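(* Let $\Gamma$ be a connected weighted graph satisfying the Sunada-Sy condition and admitting a Følner sequence. Let $G$ be a group acting on $\Gamma$ (no freeness hypothesis is made). Assume the weights $m_V$ and $m_E$ are $G$-invariant. Let $H=\Delta+q$ be a Schrödinger operator on $\Gamma$ defined by a real valued $G$-invariant potential $q$. Suppose the action of $G$ on the vertex set $V$ of $\Gamma$ has a finite number of orbits. Let $\lambda_0\in\mathbb{R}$. The following conditions are equivalent. (1) The operator $H$ satisfies $\lambda_0$-uniqueness on any finite subset of $V$. (2) There exists a Følner sequence $(\Omega_n)$ in $V$ such that $H$ satisfies $\lambda_0$-uniqueness on each $\Omega_n$. (3) The spectral projection $E_{\{\lambda_0\}}$ of $H$ is equal to zero. (4) The operator $H$ does not admit a $\lambda_0$-eigenfunction. (5) The operator $H$ does not admit a $\lambda_0$-eigenfunction with finite support. (6) The integrated density of states $\lambda\mapsto\tau_1(E_\lambda)$ of $H$ is continuous at $\lambda_0$.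
   Context: Graph (Serre): $\Gamma=(V,E,o,t,\iota)$ with vertex set $V$, set $E$ of oriented edges, origin and terminus maps $o,t:E\to V$, and a fixed point free involution $\iota(e)=\overline{e}$ of $E$ with $o(\overline e)=t(e)$, $t(\overline e)=o(e)$. Loops and multiple edges are allowed; local finiteness is not assumed. $E_x=\{e\in E:o(e)=x\}$. $\Gamma$ is connected if any two vertices are joined by a finite edge path; the path-metric $d(x,y)$ is the minimal length of a path from $x$ to $y$. Weighted graph: strictly positive weights $m_V:V\to\,]0,\infty[$ and $m_E:E\to\,]0,\infty[$ with $m_E(\overline e)=m_E(e)$. $l^2(V,m_V)$ is the Hilbert space of $\varphi:V\to\mathbb{C}$ with $\sum_x|\varphi(x)|^2m_V(x)<\infty$, with product $\langle\varphi,\psi\rangle=\sum_x\varphi(x)\overline{\psi(x)}m_V(x)$. Sunada-Sy condition: $\sup_{x\in V}\frac{1}{m_V(x)}\sum_{e\in E_x}m_E(e)<\infty$. Laplacian: the bounded operator on $l^2(V,m_V)$ given by $\Delta\varphi(x)=\left(\frac{1}{m_V(x)}\sum_{e\in E_x}m_E(e)\right)\varphi(x)-\frac{1}{m_V(x)}\sum_{e\in E_x}\varphi(t(e))m_E(e)$. Schrödinger operator: $H=\Delta+q$ with $q:V\to\mathbb{R}$ bounded; it is bounded and self-adjoint. A $\lambda$-eigenfunction of $H$ is a nonzero $\varphi\in l^2(V,m_V)$ with $H\varphi=\lambda\varphi$. By the Borel functional calculus of $H$, $E_{\{\lambda\}}={\bf 1}_{\{\lambda\}}(H)$ (the orthogonal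 projection onto $\mathrm{Ker}(H-\lambda)$) and $E_\lambda={\bf 1}_{]-\infty,\lambda]}(H)$. $\lambda$-uniqueness on $\Omega\subset V$: if $\varphi\in l^2(V,m_V)$ satisfies $H\varphi=\lambda\varphi$ and $\varphi(x)=0$ for all $x\in V\setminus\Omega$, then $\varphi=0$ on $V$. Group action on $\Gamma$: $G$ acts on $V$ and on $E$ with $o(ge)=go(e)$, $t(ge)=gt(e)$, $\iota(ge)=g\iota(e)$. Invariance of weights and potential: $m_V(gx)=m_V(x)$, $m_E(ge)=m_E(e)$, $q(gx)=q(x)$. A fundamental domain is a subset $D\subset V$ with $V=\bigsqcup_{x\in D}Gx$. Von Neumann trace: for a positive bounded operator $A$ on $l^2(V,m_V)$ commuting with the representation $(\pi(g)f)(x)=f(g^{-1}x)$ of $G$, $\tau_1(A)=\frac{1}{|D|}\sum_{x\in D}\langle A\delta_x,\delta_x\rangle$, where $D$ is any fundamental domain and $\delta_x$ is the characteristic function of $\{x\}$. Følner sequence in $\Gamma$: a sequence $(\Omega_n)_{n\ge0}$ of finite non-empty subsets of $V$ with $\lim_{n\to\infty}\frac{|\partial_1\Omega_n|}{|\Omega_n|}=0$, where $\partial_1\Omega=\{x\in\Omega:d(x,V\setminus\Omega)\le1\}$ and $d(x,A)=\inf_{y\in A}d(x,y)$. *)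

theory Defs
  imports
    "HOL-Analysis.Analysis"
    "HOL-Algebra.Group_Action"
    "Graph_Theory.Bidirected_Digraph"
    "Graph_Theory.Digraph_Component"
begin

section \<open>Weighted graphs\<close>

text \<open>
  A graph in the sense of Serre is a \<^locale>\<open>bidirected_digraph\<close>: the fixed point free involution
  of the edge set is \<open>arev\<close>, which that locale extends by the identity to the elements of the edge
  type that are not edges. The set of edges with origin \<open>x\<close> is \<open>out_arcs \<Gamma> x\<close>. No finiteness
  condition is included, and loops and multiple edges are allowed. Connectedness is
  \<open>strongly_connected \<Gamma>\<close>: \<open>\<Gamma>\<close> is nonempty and any two vertices are joined by a finite edge path.
\<close>

locale weighted_graph = bidirected_digraph \<Gamma> arev
  for \<Gamma> :: "('v, 'e) pre_digraph" and arev :: "'e \<Rightarrow> 'e" +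
  fixes mV :: "'v \<Rightarrow> real" and mE :: "'e \<Rightarrow> real"
  assumes mV_pos: "x \<in> verts \<Gamma> \<Longrightarrow> mV x > 0"
    and mE_pos: "e \<in> arcs \<Gamma> \<Longrightarrow> mE e > 0"
    and mE_inv: "e \<in> arcs \<Gamma> \<Longrightarrow> mE (arev e) = mE e"

definition sunada_sy :: "('v, 'e) pre_digraph \<Rightarrow> ('v \<Rightarrow> real) \<Rightarrow> ('e \<Rightarrow> real) \<Rightarrow> bool" where
  "sunada_sy \<Gamma> mV mE \<longleftrightarrow>
     (\<exists>C. \<forall>x\<in>verts \<Gamma>. mE summable_on out_arcs \<Gamma> x \<and>
        (1 / mV x) * (\<Sum>\<^sub>\<infinity>e\<in>out_arcs \<Gamma> x. mE e) \<le> C)"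

definition gdist :: "('v, 'e) pre_digraph \<Rightarrow> 'v \<Rightarrow> 'v \<Rightarrow> enat" where
  "gdist \<Gamma> x y = (INF p\<in>{p. pre_digraph.awalk \<Gamma> x p y}. enat (length p))"

definition gdist_set :: "('v, 'e) pre_digraph \<Rightarrow> 'v \<Rightarrow> 'v set \<Rightarrow> enat" where
  "gdist_set \<Gamma> x A = (INF y\<in>A. gdist \<Gamma> x y)"

text \<open>The infimum over the empty set is \<open>\<infinity>\<close>, so the whole vertex set has empty boundary.\<close>

definition boundary1 :: "('v, 'e) pre_digraph \<Rightarrow> 'v set \<Rightarrow> 'v set" where
  "boundary1 \<Gamma> \<Omega> = {x \<in> \<Omega>. gdist_set \<Gamma> x (verts \<Gamma> - \<Omega>) \<le> 1}"

definition folner_sequence :: "('v, 'e) pre_digraph \<Rightarrow> (nat \<Rightarrow> 'v set) \<Rightarrow> bool" where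
  "folner_sequence \<Gamma> \<Omega> \<longleftrightarrow>
     (\<forall>n. \<Omega> n \<subseteq> verts \<Gamma> \<and> finite (\<Omega> n) \<and> \<Omega> n \<noteq> {}) \<and>
     (\<lambda>n. real (card (boundary1 \<Gamma> (\<Omega> n))) / real (card (\<Omega> n))) \<longlonglongrightarrow> 0"

section \<open>The Hilbert space of a weighted set\<close>

text \<open>A function on the set \<open>V\<close> is represented by its extension by zero to the whole type.\<close>

definition l2 :: "'v set \<Rightarrow> ('v \<Rightarrow> real) \<Rightarrow> ('v \<Rightarrow> complex) set" where
  "l2 V m = {\<phi>. (\<forall>x. x \<notin> V \<longrightarrow> \<phi> x = 0) \<and> (\<lambda>x. (cmod (\<phi> x))\<^sup>2 * m x) summable_on V}"

definition l2_inner :: "'v set \<Rightarrow> ('v \<Rightarrow> real) \<Rightarrow> ('v \<Rightarrow> complex) \<Rightarrow> ('v \<Rightarrow> complex) \<Rightarrow> complex" where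
  "l2_inner V m \<phi> \<psi> = (\<Sum>\<^sub>\<infinity>x\<in>V. \<phi> x * cnj (\<psi> x) * complex_of_real (m x))"

definition l2_norm :: "'v set \<Rightarrow> ('v \<Rightarrow> real) \<Rightarrow> ('v \<Rightarrow> complex) \<Rightarrow> real" where
  "l2_norm V m \<phi> = sqrt (\<Sum>\<^sub>\<infinity>x\<in>V. (cmod (\<phi> x))\<^sup>2 * m x)"

text \<open>
  Operators are extensional (\<open>undefined\<close> outside \<open>l2 V m\<close>), so that equality of operators is
  equality on \<open>l2 V m\<close>.
\<close>

definition bounded_operator ::
  "'v set \<Rightarrow> ('v \<Rightarrow> real) \<Rightarrow> (('v \<Rightarrow> complex) \<Rightarrow> ('v \<Rightarrow> complex)) \<Rightarrow> bool" where
  "bounded_operator V m A \<longleftrightarrow>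
     A \<in> l2 V m \<rightarrow>\<^sub>E l2 V m \<and>
     (\<forall>\<phi>\<in>l2 V m. \<forall>\<psi>\<in>l2 V m. A (\<lambda>x. \<phi> x + \<psi> x) = (\<lambda>x. A \<phi> x + A \<psi> x)) \<and>
     (\<forall>\<phi>\<in>l2 V m. \<forall>c. A (\<lambda>x. c * \<phi> x) = (\<lambda>x. c * A \<phi> x)) \<and>
     (\<exists>C. \<forall>\<phi>\<in>l2 V m. l2_norm V m (A \<phi>) \<le> C * l2_norm V m \<phi>)"

definition zero_operator :: "'v set \<Rightarrow> ('v \<Rightarrow> real) \<Rightarrow> ('v \<Rightarrow> complex) \<Rightarrow> ('v \<Rightarrow> complex)" where
  "zero_operator V m = (\<lambda>\<phi>\<in>l2 V m. \<lambda>x. 0)"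

section \<open>Borel functional calculus\<close>

text \<open>
  For a bounded self-adjoint operator \<open>T\<close>, the spectral measure at \<open>\<phi>\<close> is the unique compactly
  supported finite Borel measure \<open>\<mu>\<close> on the real line with \<open>\<langle>p(T)\<phi>,\<phi>\<rangle> = \<integral> p d\<mu>\<close> for all
  polynomials \<open>p\<close>, equivalently for all monomials. For a bounded Borel function \<open>f\<close>, the operator
  \<open>f(T)\<close> is then determined by \<open>\<langle>f(T)\<phi>,\<phi>\<rangle> = \<integral> f d\<mu>\<close> for all \<open>\<phi>\<close>, by polarization. Existence
  is the spectral theorem; for other \<open>T\<close> and \<open>f\<close> the definitions carry no meaning.
\<close>

definition is_spectral_measure ::
  "'v set \<Rightarrow> ('v \<Rightarrow> real) \<Rightarrow> (('v \<Rightarrow> complex) \<Rightarrow> ('v \<Rightarrow> complex)) \<Rightarrow> ('v \<Rightarrow> complex) \<Rightarrow> real measure \<Rightarrow> bool"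
  where
  "is_spectral_measure V m T \<phi> \<mu> \<longleftrightarrow>
     sets \<mu> = sets borel \<and> finite_measure \<mu> \<and>
     (\<exists>R. emeasure \<mu> (- {-R..R}) = 0) \<and>
     (\<forall>n. l2_inner V m ((T ^^ n) \<phi>) \<phi> = complex_of_real (\<integral>t. t ^ n \<partial>\<mu>))"

definition spectral_measure ::
  "'v set \<Rightarrow> ('v \<Rightarrow> real) \<Rightarrow> (('v \<Rightarrow> complex) \<Rightarrow> ('v \<Rightarrow> complex)) \<Rightarrow> ('v \<Rightarrow> complex) \<Rightarrow> real measure"
  where
  "spectral_measure V m T \<phi> = (THE \<mu>. is_spectral_measure V m T \<phi> \<mu>)"

definition borel_calculus ::
  "'v set \<Rightarrow> ('v \<Rightarrow> real) \<Rightarrow> (('v \<Rightarrow> complex) \<Rightarrow> ('v \<Rightarrow> complex)) \<Rightarrow> (real \<Rightarrow> complex)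
     \<Rightarrow> ('v \<Rightarrow> complex) \<Rightarrow> ('v \<Rightarrow> complex)"
  where
  "borel_calculus V m T f =
     (THE A. bounded_operator V m A \<and>
        (\<forall>\<phi>\<in>l2 V m. l2_inner V m (A \<phi>) \<phi> = (\<integral>t. f t \<partial>(spectral_measure V m T \<phi>))))"

definition spectral_projection ::
  "'v set \<Rightarrow> ('v \<Rightarrow> real) \<Rightarrow> (('v \<Rightarrow> complex) \<Rightarrow> ('v \<Rightarrow> complex)) \<Rightarrow> real set
     \<Rightarrow> ('v \<Rightarrow> complex) \<Rightarrow> ('v \<Rightarrow> complex)"
  where
  "spectral_projection V m T B = borel_calculus V m T (indicator B)"

section \<open>Schroedinger operators\<close>

definition laplacian ::
  "('v, 'e) pre_digraph \<Rightarrow> ('v \<Rightarrow> real) \<Rightarrow> ('e \<Rightarrow> real) \<Rightarrow> ('v \<Rightarrow> complex) \<Rightarrow> ('v \<Rightarrow> complex)" where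
  "laplacian \<Gamma> mV mE =
     (\<lambda>\<phi>\<in>l2 (verts \<Gamma>) mV. \<lambda>x. if x \<in> verts \<Gamma> then
        complex_of_real ((1 / mV x) * (\<Sum>\<^sub>\<infinity>e\<in>out_arcs \<Gamma> x. mE e)) * \<phi> x
        - complex_of_real (1 / mV x) * (\<Sum>\<^sub>\<infinity>e\<in>out_arcs \<Gamma> x. \<phi> (head \<Gamma> e) * complex_of_real (mE e))
      else 0)"

definition schroedinger ::
  "('v, 'e) pre_digraph \<Rightarrow> ('v \<Rightarrow> real) \<Rightarrow> ('e \<Rightarrow> real) \<Rightarrow> ('v \<Rightarrow> real)
     \<Rightarrow> ('v \<Rightarrow> complex) \<Rightarrow> ('v \<Rightarrow> complex)" where
  "schroedinger \<Gamma> mV mE q =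
     (\<lambda>\<phi>\<in>l2 (verts \<Gamma>) mV. \<lambda>x. laplacian \<Gamma> mV mE \<phi> x + complex_of_real (q x) * \<phi> x)"

definition eigenfunction ::
  "'v set \<Rightarrow> ('v \<Rightarrow> real) \<Rightarrow> (('v \<Rightarrow> complex) \<Rightarrow> ('v \<Rightarrow> complex)) \<Rightarrow> real \<Rightarrow> ('v \<Rightarrow> complex) \<Rightarrow> bool"
  where
  "eigenfunction V m T l \<phi> \<longleftrightarrow>
     \<phi> \<in> l2 V m \<and> \<phi> \<noteq> (\<lambda>x. 0) \<and> T \<phi> = (\<lambda>x. complex_of_real l * \<phi> x)"

definition uniqueness_on ::
  "'v set \<Rightarrow> ('v \<Rightarrow> real) \<Rightarrow> (('v \<Rightarrow> complex) \<Rightarrow> ('v \<Rightarrow> complex)) \<Rightarrow> real \<Rightarrow> 'v set \<Rightarrow> bool"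
  where
  "uniqueness_on V m T l \<Omega> \<longleftrightarrow>
     (\<forall>\<phi>\<in>l2 V m. T \<phi> = (\<lambda>x. complex_of_real l * \<phi> x) \<and> (\<forall>x\<in>V - \<Omega>. \<phi> x = 0)
        \<longrightarrow> (\<forall>x\<in>V. \<phi> x = 0))"

section \<open>Group actions and the von Neumann trace\<close>

definition graph_action ::
  "('g, 'r) monoid_scheme \<Rightarrow> ('v, 'e) pre_digraph \<Rightarrow> ('e \<Rightarrow> 'e)
     \<Rightarrow> ('g \<Rightarrow> 'v \<Rightarrow> 'v) \<Rightarrow> ('g \<Rightarrow> 'e \<Rightarrow> 'e) \<Rightarrow> bool" where
  "graph_action G \<Gamma> arev aV aE \<longleftrightarrow>
     group_action G (verts \<Gamma>) aV \<and> group_action G (arcs \<Gamma>) aE \<and>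
     (\<forall>g\<in>carrier G. \<forall>e\<in>arcs \<Gamma>.
        tail \<Gamma> (aE g e) = aV g (tail \<Gamma> e) \<and>
        head \<Gamma> (aE g e) = aV g (head \<Gamma> e) \<and>
        arev (aE g e) = aE g (arev e))"

definition invariant_under ::
  "('g, 'r) monoid_scheme \<Rightarrow> 'a set \<Rightarrow> ('g \<Rightarrow> 'a \<Rightarrow> 'a) \<Rightarrow> ('a \<Rightarrow> real) \<Rightarrow> bool" where
  "invariant_under G X a f \<longleftrightarrow> (\<forall>g\<in>carrier G. \<forall>x\<in>X. f (a g x) = f x)"

definition fundamental_domain ::
  "('g, 'r) monoid_scheme \<Rightarrow> 'v set \<Rightarrow> ('g \<Rightarrow> 'v \<Rightarrow> 'v) \<Rightarrow> 'v set \<Rightarrow> bool" where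
  "fundamental_domain G V a D \<longleftrightarrow>
     D \<subseteq> V \<and> (\<Union>x\<in>D. Group_Action.orbit G a x) = V \<and>
     disjoint_family_on (Group_Action.orbit G a) D"

text \<open>
  For operators commuting with the action of the group on \<open>l2 V m\<close> the value does not depend on
  the fundamental domain \<open>D\<close>.
\<close>

definition vn_trace ::
  "'v set \<Rightarrow> ('v \<Rightarrow> real) \<Rightarrow> 'v set \<Rightarrow> (('v \<Rightarrow> complex) \<Rightarrow> ('v \<Rightarrow> complex)) \<Rightarrow> complex" where
  "vn_trace V m D A =
     (1 / of_nat (card D)) * (\<Sum>x\<in>D. l2_inner V m (A (indicator {x})) (indicator {x}))"

definition integrated_density_of_states ::
  "'v set \<Rightarrow> ('v \<Rightarrow> real) \<Rightarrow> 'v set \<Rightarrow> (('v \<Rightarrow> complex) \<Rightarrow> ('v \<Rightarrow> complex)) \<Rightarrow> real \<Rightarrow> complex" where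
  "integrated_density_of_states V m D T l = vn_trace V m D (spectral_projection V m T {..l})"

end

theory Submission
  imports Defs "HOL-Probability.Helly_Selection" "HOL-Probability.Probability_Mass_Function"
    "HOL-Computational_Algebra.Polynomial" "HOL-Real_Asymp.Real_Asymp"
begin

text \<open>
  All implications but one are formal once the spectral projections are available. The substance
  is that uniqueness on the members of a Folner sequence excludes eigenfunctions
  (\<open>no_eigenfunction_if_folner_uniqueness\<close>).

  Let \<open>K\<close> be the kernel of \<open>H - l0\<close>, and let \<open>H\<close> have the uniqueness property on a finite set \<open>\<Omega>\<close>
  with boundary \<open>\<partial>\<Omega>\<close>. If \<open>\<phi> \<in> K\<close> and its truncation \<open>\<psi>\<close> to \<open>\<Omega>\<close> satisfies \<open>\<psi> = H \<psi> = 0\<close> on \<open>\<partial>\<Omega>\<close>, then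
  \<open>\<psi> \<in> K\<close> (\<open>cut_off_eigen\<close>), so \<open>\<psi> = 0\<close>. Hence the restrictions of \<open>K\<close> to \<open>\<Omega>\<close> form a space of complex
  dimension at most \<open>2 |\<partial>\<Omega>|\<close>. If some \<open>\<phi> \<in> K\<close> satisfies \<open>\<phi> x0 = 1\<close>, then for every \<open>x\<close> in the orbit \<open>O\<close>
  of \<open>x0\<close> a translate of \<open>\<phi>\<close> is an element of \<open>K\<close> of the same norm with value one at \<open>x\<close>. By Bessel's
  inequality a space of dimension \<open>d\<close> contains such elements for at most a constant times \<open>d\<close> points,
  so \<open>|\<Omega> \<inter> O| \<le> M |\<partial>\<Omega>|\<close> (\<open>card_orbit_le_boundary\<close>). On the other hand, all vertices are at bounded
  distance from \<open>O\<close>, which gives \<open>|\<Omega>| \<le> K' (|\<Omega> \<inter> O| + 2 |\<partial>\<Omega>|)\<close> (\<open>card_le_orbit_boundary\<close>): vertices with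
  infinitely many neighbours always belong to \<open>\<partial>\<Omega>\<close>, and the Sunada-Sy condition bounds the number of
  the other neighbours of any vertex. Together, \<open>|\<partial>\<Omega>| / |\<Omega>|\<close> is bounded below, which a Folner
  sequence contradicts.

  The spectral theory is developed in a real Hilbert space, with the real part of the inner product.
  For \<open>0 \<le> T \<le> 1\<close> the operators \<open>T\<^sup>j (1 - T)\<^sup>k\<close> are positive, so the moments \<open>\<langle>T\<^sup>n x, x\<rangle>\<close> solve
  Hausdorff's moment problem, and Helly's theorem yields a measure with these moments
  (\<open>exists_moment_measure_unit\<close>); it is unique by Weierstrass approximation. For a bounded pointwise
  limit \<open>f\<close> of polynomials \<open>p\<^sub>k\<close> the vectors \<open>p\<^sub>k(T)x\<close> converge, by the isometry between \<open>p(T)x\<close> and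
  \<open>p\<close> in the \<open>L\<^sup>2\<close> space of the measure (locale \<open>spectral_limit\<close>). For the indicator of \<open>{l0}\<close> the
  limit operator fixes \<open>K\<close> and has its values in \<open>K\<close>, so it vanishes exactly when \<open>K\<close> does.

  The integrated density of states averages the distribution functions of the spectral measures
  of the functions \<open>\<delta>\<^sub>d\<close> for \<open>d \<in> D\<close>. Its jump at \<open>l0\<close> is zero if and only if none of them has an atom
  at \<open>l0\<close>, which means that all functions in \<open>K\<close> vanish on \<open>D\<close> (\<open>spectral_atom_iff\<close>). By translation
  they then vanish everywhere.
\<close>

section \<open>Polynomials in a self-adjoint operator\<close>

text \<open>
The polynomial functional calculus \<open>p(T)\<close>, by Horner's scheme with composition as product.
\<close>

definition poly_op :: "real poly \<Rightarrow> ('a \<Rightarrow> 'a) \<Rightarrow> 'a::real_vector \<Rightarrow> 'a" where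
  "poly_op p T = fold_coeffs (\<lambda>a g x. a *\<^sub>R x + T (g x)) p (\<lambda>x. 0)"

lemma poly_op_0 [simp]: "poly_op 0 T x = 0"
  by (simp add: poly_op_def)

context
  fixes T :: "'a::real_vector \<Rightarrow> 'a"
  assumes T: "linear T"
begin

interpretation linear T by (rule T)

lemma poly_op_pCons [simp]: "poly_op (pCons a p) T x = a *\<^sub>R x + T (poly_op p T x)"
  by (cases "p = 0"; cases "a = 0") (simp_all add: poly_op_def zero)

lemma poly_op_add: "poly_op (p + q) T x = poly_op p T x + poly_op q T x"
  by (induction p q rule: poly_induct2) (simp_all add: algebra_simps add)

lemma poly_op_smult: "poly_op (smult c p) T x = c *\<^sub>R poly_op p T x"
  by (induction p) (simp_all add: algebra_simps scale)

lemma poly_op_diff: "poly_op (p - q) T x = poly_op p T x - poly_op q T x"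
  using poly_op_add[of p "smult (-1) q"] poly_op_smult[of "-1" q] by simp

lemma poly_op_sum: "poly_op (sum f A) T x = (\<Sum>i\<in>A. poly_op (f i) T x)"
  by (induction A rule: infinite_finite_induct) (simp_all add: poly_op_add)

lemma poly_op_mult: "poly_op (p * q) T x = poly_op p T (poly_op q T x)"
  by (induction p) (simp_all add: poly_op_add poly_op_smult)

lemma linear_poly_op: "linear (poly_op p T)"
  by (induction p)
    (auto intro!: linearI simp: add scale linear_add linear_scale algebra_simps)

lemma poly_op_commute:
  assumes "linear S" and "\<And>x. S (T x) = T (S x)"
  shows "S (poly_op p T x) = poly_op p T (S x)"
  using assms by (induction p) (simp_all add: linear_add linear_scale linear_0)

lemma poly_op_monom: "poly_op (monom 1 n) T x = (T ^^ n) x"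
  by (induction n) (simp_all add: monom_0 monom_Suc zero)

end

lemma poly_op_altdef:
  assumes "linear T"
  shows "poly_op p T x = (\<Sum>i\<le>degree p. coeff p i *\<^sub>R (T ^^ i) x)"
proof -
  have "poly_op p T x = poly_op (\<Sum>i\<le>degree p. smult (coeff p i) (monom 1 i)) T x"
    by (simp add: smult_monom poly_as_sum_of_monoms)
  then show ?thesis
    by (simp only: poly_op_sum[OF assms] poly_op_smult[OF assms] poly_op_monom[OF assms])
qed

lemma poly_op_pcompose:
  assumes "linear T"
  shows "poly_op (p \<circ>\<^sub>p q) T x = poly_op p (poly_op q T) x"
  by (induction p)
    (simp_all add: pcompose_pCons assms poly_op_add poly_op_mult linear_poly_op linear_0)

locale selfadjoint = bounded_linear T for T :: "'a::real_inner \<Rightarrow> 'a" +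
  assumes selfadjoint: "T x \<bullet> y = x \<bullet> T y"
begin

lemma selfadjoint_poly_op: "poly_op p T x \<bullet> y = x \<bullet> poly_op p T y"
proof (induction p arbitrary: x y)
  case (pCons a p)
  have "T (poly_op p T x) \<bullet> y = x \<bullet> T (poly_op p T y)"
    using poly_op_commute[OF linear_axioms linear_axioms] pCons.IH selfadjoint by metis
  then show ?case
    by (simp add: linear_axioms inner_add_left inner_add_right)
qed simp

lemma bounded_linear_poly_op: "bounded_linear (poly_op p T)"
proof (induction p)
  case 0
  have "poly_op 0 T = (\<lambda>x. 0)" by (simp add: fun_eq_iff)
  then show ?case by simp
next
  case (pCons a p)
  have eq: "poly_op (pCons a p) T = (\<lambda>x. a *\<^sub>R x + T (poly_op p T x))"
    by (simp add: linear_axioms fun_eq_iff)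
  show ?case
    unfolding eq by (intro bounded_linear_add bounded_linear_scaleR_right
        bounded_linear_compose[OF bounded_linear_axioms pCons.IH])
qed

lemma poly_op_is_selfadjoint: "selfadjoint (poly_op p T)"
  by (intro selfadjoint.intro bounded_linear_poly_op selfadjoint_axioms.intro selfadjoint_poly_op)

text \<open>
Positivity of \<open>T\<^sup>j (1 - T)\<^sup>k\<close> for \<open>0 \<le> T \<le> 1\<close> reduces to small exponents: the even
parts of \<open>j\<close> and \<open>k\<close> split off as a square \<open>p\<^sup>2\<close>, and \<open>\<langle>p(T)\<^sup>2 r(T)x, x\<rangle> = \<langle>r(T)y, y\<rangle>\<close> with
\<open>y = p(T)x\<close>. The remaining factor \<open>r\<close> is \<open>1\<close>, \<open>X\<close>, \<open>1 - X\<close>, or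
\<open>X(1 - X) = X\<^sup>2(1 - X) + (1 - X)\<^sup>2X\<close>, which is covered by the two linear cases.
\<close>

lemma bernstein_nonneg:
  assumes pos: "\<And>x. 0 \<le> T x \<bullet> x" and le1: "\<And>x. T x \<bullet> x \<le> x \<bullet> x"
  shows "0 \<le> poly_op ([:0,1:] ^ j * [:1,-1:] ^ k) T x \<bullet> x"
proof -
  let ?X = "[:0, 1:] :: real poly" and ?Y = "[:1, -1:] :: real poly"
  have lin: "linear T" by (rule linear_axioms)
  have sq: "poly_op (p * p * r) T x \<bullet> x = poly_op r T (poly_op p T x) \<bullet> poly_op p T x" for p r
  proof -
    have "poly_op (p * p * r) T x = poly_op p T (poly_op r T (poly_op p T x))"
      using poly_op_mult[OF lin, of p "r * p"] poly_op_mult[OF lin, of r p]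
      by (simp add: mult_ac)
    then show ?thesis by (simp add: selfadjoint_poly_op)
  qed
  have X: "0 \<le> poly_op (p * p * ?X) T x \<bullet> x" for p
    unfolding sq using pos by (simp add: lin zero)
  have Y: "0 \<le> poly_op (p * p * ?Y) T x \<bullet> x" for p
    unfolding sq using le1 by (simp add: lin zero inner_diff_left linear_neg)
  have one: "0 \<le> poly_op (p * p) T x \<bullet> x" for p
    using sq[of p 1] by (simp add: lin zero one_pCons)
  define p where "p = ?X ^ (j div 2) * ?Y ^ (k div 2)"
  have j: "?X ^ j = ?X ^ (j div 2) * ?X ^ (j div 2) * ?X ^ (j mod 2)"
    by (metis mult_div_mod_eq mult_2 power_add)
  have k: "?Y ^ k = ?Y ^ (k div 2) * ?Y ^ (k div 2) * ?Y ^ (k mod 2)"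
    by (metis mult_div_mod_eq mult_2 power_add)
  have jk: "?X ^ j * ?Y ^ k = p * p * (?X ^ (j mod 2) * ?Y ^ (k mod 2))"
    by (simp only: j k p_def mult_ac)
  consider "j mod 2 = 0" "k mod 2 = 0" | "j mod 2 = 1" "k mod 2 = 0"
    | "j mod 2 = 0" "k mod 2 = 1" | "j mod 2 = 1" "k mod 2 = 1"
    by linarith
  then show ?thesis
  proof cases
    case 4
    \<comment> \<open>multiply by \<open>1 = X + (1 - X)\<close>\<close>
    have "p * p * (?X * ?Y) = (p * ?X) * (p * ?X) * ?Y + (p * ?Y) * (p * ?Y) * ?X"
    proof -
      have "?X + ?Y = 1" by (simp add: one_pCons)
      then have "p * p * (?X * ?Y) = p * p * (?X * ?Y) * (?X + ?Y)" by simp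
      then show ?thesis by (simp only: algebra_simps)
    qed
    then have "poly_op (p * p * (?X * ?Y)) T x \<bullet> x =
        poly_op ((p * ?X) * (p * ?X) * ?Y) T x \<bullet> x + poly_op ((p * ?Y) * (p * ?Y) * ?X) T x \<bullet> x"
      by (simp only: poly_op_add[OF lin] inner_add_left)
    then show ?thesis
      using X[of "p * ?Y"] Y[of "p * ?X"] 4 unfolding jk by simp
  qed (use X[of p] Y[of p] one[of p] in \<open>simp_all add: jk\<close>)
qed

end

section \<open>The moment problem on the unit interval\<close>

definition bernstein_poly :: "nat \<Rightarrow> nat \<Rightarrow> real poly" where
  "bernstein_poly n k = smult (of_nat (n choose k)) ([:0, 1:] ^ k * [:1, -1:] ^ (n - k))"

lemma sum_bernstein_poly: "(\<Sum>k\<le>n. bernstein_poly n k) = 1"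
proof -
  have "([:0, 1:] + [:1, -1:] :: real poly) ^ n = 
      (\<Sum>k\<le>n. of_nat (n choose k) * [:0, 1:] ^ k * [:1, -1:] ^ (n - k))"
    by (rule binomial_ring)
  also have "[:0, 1:] + [:1, -1:] = (1 :: real poly)" by (simp add: one_pCons)
  finally show ?thesis
    by (simp add: bernstein_poly_def of_nat_poly mult.assoc)
qed

text \<open>
Bernstein averages of the falling factorials reproduce the monomials exactly, whereas those of
\<open>(k/n)\<^sup>m\<close> do so only in the limit. Hence the moments of the discrete measures below are known
up to the error in \<open>choose_ratio_bound\<close>.
\<close>

lemma sum_choose_bernstein_poly:
  assumes "m \<le> n"
  shows "(\<Sum>k\<le>n. smult (of_nat (k choose m)) (bernstein_poly n k))
    = smult (of_nat (n choose m)) (monom 1 m)"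
proof -
  have "(\<Sum>k\<le>n. smult (of_nat (k choose m)) (bernstein_poly n k))
     = (\<Sum>k\<in>{m..n}. smult (of_nat (k choose m)) (bernstein_poly n k))"
    by (intro sum.mono_neutral_right) auto
  also have "\<dots> = (\<Sum>k\<in>{m..n}. smult (of_nat (n choose m)) ([:0, 1:] ^ m * bernstein_poly (n - m) (k - m)))"
  proof (intro sum.cong refl)
    fix k assume k: "k \<in> {m..n}"
    have "real (k choose m) * real (n choose k) = real (n choose m) * real ((n - m) choose (k - m))"
      using choose_mult[of m k n] k by (metis atLeastAtMost_iff mult.commute of_nat_mult)
    moreover have "[:0, 1:] ^ m * [:0, 1:] ^ (k - m) = ([:0, 1 :: real:]) ^ k"
      using k by (simp flip: power_add)
    moreover have "n - m - (k - m) = n - k" using k by simp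
    ultimately show "smult (of_nat (k choose m)) (bernstein_poly n k) =
      smult (of_nat (n choose m)) ([:0, 1:] ^ m * bernstein_poly (n - m) (k - m))"
      by (simp add: bernstein_poly_def mult.assoc[symmetric])
  qed
  also have "\<dots> = (\<Sum>k\<le>n - m. smult (of_nat (n choose m)) ([:0, 1:] ^ m * bernstein_poly (n - m) k))"
    by (rule sum.reindex_bij_witness[where i = "\<lambda>k. k + m" and j = "\<lambda>k. k - m"]) (use assms in auto)
  also have "\<dots> = smult (of_nat (n choose m)) ([:0, 1:] ^ m)"
  proof -
    have "(\<Sum>k\<le>n - m. smult (of_nat (n choose m)) ([:0, 1:] ^ m * bernstein_poly (n - m) k))
      = [:of_nat (n choose m):] * ([:0, 1:] ^ m * (\<Sum>k\<le>n - m. bernstein_poly (n - m) k))"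
      unfolding sum_distrib_left by simp
    then show ?thesis by (simp add: sum_bernstein_poly)
  qed
  also have "[:0, 1:] ^ m = monom (1::real) m"
    by (simp add: monom_altdef)
  finally show ?thesis .
qed

text \<open>
The quotient of the binomials is \<open>\<Prod>i<m. (k - i)/(n - i)\<close>, and each factor differs from \<open>k/n\<close> by at
most \<open>m/(n - m)\<close>; a product of factors of modulus at most one changes by at most the sum of the
changes. The formula also covers \<open>k < m\<close>, where one factor is zero.
\<close>

lemma choose_ratio_bound:
  assumes "k \<le> n" "2 * m < n"
  shows "\<bar>real (k choose m) / real (n choose m) - (real k / real n) ^ m\<bar> \<le> real m * (real m / (real n - real m))"
proof -
  let ?a = "\<lambda>i. (real k - real i) / (real n - real i)"
  have "real (k choose m) / real (n choose m) = (\<Prod>i=0..<m. ?a i)"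
    by (simp add: binomial_gbinomial gbinomial_prod_rev prod_dividef)
  moreover have "(real k / real n) ^ m = (\<Prod>i=0..<m. real k / real n)"
    by simp
  moreover have "norm ((\<Prod>i=0..<m. ?a i) - (\<Prod>i=0..<m. real k / real n))
    \<le> (\<Sum>i=0..<m. norm (?a i - real k / real n))"
  proof (rule norm_prod_diff)
    fix i assume i: "i \<in> {0..<m}"
    show "norm (?a i) \<le> 1" using i assms by (auto simp: divide_simps abs_le_iff)
    show "norm (real k / real n) \<le> 1" using assms by (auto simp: divide_simps)
  qed
  moreover have "(\<Sum>i=0..<m. norm (?a i - real k / real n)) \<le> (\<Sum>i=0..<m. real m / (real n - real m))"
  proof (rule sum_mono)
    fix i assume i: "i \<in> {0..<m}"
    have n: "0 < real n" "0 < real n - real i" "0 < real n - real m" using i assms by auto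
    have "?a i - real k / real n = - ((real i / (real n - real i)) * ((real n - real k) / real n))"
      using n by (simp add: field_simps)
    then have "norm (?a i - real k / real n) = (real i / (real n - real i)) * ((real n - real k) / real n)"
      using n assms by (simp add: abs_mult)
    also have "\<dots> \<le> (real i / (real n - real i)) * 1"
      using n assms by (intro mult_left_mono) (auto simp: divide_simps)
    also have "\<dots> \<le> real m / (real n - real m)"
      using n i by (auto intro!: frac_le)
    finally show "norm (?a i - real k / real n) \<le> real m / (real n - real m)" .
  qed
  ultimately show ?thesis by simp
qed

text \<open>
The condition of \<open>is_spectral_measure\<close> in a real Hilbert space. A complex Hilbert space is a real
one for the real part of its inner product, and the moments of a self-adjoint operator are real.
\<close>

definition moment_measure :: "('a \<Rightarrow> 'a) \<Rightarrow> 'a::real_inner \<Rightarrow> real measure \<Rightarrow> bool" where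
  "moment_measure T x \<mu> \<longleftrightarrow>
     sets \<mu> = sets borel \<and> finite_measure \<mu> \<and> (\<exists>R. emeasure \<mu> (- {-R..R}) = 0) \<and>
     (\<forall>n. (T ^^ n) x \<bullet> x = (\<integral>t. t ^ n \<partial>\<mu>))"

text \<open>
Hausdorff's solution of the moment problem. The numbers
\<open>(n choose k) \<langle>T\<^sup>k (1 - T)\<^bsup>n-k\<^esup> x, x\<rangle>\<close> are nonnegative and sum to \<open>\<langle>x, x\<rangle> = 1\<close>, so they are the
weights of a probability measure on the points \<open>k/n\<close>. By Helly's theorem a subsequence converges
weakly, and its limit has the moments \<open>\<langle>T\<^sup>m x, x\<rangle>\<close>.
\<close>

lemma (in selfadjoint) exists_moment_measure_unit:
  assumes pos: "\<And>x. 0 \<le> T x \<bullet> x" and le1: "\<And>x. T x \<bullet> x \<le> x \<bullet> x" and norm: "norm x = 1"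
  shows "\<exists>M. real_distribution M \<and> (AE t in M. t \<in> {0..1}) \<and> (\<forall>m. (T ^^ m) x \<bullet> x = (\<integral>t. t ^ m \<partial>M))"
proof -
  have lin: "linear T" by (rule linear_axioms)
  define w where "w n k = (if k \<le> n then poly_op (bernstein_poly n k) T x \<bullet> x else 0)" for n k
  have w_nonneg: "0 \<le> w n k" for n k
    using bernstein_nonneg[OF pos le1] by (simp add: w_def bernstein_poly_def poly_op_smult lin)
  have w_sum: "(\<Sum>k\<le>n. w n k) = 1" for n
  proof -
    have "(\<Sum>k\<le>n. w n k) = poly_op (\<Sum>k\<le>n. bernstein_poly n k) T x \<bullet> x"
      by (simp add: w_def poly_op_sum[OF lin] inner_sum_left)
    then show ?thesis
      using norm by (simp add: sum_bernstein_poly one_pCons lin zero norm_eq_1)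
  qed
  have w_choose: "(\<Sum>k\<le>n. real (k choose m) / real (n choose m) * w n k) = (T ^^ m) x \<bullet> x" if "m \<le> n" for m n
  proof -
    have "(\<Sum>k\<le>n. real (k choose m) * w n k) = 
        poly_op (\<Sum>k\<le>n. smult (of_nat (k choose m)) (bernstein_poly n k)) T x \<bullet> x"
      by (simp add: w_def poly_op_sum[OF lin] inner_sum_left poly_op_smult[OF lin])
    also have "\<dots> = real (n choose m) * ((T ^^ m) x \<bullet> x)"
      using that by (simp add: sum_choose_bernstein_poly poly_op_smult[OF lin] poly_op_monom[OF lin])
    finally show ?thesis
      using that by (simp add: sum_divide_distrib[symmetric] field_simps)
  qed
  define P where "P n = embed_pmf (w n)" for n
  have pmf_P: "pmf (P n) k = w n k" for n k
    unfolding P_def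
  proof (rule pmf_embed_pmf)
    have "(\<integral>\<^sup>+k. ennreal (w n k) \<partial>count_space UNIV) = (\<Sum>k\<le>n. ennreal (w n k))"
      by (rule nn_integral_count_space') (auto simp: w_def)
    then show "(\<integral>\<^sup>+k. ennreal (w n k) \<partial>count_space UNIV) = 1"
      by (simp add: sum_ennreal w_nonneg w_sum)
  qed (rule w_nonneg)
  \<comment> \<open>the points \<open>k/n\<close>, with values in the unit interval also for \<open>k > n\<close>, where the weight is zero\<close>
  define g where "g n k = min (real k) (real n) / real n" for n k :: nat
  have g01: "g n k \<in> {0..1}" for n k by (auto simp: g_def divide_simps)
  define \<mu> where "\<mu> n = distr (measure_pmf (P n)) borel (g n)" for n
  have dist: "real_distribution (\<mu> n)" for n
    unfolding \<mu>_def by (intro prob_space.real_distribution_distr measure_pmf.prob_space_axioms) simp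
  have integral_\<mu>: "(\<integral>t. f t \<partial>\<mu> n) = (\<Sum>k\<le>n. f (real k / real n) * w n k)"
    if "f \<in> borel_measurable borel" for f :: "real \<Rightarrow> real" and n
  proof -
    have "(\<integral>t. f t \<partial>\<mu> n) = (\<integral>k. f (g n k) \<partial>measure_pmf (P n))"
      unfolding \<mu>_def using that by (subst integral_distr) simp_all
    also have "\<dots> = (\<Sum>k\<le>n. f (g n k) * pmf (P n) k)"
      by (rule integral_measure_pmf_real) (auto simp: set_pmf_iff pmf_P w_def split: if_splits)
    also have "\<dots> = (\<Sum>k\<le>n. f (real k / real n) * w n k)"
      by (intro sum.cong) (auto simp: g_def pmf_P)
    finally show ?thesis .
  qed
  have "tight \<mu>"
    unfolding tight_def
  proof (intro conjI allI impI dist)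
    fix e :: real assume "0 < e"
    have "measure (\<mu> n) {-1<..1} = 1" for n
    proof -
      have "g n -` {-1<..1} = UNIV" using g01[of n]
        by (auto simp: greaterThanAtMost_def) (smt (verit, best))
      then show ?thesis
        unfolding \<mu>_def by (subst measure_distr) (simp_all add: measure_pmf.prob_space[simplified])
    qed
    then show "\<exists>a b. a < b \<and> (\<forall>n. 1 - e < measure (\<mu> n) {a<..b})"
      using \<open>0 < e\<close> by (intro exI[of _ "-1"] exI[of _ 1]) simp
  qed
  then obtain r M where r: "strict_mono r" and M: "real_distribution M"
      and conv: "weak_conv_m (\<mu> \<circ> id \<circ> r) M"
    using tight_imp_convergent_subsubsequence[of \<mu> id] strict_mono_id by blast
  interpret M: real_distribution M by (rule M)
  \<comment> \<open>weak convergence is tested on bounded functions, so \<open>t\<close> is replaced by its truncation to the unit interval\<close>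
  define c where "c t = max 0 (min 1 t)" for t :: real
  have c01: "c t \<in> {0..1}" and c_id: "t \<in> {0..1} \<Longrightarrow> c t = t" for t
    by (auto simp: c_def)
  have c_cont: "isCont c t" for t unfolding c_def by (intro continuous_intros)
  have lim: "(\<lambda>n. \<integral>t. f t \<partial>\<mu> (r n)) \<longlonglongrightarrow> (\<integral>t. f t \<partial>M)"
    if "\<And>t. isCont f t" "\<And>t. norm (f t) \<le> 1" for f :: "real \<Rightarrow> real"
    using weak_conv_imp_integral_bdd_continuous_conv[of "\<mu> \<circ> id \<circ> r" M f 1] dist M conv that
    by (simp add: o_def)
  have supp: "AE t in M. t \<in> {0..1}"
  proof -
    \<comment> \<open>a bounded continuous function that vanishes exactly on the unit interval\<close>
    define f where "f t = min 1 \<bar>t - c t\<bar>" for t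
    have f_cont: "isCont f t" for t unfolding f_def by (intro continuous_intros c_cont)
    then have f_meas [measurable]: "f \<in> borel_measurable borel"
      by (intro borel_measurable_continuous_onI continuous_at_imp_continuous_on) auto
    have "(\<integral>t. f t \<partial>\<mu> n) = 0" for n
      by (subst integral_\<mu>) (auto intro!: sum.neutral simp: f_def c_def divide_simps)
    moreover have "(\<lambda>n. \<integral>t. f t \<partial>\<mu> (r n)) \<longlonglongrightarrow> (\<integral>t. f t \<partial>M)"
      by (intro lim f_cont) (auto simp: f_def)
    ultimately have "(\<integral>t. f t \<partial>M) = 0" by (simp add: LIMSEQ_const_iff)
    moreover have "integrable M f"
      by (rule M.integrable_const_bound[of _ 1]) (auto simp: f_def)
    ultimately have "AE t in M. f t = 0"
      by (subst (asm) integral_nonneg_eq_0_iff_AE) (auto simp: f_def)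
    then show ?thesis
      by (rule AE_mp) (auto intro!: AE_I2 simp: f_def c_def split: if_splits)
  qed
  moreover have "(T ^^ m) x \<bullet> x = (\<integral>t. t ^ m \<partial>M)" for m
  proof -
    have c_meas: "(\<lambda>t. c t ^ m) \<in> borel_measurable borel"
      by (intro borel_measurable_continuous_onI continuous_at_imp_continuous_on ballI isCont_power c_cont)
    have bound: "\<bar>(\<integral>t. c t ^ m \<partial>\<mu> n) - (T ^^ m) x \<bullet> x\<bar> \<le> real m * (real m / (real n - real m))"
      if "2 * m < n" for n
    proof -
      have "(\<integral>t. c t ^ m \<partial>\<mu> n) = (\<Sum>k\<le>n. (real k / real n) ^ m * w n k)"
      proof (subst integral_\<mu>[OF c_meas], intro sum.cong refl)
        fix k assume "k \<in> {..n}"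
        then have "c (real k / real n) = real k / real n"
          by (intro c_id) (auto simp: divide_simps)
        then show "c (real k / real n) ^ m * w n k = (real k / real n) ^ m * w n k" by simp
      qed
      also have "\<dots> - (T ^^ m) x \<bullet> x
        = (\<Sum>k\<le>n. ((real k / real n) ^ m - real (k choose m) / real (n choose m)) * w n k)"
        using w_choose[of m n] that by (simp add: left_diff_distrib sum_subtractf)
      also have "\<bar>\<dots>\<bar> \<le> (\<Sum>k\<le>n. real m * (real m / (real n - real m)) * w n k)"
      proof (rule order_trans[OF sum_abs sum_mono])
        fix k assume "k \<in> {..n}"
        then have "\<bar>(real k / real n) ^ m - real (k choose m) / real (n choose m)\<bar>
            \<le> real m * (real m / (real n - real m))"
          using choose_ratio_bound[of k n m] that by (simp add: abs_minus_commute)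
        from mult_right_mono[OF this w_nonneg[of n k]]
        show "\<bar>((real k / real n) ^ m - real (k choose m) / real (n choose m)) * w n k\<bar>
            \<le> real m * (real m / (real n - real m)) * w n k"
          using w_nonneg[of n k] by (simp add: abs_mult)
      qed
      also have "\<dots> = real m * (real m / (real n - real m))"
        using w_sum[of n] by (simp only: sum_distrib_left[symmetric] mult_1_right)
      finally show ?thesis .
    qed
    have "(\<lambda>n. (\<integral>t. c t ^ m \<partial>\<mu> n) - (T ^^ m) x \<bullet> x) \<longlonglongrightarrow> 0"
    proof (rule Lim_null_comparison)
      show "\<forall>\<^sub>F n in sequentially. norm ((\<integral>t. c t ^ m \<partial>\<mu> n) - (T ^^ m) x \<bullet> x)
          \<le> real m * (real m / (real n - real m))"
        using eventually_gt_at_top[of "2 * m"] by eventually_elim (use bound in simp)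
      show "(\<lambda>n. real m * (real m / (real n - real m))) \<longlonglongrightarrow> 0"
        by real_asymp
    qed
    then have "(\<lambda>n. \<integral>t. c t ^ m \<partial>\<mu> n) \<longlonglongrightarrow> (T ^^ m) x \<bullet> x"
      by (simp add: LIM_zero_iff)
    then have "(\<lambda>n. \<integral>t. c t ^ m \<partial>\<mu> (r n)) \<longlonglongrightarrow> (T ^^ m) x \<bullet> x"
      using LIMSEQ_subseq_LIMSEQ[OF _ r] by (simp add: o_def)
    moreover have "(\<lambda>n. \<integral>t. c t ^ m \<partial>\<mu> (r n)) \<longlonglongrightarrow> (\<integral>t. c t ^ m \<partial>M)"
      by (intro lim isCont_power c_cont) (use c01 in \<open>auto simp: power_le_one\<close>)
    ultimately have "(T ^^ m) x \<bullet> x = (\<integral>t. c t ^ m \<partial>M)" by (rule LIMSEQ_unique)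
    also have "\<dots> = (\<integral>t. t ^ m \<partial>M)"
    proof (rule integral_cong_AE)
      show "(\<lambda>t. c t ^ m) \<in> borel_measurable M" using c_meas by simp
      show "AE t in M. c t ^ m = t ^ m" using supp by eventually_elim (simp add: c_id)
    qed simp
    finally show ?thesis .
  qed
  ultimately show ?thesis using M by blast
qed

section \<open>Spectral measures of bounded self-adjoint operators\<close>

lemma integrable_AE_bounded:
  fixes f :: "real \<Rightarrow> real"
  assumes "finite_measure \<mu>" "sets \<mu> = sets borel" "f \<in> borel_measurable borel"
    and "AE t in \<mu>. \<bar>t\<bar> \<le> R" "\<And>t. \<bar>t\<bar> \<le> R \<Longrightarrow> \<bar>f t\<bar> \<le> B"
  shows "integrable \<mu> f"
proof (rule finite_measure.integrable_const_bound[OF assms(1)])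
  show "AE t in \<mu>. norm (f t) \<le> B"
    using assms(4) by eventually_elim (use assms(5) in simp)
  show "f \<in> borel_measurable \<mu>"
    using assms(3) measurable_cong_sets[OF assms(2) refl] by blast
qed

lemma integrable_continuous_AE_bounded:
  fixes f :: "real \<Rightarrow> real"
  assumes "finite_measure \<mu>" "sets \<mu> = sets borel"
    and "AE t in \<mu>. \<bar>t\<bar> \<le> R" "continuous_on UNIV f"
  shows "integrable \<mu> f"
proof -
  have "bounded (f ` {-R..R})"
    using assms(4) by (intro compact_imp_bounded compact_continuous_image)
      (auto intro: continuous_on_subset)
  then obtain B where "\<forall>t\<in>{-R..R}. \<bar>f t\<bar> \<le> B"
    by (auto simp: bounded_iff)
  then show ?thesis
    using assms by (intro integrable_AE_bounded[where R = R and B = B])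
      (auto intro: borel_measurable_continuous_onI simp: abs_le_iff)
qed

lemma integral_poly_moments:
  assumes "linear T" "finite_measure \<mu>" "sets \<mu> = sets borel" "AE t in \<mu>. \<bar>t\<bar> \<le> R"
    and "\<And>n. (T ^^ n) x \<bullet> x = (\<integral>t. t ^ n \<partial>\<mu>)"
  shows "poly_op p T x \<bullet> x = (\<integral>t. poly p t \<partial>\<mu>)"
proof -
  have int: "integrable \<mu> (\<lambda>t. coeff p i * t ^ i)" for i
    using assms by (intro integrable_continuous_AE_bounded[where R = R] continuous_intros)
  have "(\<integral>t. poly p t \<partial>\<mu>) = (\<integral>t. (\<Sum>i\<le>degree p. coeff p i * t ^ i) \<partial>\<mu>)"
    by (simp add: poly_altdef)
  also have "\<dots> = (\<Sum>i\<le>degree p. coeff p i * (\<integral>t. t ^ i \<partial>\<mu>))"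
    using int by (subst Bochner_Integration.integral_sum) simp_all
  finally show ?thesis
    by (simp add: poly_op_altdef[OF assms(1)] inner_sum_left assms(5))
qed

lemma emeasure_outside_iff_AE:
  assumes "sets \<mu> = sets borel"
  shows "emeasure \<mu> (- {-R..R}) = 0 \<longleftrightarrow> (AE t in \<mu>. \<bar>t\<bar> \<le> (R::real))"
proof -
  have "space \<mu> = UNIV" using sets_eq_imp_space_eq[OF assms] by simp
  then have "{t \<in> space \<mu>. \<not> \<bar>t\<bar> \<le> R} = - {-R..R}" by (auto simp: abs_le_iff)
  then show ?thesis
    by (subst AE_iff_measurable[where N = "- {-R..R}"]) (use assms in auto)
qed

context selfadjoint
begin

text \<open>
Affine rescaling: if \<open>\<parallel>T\<parallel> \<le> R\<close> then \<open>S = (T + R)/(2R)\<close> satisfies \<open>0 \<le> S \<le> 1\<close>, and the measure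
of \<open>S\<close> is transported by \<open>t \<mapsto> 2Rt - R\<close>.
\<close>

lemma exists_moment_measure:
  assumes R: "0 < R" "\<And>y. norm (T y) \<le> R * norm y"
  shows "\<exists>\<mu>. moment_measure T x \<mu> \<and> (AE t in \<mu>. \<bar>t\<bar> \<le> R)"
proof (cases "x = 0")
  case True
  have "(T ^^ n) 0 = 0" for n by (induction n) (simp_all add: zero)
  then have "moment_measure T x (null_measure borel)"
    using True by (auto simp: moment_measure_def intro!: finite_measureI)
  then show ?thesis by (intro exI[of _ "null_measure borel"]) (simp add: AE_iff_null null_sets_def)
next
  case False
  have lin: "linear T" by (rule linear_axioms)
  \<comment> \<open>\<open>S = (T + R)/(2R)\<close>, inverted by \<open>q\<close> below\<close>
  define S where "S = poly_op [:1/2, 1/(2*R):] T"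
  interpret S: selfadjoint S unfolding S_def by (rule poly_op_is_selfadjoint)
  have S_eq: "S y = (1/2) *\<^sub>R y + (1/(2*R)) *\<^sub>R T y" for y
    by (simp add: S_def lin zero scale)
  have bound: "\<bar>T y \<bullet> y\<bar> \<le> R * (y \<bullet> y)" for y
  proof -
    have "\<bar>T y \<bullet> y\<bar> \<le> norm (T y) * norm y" by (rule Cauchy_Schwarz_ineq2)
    also have "\<dots> \<le> R * norm y * norm y" using R by (intro mult_right_mono) auto
    finally show ?thesis by (simp add: power2_norm_eq_inner[symmetric] power2_eq_square)
  qed
  have S_ip: "S y \<bullet> y = (R * (y \<bullet> y) + T y \<bullet> y) / (2 * R)" for y
    using R(1) by (simp add: S_eq inner_add_left field_simps)
  have pos: "0 \<le> S y \<bullet> y" for y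
    unfolding S_ip using bound[of y] R(1) by (intro divide_nonneg_pos) auto
  have le1: "S y \<bullet> y \<le> y \<bullet> y" for y
    unfolding S_ip using bound[of y] R(1) by (simp add: divide_simps abs_le_iff)
  define u where "u = x /\<^sub>R norm x"
  have "norm u = 1" using False by (simp add: u_def)
  then obtain M where M: "real_distribution M" "AE t in M. t \<in> {0..1}"
      "\<And>m. (S ^^ m) u \<bullet> u = (\<integral>t. t ^ m \<partial>M)"
    using S.exists_moment_measure_unit[OF pos le1] by blast
  interpret M: real_distribution M by (rule M)
  define q where "q = [:-R, 2*R:]"
  have T_eq: "T = poly_op q S"
    using R(1) by (simp add: fun_eq_iff q_def S.linear_axioms S_eq S.zero scale scaleR_add_right algebra_simps)
  define N where "N = x \<bullet> x"
  have N: "0 < N" using False by (simp add: N_def)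
  define \<mu> where "\<mu> = density (distr M borel (poly q)) (\<lambda>_. ennreal N)"
  have q_meas [measurable]: "poly q \<in> borel_measurable borel"
    by (intro borel_measurable_continuous_onI continuous_intros)
  have sets: "sets \<mu> = sets borel" by (simp add: \<mu>_def)
  have AE: "AE t in \<mu>. \<bar>t\<bar> \<le> R"
  proof -
    have "AE t in M. \<bar>poly q t\<bar> \<le> R"
      using M(2)
    proof eventually_elim
      case (elim t)
      then have "0 \<le> R * t" "R * t \<le> R * 1" using R(1) by (auto intro!: mult_left_mono)
      then show ?case by (simp add: q_def abs_le_iff mult.commute)
    qed
    then show ?thesis
      unfolding \<mu>_def using N by (simp add: AE_density AE_distr_iff)
  qed
  have fin: "finite_measure \<mu>"
    by (rule finite_measureI)
      (simp add: \<mu>_def emeasure_density emeasure_distr M.emeasure_space_1[simplified] ennreal_mult_eq_top_iff)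
  have "(T ^^ n) x \<bullet> x = (\<integral>t. t ^ n \<partial>\<mu>)" for n
  proof -
    have "(\<integral>t. t ^ n \<partial>\<mu>) = (\<integral>t. N * t ^ n \<partial>distr M borel (poly q))"
      unfolding \<mu>_def using N by (subst integral_density) auto
    also have "\<dots> = N * (\<integral>t. poly q t ^ n \<partial>M)"
      by (subst integral_distr) auto
    also have "(\<integral>t. poly q t ^ n \<partial>M) = (\<integral>t. poly (monom 1 n \<circ>\<^sub>p q) t \<partial>M)"
      by (simp add: poly_pcompose poly_monom)
    also have "\<dots> = poly_op (monom 1 n \<circ>\<^sub>p q) S u \<bullet> u"
    proof (rule integral_poly_moments[where R = 1, symmetric])
      show "AE t in M. \<bar>t\<bar> \<le> 1" using M(2) by eventually_elim auto
      show "linear S" by (rule S.linear_axioms)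
      show "finite_measure M" by (rule M.finite_measure_axioms)
    qed (use M in auto)
    also have "\<dots> = (T ^^ n) u \<bullet> u"
      by (simp add: poly_op_pcompose S.linear_axioms T_eq[symmetric] poly_op_monom lin)
    also have "(T ^^ n) u = (T ^^ n) x /\<^sub>R norm x"
      using poly_op_monom[OF lin, of n] linear_scale[OF linear_poly_op[OF lin, of "monom 1 n"]]
      by (simp add: u_def)
    finally have "(\<integral>t. t ^ n \<partial>\<mu>) =
        (norm x * inverse (norm x)) * (norm x * inverse (norm x)) * ((T ^^ n) x \<bullet> x)"
      by (simp only: u_def N_def dot_square_norm power2_eq_square inner_scaleR_left inner_scaleR_right mult_ac)
    then show ?thesis using False by simp
  qed
  then show ?thesis
    unfolding moment_measure_def using sets fin AE emeasure_outside_iff_AE[OF sets] by blast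
qed

end

text \<open>
Bounded pointwise approximation by polynomials on \<open>[-R, R]\<close>. This is the mode of convergence in
which the functional calculus is continuous, by dominated convergence; the bound \<open>2\<close> is one for
the indicator functions plus one for the uniform approximation error.
\<close>

definition poly_approx :: "real \<Rightarrow> (nat \<Rightarrow> real poly) \<Rightarrow> (real \<Rightarrow> real) \<Rightarrow> bool" where
  "poly_approx R p f \<longleftrightarrow> (\<forall>t. \<bar>t\<bar> \<le> R \<longrightarrow> (\<forall>k. \<bar>poly (p k) t\<bar> \<le> 2) \<and> (\<lambda>k. poly (p k) t) \<longlonglongrightarrow> f t)"

lemma poly_approx_of_continuous:
  assumes cont: "\<And>k. continuous_on UNIV (g k)" and bound: "\<And>k t. \<bar>g k t\<bar> \<le> 1"
    and lim: "\<And>t. (\<lambda>k. g k t) \<longlonglongrightarrow> f t"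
  shows "\<exists>p. poly_approx R p f"
proof -
  have "\<exists>q. \<forall>t\<in>{-R..R}. \<bar>g k t - poly q t\<bar> < 1 / real (Suc k)" for k
  proof -
    obtain h where h: "real_polynomial_function h" "\<And>t. t \<in> {-R..R} \<Longrightarrow> \<bar>g k t - h t\<bar> < 1 / real (Suc k)"
      using Stone_Weierstrass_real_polynomial_function[of "{-R..R}" "g k" "1 / real (Suc k)"]
        continuous_on_subset[OF cont] by auto
    obtain a n where "h = (\<lambda>t. \<Sum>i\<le>n. a i * t ^ i)"
      using h(1) real_polynomial_function_iff_sum by blast
    then have "h t = poly (\<Sum>i\<le>n. monom (a i) i) t" for t
      by (simp add: poly_sum poly_monom)
    then show ?thesis using h(2) by metis
  qed
  then obtain p where p: "\<And>k t. \<bar>t\<bar> \<le> R \<Longrightarrow> \<bar>g k t - poly (p k) t\<bar> < 1 / real (Suc k)"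
    by (metis abs_le_iff atLeastAtMost_iff minus_le_iff)
  have "poly_approx R p f"
    unfolding poly_approx_def
  proof (intro allI impI conjI)
    fix t k assume t: "\<bar>t\<bar> \<le> R"
    have "1 / real (Suc k) \<le> 1" by simp
    then show "\<bar>poly (p k) t\<bar> \<le> 2" using p[OF t, of k] bound[of k t] by linarith
    have "(\<lambda>k. g k t - poly (p k) t) \<longlonglongrightarrow> 0"
      by (rule Lim_null_comparison[OF _ LIMSEQ_inverse_real_of_nat])
        (use p[OF t] in \<open>auto simp: inverse_eq_divide intro!: always_eventually less_imp_le\<close>)
    from tendsto_diff[OF lim[of t] this] show "(\<lambda>k. poly (p k) t) \<longlonglongrightarrow> f t" by simp
  qed
  then show ?thesis by blast
qed

lemma poly_approx_atMost: "\<exists>p. poly_approx R p (indicator {..l})"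
proof (rule poly_approx_of_continuous[where g = "\<lambda>k t. max 0 (min 1 (1 - real k * (t - l)))"])
  fix t :: real
  show "(\<lambda>k. max 0 (min 1 (1 - real k * (t - l)))) \<longlonglongrightarrow> indicator {..l} t"
  proof (cases "t \<le> l")
    case True
    then have "min 1 (1 - real k * (t - l)) = 1" for k
      by (auto simp: min_def mult_le_0_iff zero_le_mult_iff)
    then show ?thesis using True by simp
  next
    case False
    then obtain K :: nat where K: "1 < real K * (t - l)"
      using reals_Archimedean3[of "t - l"] by auto
    have "\<forall>\<^sub>F k in sequentially. max 0 (min 1 (1 - real k * (t - l))) = 0"
      using eventually_ge_at_top[of K]
    proof eventually_elim
      case (elim k)
      then have "real K * (t - l) \<le> real k * (t - l)" using False by (intro mult_right_mono) auto
      then show ?case using K by simp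
    qed
    then show ?thesis using False by (simp add: tendsto_eventually)
  qed
qed (auto intro!: continuous_intros)

lemma poly_approx_singleton: "\<exists>p. poly_approx R p (indicator {l})"
proof (rule poly_approx_of_continuous[where g = "\<lambda>k t. max 0 (1 - real k * \<bar>t - l\<bar>)"])
  fix t :: real
  show "(\<lambda>k. max 0 (1 - real k * \<bar>t - l\<bar>)) \<longlonglongrightarrow> indicator {l} t"
  proof (cases "t = l")
    case False
    then obtain K :: nat where K: "1 < real K * \<bar>t - l\<bar>"
      using reals_Archimedean3[of "\<bar>t - l\<bar>"] by auto
    have "\<forall>\<^sub>F k in sequentially. max 0 (1 - real k * \<bar>t - l\<bar>) = 0"
      using eventually_ge_at_top[of K]
    proof eventually_elim
      case (elim k)
      then have "real K * \<bar>t - l\<bar> \<le> real k * \<bar>t - l\<bar>" by (intro mult_right_mono) auto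
      then show ?case using K by simp
    qed
    then show ?thesis using False by (simp add: tendsto_eventually)
  qed simp
qed (auto intro!: continuous_intros)

text \<open>
Dominated convergence; the additional function \<open>h\<close> allows the squares and products needed below.
\<close>

lemma integral_poly_approx:
  assumes \<mu>: "finite_measure \<mu>" "sets \<mu> = sets borel" "AE t in \<mu>. \<bar>t\<bar> \<le> R"
    and p: "poly_approx R p f" and f: "f \<in> borel_measurable borel"
    and h: "continuous_on UNIV (\<lambda>(a, b). h a b :: real)"
    and B: "\<And>t k. \<bar>t\<bar> \<le> R \<Longrightarrow> \<bar>h t (poly (p k) t)\<bar> \<le> B"
  shows "(\<lambda>k. \<integral>t. h t (poly (p k) t) \<partial>\<mu>) \<longlonglongrightarrow> (\<integral>t. h t (f t) \<partial>\<mu>)"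
proof (rule integral_dominated_convergence[where w = "\<lambda>_. B"])
  have meas: "(\<lambda>t. h t (g t)) \<in> borel_measurable \<mu>" if "g \<in> borel_measurable borel" for g
  proof -
    have "(\<lambda>(a, b). h a b) \<in> borel_measurable (borel \<Otimes>\<^sub>M borel)"
      unfolding borel_prod by (rule borel_measurable_continuous_onI[OF h])
    moreover have "(\<lambda>t. (t, g t)) \<in> borel \<rightarrow>\<^sub>M borel \<Otimes>\<^sub>M borel" using that by simp
    ultimately have "(\<lambda>(a, b). h a b) \<circ> (\<lambda>t. (t, g t)) \<in> borel_measurable borel"
      by (rule measurable_comp[rotated])
    then show ?thesis
      using measurable_cong_sets[OF \<mu>(2) refl] by (auto simp: o_def)
  qed
  show "(\<lambda>t. h t (f t)) \<in> borel_measurable \<mu>" by (rule meas[OF f])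
  show "(\<lambda>t. h t (poly (p k) t)) \<in> borel_measurable \<mu>" for k
    by (intro meas borel_measurable_continuous_onI continuous_intros)
  show "integrable \<mu> (\<lambda>_. B)" by (rule finite_measure.integrable_const[OF \<mu>(1)])
  show "AE t in \<mu>. (\<lambda>k. h t (poly (p k) t)) \<longlonglongrightarrow> h t (f t)"
    using \<mu>(3)
  proof eventually_elim
    case (elim t)
    then have "(\<lambda>k. poly (p k) t) \<longlonglongrightarrow> f t" using p by (simp add: poly_approx_def)
    then have "(\<lambda>k. (\<lambda>(a, b). h a b) (t, poly (p k) t)) \<longlonglongrightarrow> (\<lambda>(a, b). h a b) (t, f t)"
      by (intro isCont_tendsto_compose[where g = "\<lambda>(a, b). h a b"] tendsto_intros)
        (use h in \<open>auto simp: continuous_on_eq_continuous_at\<close>)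
    then show ?case by simp
  qed
  show "AE t in \<mu>. norm (h t (poly (p k) t)) \<le> B" for k
    using \<mu>(3) by eventually_elim (use B in simp)
qed

text \<open>
The moments determine the integrals of polynomials, hence those of their bounded pointwise
limits, hence the distribution function.
\<close>

lemma (in selfadjoint) moment_measure_unique:
  assumes "moment_measure T x \<mu>" "moment_measure T x \<nu>"
  shows "\<mu> = \<nu>"
proof -
  have \<mu>: "finite_measure \<mu>" "sets \<mu> = sets borel" "\<And>n. (T ^^ n) x \<bullet> x = (\<integral>t. t ^ n \<partial>\<mu>)"
   and \<nu>: "finite_measure \<nu>" "sets \<nu> = sets borel" "\<And>n. (T ^^ n) x \<bullet> x = (\<integral>t. t ^ n \<partial>\<nu>)"
    using assms by (simp_all add: moment_measure_def)
  obtain R1 R2 where "AE t in \<mu>. \<bar>t\<bar> \<le> R1" "AE t in \<nu>. \<bar>t\<bar> \<le> R2"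
    using assms emeasure_outside_iff_AE by (auto simp: moment_measure_def)
  then obtain R where R: "AE t in \<mu>. \<bar>t\<bar> \<le> R" "AE t in \<nu>. \<bar>t\<bar> \<le> R"
    by (intro that[of "max R1 R2"]) (auto elim!: eventually_mono)
  have "cdf \<mu> l = cdf \<nu> l" for l
  proof -
    obtain p where p: "poly_approx R p (indicator {..l})" using poly_approx_atMost by blast
    have lim: "(\<lambda>k. poly_op (p k) T x \<bullet> x) \<longlonglongrightarrow> cdf M l"
      if "finite_measure M" "sets M = sets borel" "AE t in M. \<bar>t\<bar> \<le> R"
        "\<And>n. (T ^^ n) x \<bullet> x = (\<integral>t. t ^ n \<partial>M)" for M
    proof -
      have "(\<lambda>k. \<integral>t. poly (p k) t \<partial>M) \<longlonglongrightarrow> (\<integral>t. indicator {..l} t \<partial>M)"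
        using integral_poly_approx[OF that(1-3) p, of "\<lambda>a b. b" 2] p
        by (auto simp: poly_approx_def case_prod_beta continuous_on_snd)
      then show ?thesis
        using integral_poly_moments[OF linear_axioms that]
        by (simp add: cdf_def sets_eq_imp_space_eq[OF that(2)])
    qed
    show ?thesis using lim[OF \<mu>(1,2) R(1) \<mu>(3)] lim[OF \<nu>(1,2) R(2) \<nu>(3)] by (rule LIMSEQ_unique)
  qed
  then show ?thesis
    using \<mu> \<nu> by (intro cdf_unique')
      (auto simp: finite_borel_measure_def finite_borel_measure_axioms_def)
qed

section \<open>Bounded functions of a self-adjoint operator\<close>

lemma (in selfadjoint) AE_moment_measure_bounded:
  assumes "\<And>y. norm (T y) \<le> R * norm y" "0 < R"
  shows "moment_measure T x \<mu> \<Longrightarrow> AE t in \<mu>. \<bar>t\<bar> \<le> R"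
  using exists_moment_measure[OF assms(2,1)] moment_measure_unique by blast

text \<open>
The isometry \<open>p \<mapsto> p(T)x\<close> from \<open>L\<^sup>2(\<mu>)\<close>: it turns norm estimates for operators into integrals.
\<close>

lemma (in selfadjoint) norm_poly_op:
  assumes "moment_measure T x \<mu>"
  shows "(norm (poly_op p T x))\<^sup>2 = (\<integral>t. (poly p t)\<^sup>2 \<partial>\<mu>)"
proof -
  obtain R where R: "AE t in \<mu>. \<bar>t\<bar> \<le> R"
    using assms emeasure_outside_iff_AE by (auto simp: moment_measure_def)
  have "(norm (poly_op p T x))\<^sup>2 = poly_op (p * p) T x \<bullet> x"
    by (simp add: power2_norm_eq_inner poly_op_mult[OF linear_axioms] selfadjoint_poly_op)
  also have "\<dots> = (\<integral>t. poly (p * p) t \<partial>\<mu>)"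
    using assms R by (intro integral_poly_moments linear_axioms) (auto simp: moment_measure_def)
  finally show ?thesis by (simp add: power2_eq_square)
qed

text \<open>
A bounded function \<open>f\<close> on the spectrum together with polynomials approximating it; the operator
\<open>E\<close> constructed below is \<open>f(T)\<close>.
\<close>

locale spectral_limit = selfadjoint T for T :: "'a::{real_inner,complete_space} \<Rightarrow> 'a" +
  fixes R :: real and p :: "nat \<Rightarrow> real poly" and f :: "real \<Rightarrow> real"
  assumes R_pos: "0 < R" and norm_le: "norm (T y) \<le> R * norm y"
    and poly_approx: "poly_approx R p f" and f_meas [measurable]: "f \<in> borel_measurable borel"
begin

lemma moment_measureE:
  obtains \<mu> where "moment_measure T x \<mu>" "finite_measure \<mu>" "sets \<mu> = sets borel" "AE t in \<mu>. \<bar>t\<bar> \<le> R"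
  using exists_moment_measure[OF R_pos norm_le, of x] by (auto simp: moment_measure_def)

lemma poly_bound: "\<bar>t\<bar> \<le> R \<Longrightarrow> \<bar>poly (p k) t\<bar> \<le> 2"
  using poly_approx by (simp add: poly_approx_def)

lemma limit_bound: "\<bar>t\<bar> \<le> R \<Longrightarrow> \<bar>f t\<bar> \<le> 2"
  by (rule LIMSEQ_le_const2[OF tendsto_rabs[of "\<lambda>k. poly (p k) t"]])
    (use poly_approx in \<open>auto simp: poly_approx_def\<close>)

text \<open>
By the isometry, \<open>\<parallel>p\<^sub>j(T)x - p\<^sub>k(T)x\<parallel>\<^sup>2 = \<integral> (p\<^sub>j - p\<^sub>k)\<^sup>2 d\<mu>\<close>, which tends to zero because both
polynomials converge to \<open>f\<close> in \<open>L\<^sup>2(\<mu>)\<close>.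
\<close>

lemma convergent: "convergent (\<lambda>k. poly_op (p k) T x)"
proof -
  obtain \<mu> where \<mu>: "moment_measure T x \<mu>" "finite_measure \<mu>" "sets \<mu> = sets borel" "AE t in \<mu>. \<bar>t\<bar> \<le> R"
    by (rule moment_measureE)
  define a where "a k = (\<integral>t. (poly (p k) t - f t)\<^sup>2 \<partial>\<mu>)" for k
  have d_int: "integrable \<mu> (\<lambda>t. (poly (p k) t - f t)\<^sup>2)" for k
  proof (rule integrable_AE_bounded[OF \<mu>(2,3) _ \<mu>(4)])
    show "(\<lambda>t. (poly (p k) t - f t)\<^sup>2) \<in> borel_measurable borel"
      by (intro borel_measurable_power borel_measurable_diff f_meas
          borel_measurable_continuous_onI continuous_intros)
    fix t assume "\<bar>t\<bar> \<le> R"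
    then have "\<bar>poly (p k) t - f t\<bar> \<le> 4" using poly_bound[of t k] limit_bound[of t] by linarith
    then have "\<bar>poly (p k) t - f t\<bar>\<^sup>2 \<le> 4\<^sup>2" by (intro power_mono) auto
    then show "\<bar>(poly (p k) t - f t)\<^sup>2\<bar> \<le> 16" by simp
  qed
  have "a \<longlonglongrightarrow> (\<integral>t. (f t - f t)\<^sup>2 \<partial>\<mu>)"
    unfolding a_def
  proof (rule integral_dominated_convergence[where w = "\<lambda>_. 16"])
    show "AE t in \<mu>. (\<lambda>k. (poly (p k) t - f t)\<^sup>2) \<longlonglongrightarrow> (f t - f t)\<^sup>2"
      using \<mu>(4)
    proof eventually_elim
      case (elim t)
      then have "(\<lambda>k. poly (p k) t) \<longlonglongrightarrow> f t" using poly_approx by (simp add: poly_approx_def)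
      then show ?case by (intro tendsto_intros)
    qed
    show "AE t in \<mu>. norm ((poly (p k) t - f t)\<^sup>2) \<le> 16" for k
      using \<mu>(4)
    proof eventually_elim
      case (elim t)
      then have "\<bar>poly (p k) t - f t\<bar> \<le> 4" using poly_bound[of t k] limit_bound[of t] by linarith
      then have "\<bar>poly (p k) t - f t\<bar>\<^sup>2 \<le> 4\<^sup>2" by (intro power_mono) auto
      then show ?case by simp
    qed
    show "integrable \<mu> (\<lambda>_. 16 :: real)" by (rule finite_measure.integrable_const[OF \<mu>(2)])
  qed (use d_int in \<open>auto intro: borel_measurable_integrable\<close>)
  then have a0: "a \<longlonglongrightarrow> 0" by simp
  have diff: "(norm (poly_op (p j) T x - poly_op (p k) T x))\<^sup>2 \<le> 2 * a j + 2 * a k" for j k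
  proof -
    have "(norm (poly_op (p j) T x - poly_op (p k) T x))\<^sup>2 = (\<integral>t. (poly (p j - p k) t)\<^sup>2 \<partial>\<mu>)"
      by (simp only: norm_poly_op[OF \<mu>(1)] flip: poly_op_diff[OF linear_axioms])
    also have "\<dots> \<le> (\<integral>t. 2 * (poly (p j) t - f t)\<^sup>2 + 2 * (poly (p k) t - f t)\<^sup>2 \<partial>\<mu>)"
    proof (rule integral_mono)
      show "integrable \<mu> (\<lambda>t. (poly (p j - p k) t)\<^sup>2)"
        by (rule integrable_continuous_AE_bounded[OF \<mu>(2,3,4)]) (intro continuous_intros)
      fix t
      show "(poly (p j - p k) t)\<^sup>2 \<le> 2 * (poly (p j) t - f t)\<^sup>2 + 2 * (poly (p k) t - f t)\<^sup>2"
        using zero_le_power2[of "(poly (p j) t - f t) + (poly (p k) t - f t)"]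
        by (simp add: power2_eq_square algebra_simps)
    qed (use d_int in simp)
    also have "\<dots> = 2 * a j + 2 * a k" using d_int by (simp add: a_def)
    finally show ?thesis .
  qed
  have "Cauchy (\<lambda>k. poly_op (p k) T x)"
    unfolding Cauchy_def
  proof (intro allI impI)
    fix e :: real assume e: "0 < e"
    then have "\<forall>\<^sub>F k in sequentially. a k < e\<^sup>2 / 4"
      by (intro order_tendstoD(2)[OF a0]) simp
    then obtain K where K: "\<And>k. K \<le> k \<Longrightarrow> a k < e\<^sup>2 / 4"
      by (auto simp: eventually_sequentially)
    show "\<exists>K. \<forall>j\<ge>K. \<forall>k\<ge>K. dist (poly_op (p j) T x) (poly_op (p k) T x) < e"
    proof (intro exI[of _ K] allI impI)
      fix j k assume "K \<le> j" "K \<le> k"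
      then have "(norm (poly_op (p j) T x - poly_op (p k) T x))\<^sup>2 < e\<^sup>2"
        using diff[of j k] K[of j] K[of k] by simp
      then show "dist (poly_op (p j) T x) (poly_op (p k) T x) < e"
        using e by (simp add: dist_norm power_less_imp_less_base)
    qed
  qed
  then show ?thesis by (simp add: Cauchy_convergent_iff)
qed

definition E :: "'a \<Rightarrow> 'a" where "E x = lim (\<lambda>k. poly_op (p k) T x)"

lemma tendsto_E: "(\<lambda>k. poly_op (p k) T x) \<longlonglongrightarrow> E x"
  using convergent by (simp add: E_def convergent_LIMSEQ_iff)

lemma norm_E:
  assumes "moment_measure T x \<mu>"
  shows "(norm (E x))\<^sup>2 = (\<integral>t. (f t)\<^sup>2 \<partial>\<mu>)"
proof -
  have \<mu>: "finite_measure \<mu>" "sets \<mu> = sets borel" "AE t in \<mu>. \<bar>t\<bar> \<le> R"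
    using assms AE_moment_measure_bounded[OF norm_le R_pos] by (auto simp: moment_measure_def)
  have "(\<lambda>k. \<integral>t. (poly (p k) t)\<^sup>2 \<partial>\<mu>) \<longlonglongrightarrow> (\<integral>t. (f t)\<^sup>2 \<partial>\<mu>)"
  proof (rule integral_poly_approx[OF \<mu> poly_approx f_meas])
    show "continuous_on UNIV (\<lambda>(a :: real, b :: real). b\<^sup>2)"
      by (simp add: case_prod_beta continuous_on_snd continuous_on_power)
    fix t k assume "\<bar>t\<bar> \<le> R"
    then have "\<bar>poly (p k) t\<bar>\<^sup>2 \<le> 2\<^sup>2" by (intro power_mono poly_bound) auto
    then show "\<bar>(poly (p k) t)\<^sup>2\<bar> \<le> 4" by simp
  qed
  moreover have "(\<lambda>k. (norm (poly_op (p k) T x))\<^sup>2) \<longlonglongrightarrow> (norm (E x))\<^sup>2"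
    by (intro tendsto_intros tendsto_E)
  ultimately show ?thesis
    unfolding norm_poly_op[OF assms] using LIMSEQ_unique by blast
qed

lemma inner_E:
  assumes "moment_measure T x \<mu>"
  shows "E x \<bullet> x = (\<integral>t. f t \<partial>\<mu>)"
proof -
  have \<mu>: "finite_measure \<mu>" "sets \<mu> = sets borel" "AE t in \<mu>. \<bar>t\<bar> \<le> R"
    using assms AE_moment_measure_bounded[OF norm_le R_pos] by (auto simp: moment_measure_def)
  have "(\<lambda>k. \<integral>t. poly (p k) t \<partial>\<mu>) \<longlonglongrightarrow> (\<integral>t. f t \<partial>\<mu>)"
    by (rule integral_poly_approx[OF \<mu> poly_approx f_meas, of "\<lambda>a b. b" 2])
      (auto simp: case_prod_beta continuous_on_snd poly_bound)
  moreover have "(\<lambda>k. poly_op (p k) T x \<bullet> x) \<longlonglongrightarrow> E x \<bullet> x"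
    by (intro tendsto_intros tendsto_E)
  moreover have "poly_op (p k) T x \<bullet> x = (\<integral>t. poly (p k) t \<partial>\<mu>)" for k
    using assms \<mu> by (intro integral_poly_moments linear_axioms) (auto simp: moment_measure_def)
  ultimately show ?thesis using LIMSEQ_unique by simp
qed

lemma bounded_linear_E: "bounded_linear E"
proof (rule bounded_linear_intro[where K = 2])
  fix x y and r :: real
  show "E (x + y) = E x + E y"
  proof (rule LIMSEQ_unique[OF tendsto_E])
    show "(\<lambda>k. poly_op (p k) T (x + y)) \<longlonglongrightarrow> E x + E y"
      unfolding linear_add[OF linear_poly_op[OF linear_axioms]] by (intro tendsto_intros tendsto_E)
  qed
  show "E (r *\<^sub>R x) = r *\<^sub>R E x"
  proof (rule LIMSEQ_unique[OF tendsto_E])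
    show "(\<lambda>k. poly_op (p k) T (r *\<^sub>R x)) \<longlonglongrightarrow> r *\<^sub>R E x"
      unfolding linear_scale[OF linear_poly_op[OF linear_axioms]] by (intro tendsto_intros tendsto_E)
  qed
  obtain \<mu> where \<mu>: "moment_measure T x \<mu>" "finite_measure \<mu>" "sets \<mu> = sets borel" "AE t in \<mu>. \<bar>t\<bar> \<le> R"
    by (rule moment_measureE)
  have sq: "\<bar>(f t)\<^sup>2\<bar> \<le> 4" if "\<bar>t\<bar> \<le> R" for t
  proof -
    have "\<bar>f t\<bar>\<^sup>2 \<le> 2\<^sup>2" by (intro power_mono limit_bound that) auto
    then show ?thesis by simp
  qed
  have "(\<integral>t. (f t)\<^sup>2 \<partial>\<mu>) \<le> (\<integral>t. 4 * t ^ 0 \<partial>\<mu>)"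
  proof (rule integral_mono_AE)
    show "integrable \<mu> (\<lambda>t. (f t)\<^sup>2)"
      by (rule integrable_AE_bounded[OF \<mu>(2,3) _ \<mu>(4) sq]) auto
    show "integrable \<mu> (\<lambda>t. 4 * t ^ 0)" 
      unfolding power_0 mult_1_right by (rule finite_measure.integrable_const[OF \<mu>(2)])
    show "AE t in \<mu>. (f t)\<^sup>2 \<le> 4 * t ^ 0" using \<mu>(4) by eventually_elim (use sq in auto)
  qed
  also have "\<dots> = 4 * ((T ^^ 0) x \<bullet> x)"
    unfolding integral_mult_right_zero using \<mu>(1) by (simp only: moment_measure_def)
  also have "\<dots> = (2 * norm x)\<^sup>2" by (simp add: power2_norm_eq_inner power_mult_distrib)
  finally have "(norm (E x))\<^sup>2 \<le> (2 * norm x)\<^sup>2" by (simp add: norm_E[OF \<mu>(1)])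
  from power2_le_imp_le[OF this] show "norm (E x) \<le> norm x * 2" by simp
qed

lemma E_selfadjoint: "E x \<bullet> y = x \<bullet> E y"
proof (rule LIMSEQ_unique)
  show "(\<lambda>k. poly_op (p k) T x \<bullet> y) \<longlonglongrightarrow> E x \<bullet> y" by (intro tendsto_intros tendsto_E)
  show "(\<lambda>k. poly_op (p k) T x \<bullet> y) \<longlonglongrightarrow> x \<bullet> E y"
    unfolding selfadjoint_poly_op by (intro tendsto_intros tendsto_E)
qed

lemma E_commute:
  assumes S: "bounded_linear S" and "\<And>x. S (T x) = T (S x)"
  shows "S (E x) = E (S x)"
proof (rule LIMSEQ_unique)
  show "(\<lambda>k. S (poly_op (p k) T x)) \<longlonglongrightarrow> S (E x)"
    by (intro bounded_linear.tendsto[OF S] tendsto_E)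
  show "(\<lambda>k. S (poly_op (p k) T x)) \<longlonglongrightarrow> E (S x)"
    unfolding poly_op_commute[OF linear_axioms bounded_linear.linear[OF S] assms(2)] by (rule tendsto_E)
qed

lemma E_eigenvector:
  assumes "T x = l *\<^sub>R x" "x \<noteq> 0"
  shows "E x = f l *\<^sub>R x"
proof (rule LIMSEQ_unique[OF tendsto_E])
  have "\<bar>l\<bar> * norm x \<le> R * norm x" using norm_le[of x] assms(1) by simp
  then have "\<bar>l\<bar> \<le> R" using assms(2) by simp
  moreover have "poly_op q T x = poly q l *\<^sub>R x" for q
    by (induction q) (simp_all add: linear_axioms scale assms(1) scaleR_add_left mult.commute)
  ultimately show "(\<lambda>k. poly_op (p k) T x) \<longlonglongrightarrow> f l *\<^sub>R x"
    using poly_approx by (auto simp: poly_approx_def intro!: tendsto_intros)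
qed

text \<open>
For \<open>f\<close> the indicator of \<open>{l}\<close>: the range of the spectral projection consists of eigenvectors,
since \<open>\<parallel>(T - l)p\<^sub>k(T)x\<parallel>\<^sup>2 = \<integral> ((t - l)p\<^sub>k)\<^sup>2 d\<mu>\<close> converges to \<open>\<integral> ((t - l)f)\<^sup>2 d\<mu> = 0\<close>.
\<close>

lemma eigenvector_E:
  assumes "\<And>t. (t - l) * f t = 0"
  shows "T (E x) = l *\<^sub>R E x"
proof -
  obtain \<mu> where \<mu>: "moment_measure T x \<mu>" "finite_measure \<mu>" "sets \<mu> = sets borel" "AE t in \<mu>. \<bar>t\<bar> \<le> R"
    by (rule moment_measureE)
  have "(\<lambda>k. \<integral>t. ((t - l) * poly (p k) t)\<^sup>2 \<partial>\<mu>) \<longlonglongrightarrow> (\<integral>t. ((t - l) * f t)\<^sup>2 \<partial>\<mu>)"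
  proof (rule integral_poly_approx[OF \<mu>(2-4) poly_approx f_meas])
    show "continuous_on UNIV (\<lambda>(a :: real, b :: real). ((a - l) * b)\<^sup>2)"
      by (simp add: case_prod_beta) (intro continuous_intros)
    fix t k assume t: "\<bar>t\<bar> \<le> R"
    have "\<bar>(t - l) * poly (p k) t\<bar> \<le> (R + \<bar>l\<bar>) * 2"
      unfolding abs_mult using t poly_bound[OF t, of k] by (intro mult_mono) auto
    then have "\<bar>(t - l) * poly (p k) t\<bar>\<^sup>2 \<le> ((R + \<bar>l\<bar>) * 2)\<^sup>2" by (intro power_mono) auto
    then show "\<bar>((t - l) * poly (p k) t)\<^sup>2\<bar> \<le> ((R + \<bar>l\<bar>) * 2)\<^sup>2" by simp
  qed
  moreover have "(norm (T (poly_op (p k) T x) - l *\<^sub>R poly_op (p k) T x))\<^sup>2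
      = (\<integral>t. ((t - l) * poly (p k) t)\<^sup>2 \<partial>\<mu>)" for k
  proof -
    have "poly_op ([:-l, 1:] * p k) T x = T (poly_op (p k) T x) - l *\<^sub>R poly_op (p k) T x"
      unfolding poly_op_mult[OF linear_axioms] by (simp add: linear_axioms zero)
    moreover have "poly ([:-l, 1:] * p k) t = (t - l) * poly (p k) t" for t
      unfolding poly_mult by simp
    ultimately show ?thesis using norm_poly_op[OF \<mu>(1), of "[:-l, 1:] * p k"] by simp
  qed
  moreover have "(\<lambda>k. (norm (T (poly_op (p k) T x) - l *\<^sub>R poly_op (p k) T x))\<^sup>2)
      \<longlonglongrightarrow> (norm (T (E x) - l *\<^sub>R E x))\<^sup>2"
    by (intro tendsto_intros tendsto tendsto_E)
  ultimately have "(norm (T (E x) - l *\<^sub>R E x))\<^sup>2 = (\<integral>t. ((t - l) * f t)\<^sup>2 \<partial>\<mu>)"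
    using LIMSEQ_unique by simp
  then show ?thesis by (simp add: assms)
qed

end

section \<open>The Hilbert space of square summable functions\<close>

text \<open>
  The square summable functions on a whole type, as a real Hilbert space: the type classes then
  supply norms, convergence and orthogonalization. A weighted space \<open>l2 V m\<close> embeds into it as the
  functions that vanish outside \<open>V\<close>.
\<close>

typedef 'a ell2 = "{f :: 'a \<Rightarrow> complex. (\<lambda>x. (cmod (f x))\<^sup>2) summable_on UNIV}"
  morphisms coord Abs_ell2
  by (rule exI[of _ "\<lambda>_. 0"]) simp

setup_lifting type_definition_ell2

lemma summable_on_le_nonneg:
  fixes f g :: "'a \<Rightarrow> real"
  assumes "g summable_on A" "\<And>x. x \<in> A \<Longrightarrow> 0 \<le> f x" "\<And>x. x \<in> A \<Longrightarrow> f x \<le> g x"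
  shows "f summable_on A"
  by (rule summable_on_comparison_test[OF assms(1)]) (use assms in auto)

lemma summable_inner:
  fixes f g :: "'a \<Rightarrow> complex"
  assumes "(\<lambda>x. (cmod (f x))\<^sup>2) summable_on A" "(\<lambda>x. (cmod (g x))\<^sup>2) summable_on A"
  shows "(\<lambda>x. f x \<bullet> g x) summable_on A"
proof -
  have "(\<lambda>x. (cmod (f x))\<^sup>2 + (cmod (g x))\<^sup>2) summable_on A"
    by (intro summable_on_add assms)
  moreover have "norm (f x \<bullet> g x) \<le> (cmod (f x))\<^sup>2 + (cmod (g x))\<^sup>2" for x
  proof -
    have "\<bar>f x \<bullet> g x\<bar> \<le> cmod (f x) * cmod (g x)" by (rule Cauchy_Schwarz_ineq2)
    moreover have "2 * (cmod (f x) * cmod (g x)) \<le> (cmod (f x))\<^sup>2 + (cmod (g x))\<^sup>2"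
      using zero_le_power2[of "cmod (f x) - cmod (g x)"] by (simp add: power2_diff)
    moreover have "0 \<le> cmod (f x) * cmod (g x)" by simp
    ultimately show ?thesis by simp
  qed
  ultimately have "(\<lambda>x. norm (f x \<bullet> g x)) summable_on A"
    by (intro summable_on_le_nonneg[where f = "\<lambda>x. norm (f x \<bullet> g x)"]) auto
  then show ?thesis by (rule abs_summable_summable)
qed

lemma summable_add_sq:
  fixes f g :: "'a \<Rightarrow> complex"
  assumes "(\<lambda>x. (cmod (f x))\<^sup>2) summable_on A" "(\<lambda>x. (cmod (g x))\<^sup>2) summable_on A"
  shows "(\<lambda>x. (cmod (f x + g x))\<^sup>2) summable_on A"
proof -
  have "(\<lambda>x. (cmod (f x))\<^sup>2 + (cmod (g x))\<^sup>2 + 2 * (f x \<bullet> g x)) summable_on A"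
    by (intro summable_on_add summable_on_cmult_right assms summable_inner)
  then show ?thesis
    by (simp add: power2_norm_eq_inner inner_add_left inner_add_right inner_commute algebra_simps)
qed

instantiation ell2 :: (type) real_vector
begin

lift_definition zero_ell2 :: "'a ell2" is "\<lambda>_. 0" by simp
lift_definition plus_ell2 :: "'a ell2 \<Rightarrow> 'a ell2 \<Rightarrow> 'a ell2" is "\<lambda>f g x. f x + g x"
  by (rule summable_add_sq)
lift_definition uminus_ell2 :: "'a ell2 \<Rightarrow> 'a ell2" is "\<lambda>f x. - f x" by simp
lift_definition minus_ell2 :: "'a ell2 \<Rightarrow> 'a ell2 \<Rightarrow> 'a ell2" is "\<lambda>f g x. f x - g x"
  using summable_add_sq[where g = "\<lambda>x. - g x" for g] by simp
lift_definition scaleR_ell2 :: "real \<Rightarrow> 'a ell2 \<Rightarrow> 'a ell2" is "\<lambda>r f x. r *\<^sub>R f x"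
  by (simp add: power_mult_distrib summable_on_cmult_right)

instance
  by standard (transfer; simp add: fun_eq_iff algebra_simps)+

end

instantiation ell2 :: (type) real_inner
begin

lift_definition inner_ell2 :: "'a ell2 \<Rightarrow> 'a ell2 \<Rightarrow> real" is "\<lambda>f g. \<Sum>\<^sub>\<infinity>x. f x \<bullet> g x" .
definition norm_ell2 :: "'a ell2 \<Rightarrow> real" where "norm_ell2 f = sqrt (inner f f)"
definition dist_ell2 :: "'a ell2 \<Rightarrow> 'a ell2 \<Rightarrow> real" where "dist_ell2 f g = norm (f - g)"
definition sgn_ell2 :: "'a ell2 \<Rightarrow> 'a ell2" where "sgn_ell2 f = f /\<^sub>R norm f"
definition uniformity_ell2 :: "('a ell2 \<times> 'a ell2) filter" where
  "uniformity_ell2 = (INF e\<in>{0<..}. principal {(x, y). dist x y < e})"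
definition open_ell2 :: "'a ell2 set \<Rightarrow> bool" where
  "open_ell2 U \<longleftrightarrow> (\<forall>x\<in>U. \<forall>\<^sub>F (x', y) in uniformity. x' = x \<longrightarrow> y \<in> U)"

instance
proof
  fix f g h :: "'a ell2" and r :: real
  show "f \<bullet> g = g \<bullet> f" by transfer (simp add: inner_commute)
  show "(f + g) \<bullet> h = f \<bullet> h + g \<bullet> h"
    by transfer (simp add: inner_add_left infsum_add summable_inner)
  show "(r *\<^sub>R f) \<bullet> g = r * (f \<bullet> g)"
    by transfer (simp add: infsum_cmult_right')
  show "0 \<le> f \<bullet> f" by transfer (simp add: infsum_nonneg)
  show "f \<bullet> f = 0 \<longleftrightarrow> f = 0"
  proof transfer
    fix f :: "'a \<Rightarrow> complex" assume f: "(\<lambda>x. (cmod (f x))\<^sup>2) summable_on UNIV"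
    show "(\<Sum>\<^sub>\<infinity>x. f x \<bullet> f x) = 0 \<longleftrightarrow> f = (\<lambda>_. 0)"
    proof
      assume 0: "(\<Sum>\<^sub>\<infinity>x. f x \<bullet> f x) = 0"
      show "f = (\<lambda>_. 0)"
      proof
        fix x
        have "f x \<bullet> f x = 0"
          by (rule nonneg_infsum_le_0D[where A = UNIV])
            (use 0 f in \<open>simp_all add: summable_inner\<close>)
        then show "f x = 0" by simp
      qed
    qed simp
  qed
qed (rule norm_ell2_def dist_ell2_def sgn_ell2_def open_ell2_def uniformity_ell2_def)+

end

lemma ell2_eqI: "(\<And>x. coord f x = coord g x) \<Longrightarrow> f = g"
  by (simp add: coord_inject[symmetric] fun_eq_iff)

lemma coord_simps [simp]:
  "coord 0 x = 0" "coord (f + g) x = coord f x + coord g x" "coord (- f) x = - coord f x"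
  "coord (f - g) x = coord f x - coord g x" "coord (r *\<^sub>R f) x = r *\<^sub>R coord f x"
  by (transfer, simp)+

lemma summable_coord: "(\<lambda>x. (cmod (coord f x))\<^sup>2) summable_on A"
proof -
  have "(\<lambda>x. (cmod (coord f x))\<^sup>2) summable_on UNIV" by transfer
  then show ?thesis by (rule summable_on_subset_banach) simp
qed

lemma norm_ell2_sq: "(norm f)\<^sup>2 = (\<Sum>\<^sub>\<infinity>x. (cmod (coord f x))\<^sup>2)"
  unfolding power2_norm_eq_inner by transfer simp

lemma sum_coord_le_norm: "finite F \<Longrightarrow> (\<Sum>x\<in>F. (cmod (coord f x))\<^sup>2) \<le> (norm f)\<^sup>2"
  unfolding norm_ell2_sq by (rule finite_sum_le_infsum) (use summable_coord in auto)

lemma cmod_coord_le_norm: "cmod (coord f x) \<le> norm f"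
  by (rule power2_le_imp_le) (use sum_coord_le_norm[of "{x}" f] in auto)

text \<open>
Membership and norm at once, from bounds on finite partial sums; this is the form that survives
pointwise limits.
\<close>

lemma ell2_bounded_sums:
  assumes "\<And>F. finite F \<Longrightarrow> (\<Sum>x\<in>F. (cmod (g x))\<^sup>2) \<le> B\<^sup>2" and "0 \<le> B"
  shows "coord (Abs_ell2 g) = g" "norm (Abs_ell2 g) \<le> B"
proof -
  have sum: "(\<lambda>x. (cmod (g x))\<^sup>2) summable_on UNIV"
    by (rule nonneg_bdd_above_summable_on) (use assms in \<open>auto intro!: bdd_aboveI2[of _ _ "B\<^sup>2"]\<close>)
  then show eq: "coord (Abs_ell2 g) = g" by (simp add: Abs_ell2_inverse)
  have "(norm (Abs_ell2 g))\<^sup>2 \<le> B\<^sup>2"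
    unfolding norm_ell2_sq eq by (rule infsum_le_finite_sums[OF sum assms(1)])
  then show "norm (Abs_ell2 g) \<le> B" using assms(2) by (rule power2_le_imp_le)
qed

instance ell2 :: (type) complete_space
proof
  fix X :: "nat \<Rightarrow> 'a ell2" assume X: "Cauchy X"
  have "Cauchy (\<lambda>n. coord (X n) x)" for x
    unfolding Cauchy_def
  proof (intro allI impI)
    fix e :: real assume "0 < e"
    then obtain N where N: "\<And>m n. N \<le> m \<Longrightarrow> N \<le> n \<Longrightarrow> dist (X m) (X n) < e"
      using X unfolding Cauchy_def by blast
    have "dist (coord (X m) x) (coord (X n) x) < e" if "N \<le> m" "N \<le> n" for m n
      using cmod_coord_le_norm[of "X m - X n" x] N[OF that] by (simp add: dist_norm)
    then show "\<exists>N. \<forall>m\<ge>N. \<forall>n\<ge>N. dist (coord (X m) x) (coord (X n) x) < e" by blast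
  qed
  then have "\<forall>x. \<exists>l. (\<lambda>n. coord (X n) x) \<longlonglongrightarrow> l"
    by (simp add: Cauchy_convergent_iff convergent_def)
  then obtain g where g: "\<And>x. (\<lambda>n. coord (X n) x) \<longlonglongrightarrow> g x"
    by metis
  have tail: "\<exists>N. \<forall>n\<ge>N. \<forall>F. finite F \<longrightarrow> (\<Sum>x\<in>F. (cmod (coord (X n) x - g x))\<^sup>2) \<le> e\<^sup>2"
    if "0 < e" for e
  proof -
    obtain N where N: "\<And>m n. N \<le> m \<Longrightarrow> N \<le> n \<Longrightarrow> dist (X m) (X n) < e"
      using X \<open>0 < e\<close> unfolding Cauchy_def by blast
    have "(\<Sum>x\<in>F. (cmod (coord (X n) x - g x))\<^sup>2) \<le> e\<^sup>2" if "N \<le> n" "finite F" for n F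
    proof (rule LIMSEQ_le_const2)
      show "(\<lambda>m. \<Sum>x\<in>F. (cmod (coord (X n) x - coord (X m) x))\<^sup>2) \<longlonglongrightarrow>
          (\<Sum>x\<in>F. (cmod (coord (X n) x - g x))\<^sup>2)"
        by (intro tendsto_intros g)
      have "(\<Sum>x\<in>F. (cmod (coord (X n) x - coord (X m) x))\<^sup>2) \<le> e\<^sup>2" if "N \<le> m" for m
      proof -
        have "(\<Sum>x\<in>F. (cmod (coord (X n) x - coord (X m) x))\<^sup>2) \<le> (norm (X n - X m))\<^sup>2"
          using sum_coord_le_norm[OF \<open>finite F\<close>, of "X n - X m"] by simp
        also have "\<dots> \<le> e\<^sup>2"
          using N[OF \<open>N \<le> n\<close> that] by (intro power_mono) (auto simp: dist_norm)
        finally show ?thesis .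
      qed
      then show "\<exists>N. \<forall>m\<ge>N. (\<Sum>x\<in>F. (cmod (coord (X n) x - coord (X m) x))\<^sup>2) \<le> e\<^sup>2" by blast
    qed
    then show ?thesis by blast
  qed
  define d where "d n = Abs_ell2 (\<lambda>x. coord (X n) x - g x)" for n
  have d: "\<exists>N. \<forall>n\<ge>N. coord (d n) = (\<lambda>x. coord (X n) x - g x) \<and> norm (d n) \<le> e" if "0 < e" for e
  proof -
    obtain N where "\<And>n F. N \<le> n \<Longrightarrow> finite F \<Longrightarrow> (\<Sum>x\<in>F. (cmod (coord (X n) x - g x))\<^sup>2) \<le> e\<^sup>2"
      using tail[OF \<open>0 < e\<close>] by blast
    then have "coord (d n) = (\<lambda>x. coord (X n) x - g x) \<and> norm (d n) \<le> e" if "N \<le> n" for n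
      unfolding d_def using that \<open>0 < e\<close> by (intro conjI ell2_bounded_sums[where B = e]) auto
    then show ?thesis by blast
  qed
  obtain N where N: "coord (d N) = (\<lambda>x. coord (X N) x - g x)" using d[of 1] by force
  define L where "L = X N - d N"
  have L: "coord L x = g x" for x by (simp add: L_def N)
  have "X \<longlonglongrightarrow> L"
  proof (rule LIMSEQ_I)
    fix e :: real assume e: "0 < e"
    obtain M where M: "\<And>n. M \<le> n \<Longrightarrow> coord (d n) = (\<lambda>x. coord (X n) x - g x) \<and> norm (d n) \<le> e / 2"
      using d[of "e / 2"] e by auto
    have "norm (X n - L) < e" if "M \<le> n" for n
    proof -
      have "X n - L = d n" by (rule ell2_eqI) (simp add: M[OF that] L)
      then show ?thesis using M[OF that] e by simp
    qed
    then show "\<exists>M. \<forall>n\<ge>M. norm (X n - L) < e" by blast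
  qed
  then show "convergent X" by (auto simp: convergent_def)
qed

lift_definition scaleC_ell2 :: "complex \<Rightarrow> 'a ell2 \<Rightarrow> 'a ell2" is "\<lambda>c f x. c * f x"
  by (simp add: norm_mult power_mult_distrib summable_on_cmult_right)

lift_definition restrict_ell2 :: "'a set \<Rightarrow> 'a ell2 \<Rightarrow> 'a ell2" is "\<lambda>A f x. if x \<in> A then f x else 0"
  by (erule summable_on_le_nonneg) auto

lift_definition unit_ell2 :: "complex \<Rightarrow> 'a \<Rightarrow> 'a ell2" is "\<lambda>c x y. if y = x then c else 0"
proof -
  fix c :: complex and x :: 'a
  have "(\<lambda>y. (cmod (if y = x then c else 0))\<^sup>2) summable_on {x}" by simp
  then show "(\<lambda>y. (cmod (if y = x then c else 0))\<^sup>2) summable_on UNIV"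
    by (rule summable_on_cong_neutral[THEN iffD1, rotated -1]) auto
qed

lemma coord_scaleC [simp]: "coord (scaleC_ell2 c f) x = c * coord f x"
  by transfer simp

lemma coord_restrict [simp]: "coord (restrict_ell2 A f) x = (if x \<in> A then coord f x else 0)"
  by transfer simp

lemma coord_unit [simp]: "coord (unit_ell2 c x) y = (if y = x then c else 0)"
  by transfer simp

lemma norm_scaleC: "norm (scaleC_ell2 c f) = cmod c * norm f"
proof -
  have "(norm (scaleC_ell2 c f))\<^sup>2 = (cmod c * norm f)\<^sup>2"
    by (simp add: norm_ell2_sq norm_mult power_mult_distrib infsum_cmult_right')
  then show ?thesis by (simp add: power2_eq_iff_nonneg)
qed

lemma inner_ell2_coord: "f \<bullet> g = (\<Sum>\<^sub>\<infinity>x. coord f x \<bullet> coord g x)"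
  by (rule inner_ell2.rep_eq)

lemma inner_scaleC: "f \<bullet> scaleC_ell2 c g = scaleC_ell2 (cnj c) f \<bullet> g"
proof -
  have "u \<bullet> (c * v) = (cnj c * u) \<bullet> v" for u v :: complex
    by (simp add: inner_complex_def algebra_simps)
  then show ?thesis by (simp add: inner_ell2_coord)
qed

lemma bounded_linear_scaleC: "bounded_linear (scaleC_ell2 c)"
proof (rule bounded_linear_intro[where K = "cmod c"])
  fix f :: "'a ell2"
  show "norm (scaleC_ell2 c f) \<le> norm f * cmod c" by (simp add: norm_scaleC)
qed (auto intro!: ell2_eqI simp: algebra_simps)

lemma norm_restrict_le: "norm (restrict_ell2 A f) \<le> norm f"
proof -
  have "(norm (restrict_ell2 A f))\<^sup>2 \<le> (norm f)\<^sup>2"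
    unfolding norm_ell2_sq by (intro infsum_mono summable_coord) auto
  then show ?thesis by (rule power2_le_imp_le) simp
qed

lemma bounded_linear_restrict: "bounded_linear (restrict_ell2 A)"
  by (rule bounded_linear_intro[where K = 1]) (auto intro!: ell2_eqI simp: norm_restrict_le)

lemma inner_unit: "f \<bullet> unit_ell2 c x = coord f x \<bullet> c"
proof -
  have "f \<bullet> unit_ell2 c x = (\<Sum>\<^sub>\<infinity>y. coord f y \<bullet> coord (unit_ell2 c x) y)" by transfer simp
  also have "\<dots> = (\<Sum>\<^sub>\<infinity>y\<in>{x}. coord f y \<bullet> coord (unit_ell2 c x) y)"
    by (rule infsum_cong_neutral) auto
  finally show ?thesis by simp
qed

text \<open>
Over the real numbers each point of the support contributes two basis vectors, \<open>1\<close> and \<open>\<i>\<close>.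
\<close>

lemma in_span_units:
  assumes "finite A" "\<And>x. x \<notin> A \<Longrightarrow> coord f x = 0"
  shows "f \<in> span (unit_ell2 1 ` A \<union> unit_ell2 \<i> ` A)"
proof -
  have coord_sum: "coord (\<Sum>x\<in>B. g x) y = (\<Sum>x\<in>B. coord (g x) y)" for g :: "'a \<Rightarrow> 'a ell2" and B y
    by (induction B rule: infinite_finite_induct) auto
  have "f = (\<Sum>x\<in>A. Re (coord f x) *\<^sub>R unit_ell2 1 x + Im (coord f x) *\<^sub>R unit_ell2 \<i> x)"
  proof (rule ell2_eqI)
    fix y
    show "coord f y = coord (\<Sum>x\<in>A. Re (coord f x) *\<^sub>R unit_ell2 1 x + Im (coord f x) *\<^sub>R unit_ell2 \<i> x) y"
      unfolding coord_sum
    proof (cases "y \<in> A")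
      case True
      have "(\<Sum>x\<in>A. coord (Re (coord f x) *\<^sub>R unit_ell2 1 x + Im (coord f x) *\<^sub>R unit_ell2 \<i> x) y)
        = (\<Sum>x\<in>A. if y = x then coord f x else 0)"
        by (intro sum.cong) (auto simp: complex_eq_iff)
      then show "coord f y = (\<Sum>x\<in>A. coord (Re (coord f x) *\<^sub>R unit_ell2 1 x + Im (coord f x) *\<^sub>R unit_ell2 \<i> x) y)"
        using True assms(1) by simp
    next
      case False
      then have "(\<Sum>x\<in>A. coord (Re (coord f x) *\<^sub>R unit_ell2 1 x + Im (coord f x) *\<^sub>R unit_ell2 \<i> x) y) = 0"
        by (intro sum.neutral) auto
      then show "coord f y = (\<Sum>x\<in>A. coord (Re (coord f x) *\<^sub>R unit_ell2 1 x + Im (coord f x) *\<^sub>R unit_ell2 \<i> x) y)"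
        using assms(2)[OF False] by simp
    qed
  qed
  also have "\<dots> \<in> span (unit_ell2 1 ` A \<union> unit_ell2 \<i> ` A)"
    by (intro span_sum span_add span_scale span_base) auto
  finally show ?thesis .
qed

section \<open>Spectral projections on weighted function spaces\<close>

text \<open>
The imaginary part of \<open>\<langle>Sf, f\<rangle>\<close> vanishes for a self-adjoint complex linear \<open>S\<close>; self-adjointness
for the real part of the inner product suffices, because multiplication by \<open>\<i>\<close> is skew.
\<close>

lemma selfadjoint_inner_imaginary:
  assumes "\<And>f g. S f \<bullet> g = f \<bullet> S g" and "\<And>f. S (scaleC_ell2 \<i> f) = scaleC_ell2 \<i> (S f)"
  shows "S f \<bullet> scaleC_ell2 \<i> f = 0"
proof -
  have "S f \<bullet> scaleC_ell2 \<i> f = f \<bullet> scaleC_ell2 \<i> (S f)" by (simp only: assms)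
  also have "\<dots> = scaleC_ell2 (cnj \<i>) f \<bullet> S f" by (rule inner_scaleC)
  also have "scaleC_ell2 (cnj \<i>) f = - scaleC_ell2 \<i> f" by (rule ell2_eqI) simp
  finally show ?thesis by (simp add: inner_commute)
qed

locale l2_space =
  fixes V :: "'v set" and m :: "'v \<Rightarrow> real"
  assumes m_pos: "x \<in> V \<Longrightarrow> 0 < m x"
begin

definition to_ell2 :: "('v \<Rightarrow> complex) \<Rightarrow> 'v ell2" where
  "to_ell2 \<phi> = Abs_ell2 (\<lambda>x. if x \<in> V then sqrt (m x) *\<^sub>R \<phi> x else 0)"

definition of_ell2 :: "'v ell2 \<Rightarrow> 'v \<Rightarrow> complex" where
  "of_ell2 f x = (if x \<in> V then coord f x /\<^sub>R sqrt (m x) else 0)"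

lemma weighted_sq: "x \<in> V \<Longrightarrow> (cmod (sqrt (m x) *\<^sub>R z))\<^sup>2 = (cmod z)\<^sup>2 * m x"
  using m_pos[of x] by (simp add: power_mult_distrib mult.commute)

lemma coord_to_ell2:
  assumes "\<phi> \<in> l2 V m"
  shows "coord (to_ell2 \<phi>) x = (if x \<in> V then sqrt (m x) *\<^sub>R \<phi> x else 0)"
proof -
  have "(\<lambda>x. (cmod (\<phi> x))\<^sup>2 * m x) summable_on V" using assms by (simp add: l2_def)
  then have "(\<lambda>x. (cmod (if x \<in> V then sqrt (m x) *\<^sub>R \<phi> x else 0))\<^sup>2) summable_on UNIV"
    by (rule summable_on_cong_neutral[THEN iffD1, rotated -1]) (auto simp: weighted_sq simp del: norm_scaleR)
  then show ?thesis by (simp add: to_ell2_def Abs_ell2_inverse)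
qed

lemma of_ell2_in_l2: "of_ell2 f \<in> l2 V m"
proof -
  have "(\<lambda>x. (cmod (coord f x))\<^sup>2) summable_on V" by (rule summable_coord)
  moreover have "(cmod (of_ell2 f x))\<^sup>2 * m x = (cmod (coord f x))\<^sup>2" if "x \<in> V" for x
    using m_pos[OF that] that
    by (simp add: of_ell2_def power_mult_distrib power_inverse field_simps)
  ultimately have "(\<lambda>x. (cmod (of_ell2 f x))\<^sup>2 * m x) summable_on V"
    by (metis (no_types, lifting) summable_on_cong)
  then show ?thesis by (simp add: l2_def of_ell2_def)
qed

lemma of_to_ell2: "\<phi> \<in> l2 V m \<Longrightarrow> of_ell2 (to_ell2 \<phi>) = \<phi>"
  using m_pos by (force simp: of_ell2_def coord_to_ell2 l2_def fun_eq_iff)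

lemma to_of_ell2: "to_ell2 (of_ell2 f) = restrict_ell2 V f"
  by (rule ell2_eqI) (use m_pos in \<open>force simp: coord_to_ell2 of_ell2_in_l2 of_ell2_def\<close>)

lemma restrict_to_ell2: "\<phi> \<in> l2 V m \<Longrightarrow> restrict_ell2 V (to_ell2 \<phi>) = to_ell2 \<phi>"
  by (rule ell2_eqI) (simp add: coord_to_ell2)

lemma of_restrict_ell2: "of_ell2 (restrict_ell2 V f) = of_ell2 f"
  by (simp add: of_ell2_def fun_eq_iff)

lemma of_ell2_add: "of_ell2 (f + g) = (\<lambda>x. of_ell2 f x + of_ell2 g x)"
  by (simp add: of_ell2_def fun_eq_iff algebra_simps)

lemma of_ell2_scaleC: "of_ell2 (scaleC_ell2 c f) = (\<lambda>x. c * of_ell2 f x)"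
  by (simp add: of_ell2_def fun_eq_iff)

lemma l2_add: "\<phi> \<in> l2 V m \<Longrightarrow> \<psi> \<in> l2 V m \<Longrightarrow> (\<lambda>x. \<phi> x + \<psi> x) \<in> l2 V m"
  using of_ell2_in_l2[of "to_ell2 \<phi> + to_ell2 \<psi>"] by (simp add: of_ell2_add of_to_ell2)

lemma l2_scale: "\<phi> \<in> l2 V m \<Longrightarrow> (\<lambda>x. c * \<phi> x) \<in> l2 V m"
  using of_ell2_in_l2[of "scaleC_ell2 c (to_ell2 \<phi>)"] by (simp add: of_ell2_scaleC of_to_ell2)

lemma to_ell2_add:
  "\<phi> \<in> l2 V m \<Longrightarrow> \<psi> \<in> l2 V m \<Longrightarrow> to_ell2 (\<lambda>x. \<phi> x + \<psi> x) = to_ell2 \<phi> + to_ell2 \<psi>"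
  by (rule ell2_eqI) (simp add: coord_to_ell2 l2_add algebra_simps)

lemma to_ell2_scaleC: "\<phi> \<in> l2 V m \<Longrightarrow> to_ell2 (\<lambda>x. c * \<phi> x) = scaleC_ell2 c (to_ell2 \<phi>)"
  by (rule ell2_eqI) (simp add: coord_to_ell2 l2_scale algebra_simps)

lemma inner_to_ell2:
  assumes "\<phi> \<in> l2 V m" "\<psi> \<in> l2 V m"
  shows "to_ell2 \<phi> \<bullet> to_ell2 \<psi> = (\<Sum>\<^sub>\<infinity>x\<in>V. Re (\<phi> x * cnj (\<psi> x) * complex_of_real (m x)))"
proof -
  have "to_ell2 \<phi> \<bullet> to_ell2 \<psi> = (\<Sum>\<^sub>\<infinity>x. coord (to_ell2 \<phi>) x \<bullet> coord (to_ell2 \<psi>) x)"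
    by (rule inner_ell2_coord)
  also have "\<dots> = (\<Sum>\<^sub>\<infinity>x\<in>V. Re (\<phi> x * cnj (\<psi> x) * complex_of_real (m x)))"
  proof (rule infsum_cong_neutral)
    fix x assume x: "x \<in> UNIV \<inter> V"
    then have "sqrt (m x) * sqrt (m x) = m x" using m_pos[of x] by simp
    moreover have "coord (to_ell2 \<phi>) x \<bullet> coord (to_ell2 \<psi>) x = (sqrt (m x) * sqrt (m x)) * (\<phi> x \<bullet> \<psi> x)"
      using x by (simp add: coord_to_ell2 assms)
    ultimately show "coord (to_ell2 \<phi>) x \<bullet> coord (to_ell2 \<psi>) x = Re (\<phi> x * cnj (\<psi> x) * complex_of_real (m x))"
      by (simp add: inner_complex_def algebra_simps)
  qed (auto simp: coord_to_ell2 assms)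
  finally show ?thesis .
qed

lemma summable_l2_inner:
  assumes "\<phi> \<in> l2 V m" "\<psi> \<in> l2 V m"
  shows "(\<lambda>x. \<phi> x * cnj (\<psi> x) * complex_of_real (m x)) summable_on V"
proof -
  have "(\<lambda>x. (cmod (\<phi> x))\<^sup>2 * m x + (cmod (\<psi> x))\<^sup>2 * m x) summable_on V"
    using assms by (intro summable_on_add) (auto simp: l2_def)
  then have "(\<lambda>x. norm (\<phi> x * cnj (\<psi> x) * complex_of_real (m x))) summable_on V"
  proof (rule summable_on_le_nonneg)
    fix x assume x: "x \<in> V"
    have "2 * (cmod (\<phi> x) * cmod (\<psi> x)) \<le> (cmod (\<phi> x))\<^sup>2 + (cmod (\<psi> x))\<^sup>2"
      using zero_le_power2[of "cmod (\<phi> x) - cmod (\<psi> x)"] by (simp add: power2_diff)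
    moreover have "0 \<le> cmod (\<phi> x) * cmod (\<psi> x)" by simp
    ultimately have "cmod (\<phi> x) * cmod (\<psi> x) \<le> (cmod (\<phi> x))\<^sup>2 + (cmod (\<psi> x))\<^sup>2" by linarith
    from mult_right_mono[OF this less_imp_le[OF m_pos[OF x]]]
    show "norm (\<phi> x * cnj (\<psi> x) * complex_of_real (m x)) \<le> (cmod (\<phi> x))\<^sup>2 * m x + (cmod (\<psi> x))\<^sup>2 * m x"
      using m_pos[OF x] by (simp add: norm_mult distrib_right)
  qed simp
  then show ?thesis by (rule abs_summable_summable)
qed

text \<open>
Real and imaginary parts of the complex inner product are both values of the real one. Thus all
statements about \<open>l2_inner\<close> can be moved to \<open>'v ell2\<close>.
\<close>

lemma l2_inner_eq:
  assumes "\<phi> \<in> l2 V m" "\<psi> \<in> l2 V m"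
  shows "l2_inner V m \<phi> \<psi> = Complex (to_ell2 \<phi> \<bullet> to_ell2 \<psi>) (to_ell2 \<phi> \<bullet> scaleC_ell2 \<i> (to_ell2 \<psi>))"
proof (rule complex_eqI)
  note s = summable_l2_inner[OF assms]
  show "Re (l2_inner V m \<phi> \<psi>) = Re (Complex (to_ell2 \<phi> \<bullet> to_ell2 \<psi>) (to_ell2 \<phi> \<bullet> scaleC_ell2 \<i> (to_ell2 \<psi>)))"
    by (simp add: l2_inner_def infsum_Re[OF s, symmetric] inner_to_ell2 assms)
  have "Im z = Re (z * cnj \<i>)" for z by simp
  then have "Im (l2_inner V m \<phi> \<psi>) = (\<Sum>\<^sub>\<infinity>x\<in>V. Re (\<phi> x * cnj (\<i> * \<psi> x) * complex_of_real (m x)))"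
    unfolding l2_inner_def infsum_Im[OF s, symmetric]
    by (intro infsum_cong) (simp add: algebra_simps)
  also have "\<dots> = to_ell2 \<phi> \<bullet> scaleC_ell2 \<i> (to_ell2 \<psi>)"
    using inner_to_ell2[OF assms(1) l2_scale[OF assms(2)], of \<i>] by (simp add: to_ell2_scaleC assms)
  finally show "Im (l2_inner V m \<phi> \<psi>) = Im (Complex (to_ell2 \<phi> \<bullet> to_ell2 \<psi>) (to_ell2 \<phi> \<bullet> scaleC_ell2 \<i> (to_ell2 \<psi>)))"
    by simp
qed

lemma l2_norm_eq: "\<phi> \<in> l2 V m \<Longrightarrow> l2_norm V m \<phi> = norm (to_ell2 \<phi>)"
proof -
  assume \<phi>: "\<phi> \<in> l2 V m"
  have "(\<Sum>\<^sub>\<infinity>x\<in>V. (cmod (\<phi> x))\<^sup>2 * m x) = (\<Sum>\<^sub>\<infinity>x\<in>V. Re (\<phi> x * cnj (\<phi> x) * complex_of_real (m x)))"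
    by (intro infsum_cong) (simp add: complex_mult_cnj cmod_power2 flip: of_real_power)
  then have "l2_norm V m \<phi> = sqrt (to_ell2 \<phi> \<bullet> to_ell2 \<phi>)"
    by (simp add: l2_norm_def inner_to_ell2 \<phi>)
  then show ?thesis by (simp add: norm_eq_sqrt_inner)
qed

text \<open>
Polarization. This makes the description of \<open>borel_calculus\<close> by its quadratic form definite.
\<close>

lemma bounded_operator_eqI:
  assumes A: "bounded_operator V m A" and B: "bounded_operator V m B"
    and eq: "\<And>\<phi>. \<phi> \<in> l2 V m \<Longrightarrow> l2_inner V m (A \<phi>) \<phi> = l2_inner V m (B \<phi>) \<phi>"
  shows "A = B"
proof -
  have cl: "A \<phi> \<in> l2 V m" "B \<phi> \<in> l2 V m" if "\<phi> \<in> l2 V m" for \<phi>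
    using A B that by (auto simp: bounded_operator_def)
  define D where "D \<phi> = to_ell2 (A \<phi>) - to_ell2 (B \<phi>)" for \<phi>
  have D_add: "D (\<lambda>x. \<phi> x + \<psi> x) = D \<phi> + D \<psi>" if "\<phi> \<in> l2 V m" "\<psi> \<in> l2 V m" for \<phi> \<psi>
    using A B that by (simp add: D_def bounded_operator_def to_ell2_add[OF cl(1) cl(1)] to_ell2_add[OF cl(2) cl(2)])
  have D_scale: "D (\<lambda>x. c * \<phi> x) = scaleC_ell2 c (D \<phi>)" if "\<phi> \<in> l2 V m" for \<phi> c
    using A B that by (simp add: D_def bounded_operator_def to_ell2_scaleC cl linear_diff[OF bounded_linear.linear[OF bounded_linear_scaleC]])
  have D0: "D \<phi> \<bullet> to_ell2 \<phi> = 0" "D \<phi> \<bullet> scaleC_ell2 \<i> (to_ell2 \<phi>) = 0" if "\<phi> \<in> l2 V m" for \<phi>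
    using eq[OF that] that by (simp_all add: l2_inner_eq cl D_def inner_diff_left)
  have anti: "D \<phi> \<bullet> to_ell2 \<psi> + D \<psi> \<bullet> to_ell2 \<phi> = 0"
    "D \<phi> \<bullet> scaleC_ell2 \<i> (to_ell2 \<psi>) + D \<psi> \<bullet> scaleC_ell2 \<i> (to_ell2 \<phi>) = 0"
    if "\<phi> \<in> l2 V m" "\<psi> \<in> l2 V m" for \<phi> \<psi>
    using D0[OF l2_add[OF that]] D0[OF that(1)] D0[OF that(2)]
    by (simp_all add: D_add to_ell2_add that inner_add_left inner_add_right
        linear_add[OF bounded_linear.linear[OF bounded_linear_scaleC]])
  have orth: "D \<phi> \<bullet> scaleC_ell2 \<i> (to_ell2 \<psi>) = 0" if \<phi>: "\<phi> \<in> l2 V m" and \<psi>: "\<psi> \<in> l2 V m" for \<phi> \<psi>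
  proof -
    have "scaleC_ell2 \<i> (D \<psi>) \<bullet> to_ell2 \<phi> = - (D \<psi> \<bullet> scaleC_ell2 \<i> (to_ell2 \<phi>))"
    proof -
      have "scaleC_ell2 (cnj \<i>) (D \<psi>) = - scaleC_ell2 \<i> (D \<psi>)" by (rule ell2_eqI) simp
      then show ?thesis by (simp only: inner_scaleC inner_minus_left minus_minus)
    qed
    then show ?thesis
      using anti(1)[OF \<phi> l2_scale[OF \<psi>, of \<i>]] anti(2)[OF \<phi> \<psi>]
      by (simp add: D_scale to_ell2_scaleC \<psi>)
  qed
  have "A \<phi> = B \<phi>" if \<phi>: "\<phi> \<in> l2 V m" for \<phi>
  proof -
    \<comment> \<open>chosen so that \<open>\<i> \<psi>\<close> becomes \<open>D \<phi>\<close>\<close>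
    define \<psi> where "\<psi> = of_ell2 (scaleC_ell2 (- \<i>) (D \<phi>))"
    have "scaleC_ell2 \<i> (to_ell2 \<psi>) = D \<phi>"
      by (rule ell2_eqI) (simp add: \<psi>_def to_of_ell2 D_def coord_to_ell2 cl \<phi>)
    then have "D \<phi> \<bullet> D \<phi> = 0"
      using orth[OF \<phi>, of \<psi>] by (simp add: \<psi>_def of_ell2_in_l2)
    then have "to_ell2 (A \<phi>) = to_ell2 (B \<phi>)" by (simp add: D_def)
    then show "A \<phi> = B \<phi>" using of_to_ell2 cl[OF \<phi>] by metis
  qed
  moreover have "A \<phi> = B \<phi>" if "\<phi> \<notin> l2 V m" for \<phi>
    using A B that by (auto simp: bounded_operator_def PiE_def extensional_def)
  ultimately show ?thesis by blast
qed

end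

locale selfadjoint_l2 = l2_space V m for V :: "'v set" and m +
  fixes T :: "('v \<Rightarrow> complex) \<Rightarrow> 'v \<Rightarrow> complex"
  assumes bounded: "bounded_operator V m T"
    and symmetric: "\<phi> \<in> l2 V m \<Longrightarrow> \<psi> \<in> l2 V m \<Longrightarrow> l2_inner V m (T \<phi>) \<psi> = l2_inner V m \<phi> (T \<psi>)"
begin

definition op :: "'v ell2 \<Rightarrow> 'v ell2" where "op f = to_ell2 (T (of_ell2 f))"

lemma T_closed: "\<phi> \<in> l2 V m \<Longrightarrow> T \<phi> \<in> l2 V m"
  using bounded by (auto simp: bounded_operator_def)

lemma op_to_ell2: "\<phi> \<in> l2 V m \<Longrightarrow> op (to_ell2 \<phi>) = to_ell2 (T \<phi>)"
  by (simp add: op_def of_to_ell2)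

lemma of_ell2_op: "of_ell2 (op f) = T (of_ell2 f)"
  by (simp add: op_def of_to_ell2 T_closed of_ell2_in_l2)

lemma op_power: "\<phi> \<in> l2 V m \<Longrightarrow> (T ^^ n) \<phi> \<in> l2 V m \<and> (op ^^ n) (to_ell2 \<phi>) = to_ell2 ((T ^^ n) \<phi>)"
  by (induction n) (auto simp: T_closed op_to_ell2)

lemma op_scaleC: "op (scaleC_ell2 c f) = scaleC_ell2 c (op f)"
  using bounded unfolding op_def of_ell2_scaleC
  by (simp add: bounded_operator_def of_ell2_in_l2 T_closed to_ell2_scaleC)

lemma restrict_op: "restrict_ell2 V (op f) = op f"
  by (simp add: op_def restrict_to_ell2 T_closed of_ell2_in_l2)

lemma op_restrict: "op (restrict_ell2 V f) = op f"
  by (simp add: op_def of_restrict_ell2)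

lemma op_bound: "\<exists>R>0. \<forall>f. norm (op f) \<le> R * norm f"
proof -
  obtain C where C: "\<And>\<phi>. \<phi> \<in> l2 V m \<Longrightarrow> l2_norm V m (T \<phi>) \<le> C * l2_norm V m \<phi>"
    using bounded unfolding bounded_operator_def by blast
  have "norm (op f) \<le> (\<bar>C\<bar> + 1) * norm f" for f
  proof -
    have "norm (op f) \<le> C * norm (restrict_ell2 V f)"
      using C[OF of_ell2_in_l2, of f]
      by (simp add: l2_norm_eq T_closed of_ell2_in_l2 to_of_ell2 op_def)
    also have "\<dots> \<le> (\<bar>C\<bar> + 1) * norm f"
      by (intro mult_mono norm_restrict_le) auto
    finally show ?thesis .
  qed
  then show ?thesis by (intro exI[of _ "\<bar>C\<bar> + 1"]) auto
qed

sublocale op: selfadjoint op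
proof
  fix f g :: "'v ell2" and r :: real
  show "op (f + g) = op f + op g"
    using bounded unfolding op_def of_ell2_add
    by (simp add: bounded_operator_def of_ell2_in_l2 T_closed to_ell2_add)
  have "scaleC_ell2 (of_real r) h = r *\<^sub>R h" for h :: "'v ell2"
    by (rule ell2_eqI) (simp add: scaleR_conv_of_real)
  then show "op (r *\<^sub>R f) = r *\<^sub>R op f" using op_scaleC[of "of_real r" f] by simp
  show "\<exists>K. \<forall>f. norm (op f) \<le> norm f * K"
    using op_bound by (auto simp: mult.commute)
  have restrict: "restrict_ell2 V f \<bullet> op g = f \<bullet> op g" for f g
  proof -
    have "restrict_ell2 V f \<bullet> op g = f \<bullet> restrict_ell2 V (op g)"
      unfolding inner_ell2_coord by (intro infsum_cong) simp
    then show ?thesis by (simp add: restrict_op)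
  qed
  have "op f \<bullet> restrict_ell2 V g = restrict_ell2 V f \<bullet> op g"
    using symmetric[OF of_ell2_in_l2 of_ell2_in_l2, of f g]
    by (simp add: l2_inner_eq T_closed of_ell2_in_l2 to_of_ell2 op_def)
  then show "op f \<bullet> g = f \<bullet> op g"
    using restrict[of g f] restrict[of f g] by (simp add: inner_commute)
qed

text \<open>
The imaginary part of \<open>\<langle>T\<^sup>n \<phi>, \<phi>\<rangle>\<close> is zero, so only the real moments matter.
\<close>

lemma is_spectral_measure_iff:
  assumes "\<phi> \<in> l2 V m"
  shows "is_spectral_measure V m T \<phi> \<mu> \<longleftrightarrow> moment_measure op (to_ell2 \<phi>) \<mu>"
proof -
  have "l2_inner V m ((T ^^ n) \<phi>) \<phi> = complex_of_real ((op ^^ n) (to_ell2 \<phi>) \<bullet> to_ell2 \<phi>)" for n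
  proof -
    have "(op ^^ n) f \<bullet> scaleC_ell2 \<i> f = 0" for f
    proof (rule selfadjoint_inner_imaginary)
      show "(op ^^ n) f \<bullet> g = f \<bullet> (op ^^ n) g" for f g
        using op.selfadjoint_poly_op[of "monom 1 n"] by (simp add: poly_op_monom op.linear_axioms)
      show "(op ^^ n) (scaleC_ell2 \<i> f) = scaleC_ell2 \<i> ((op ^^ n) f)" for f
        by (induction n) (simp_all add: op_scaleC)
    qed
    then show ?thesis
      using op_power[OF assms, of n] by (metis assms l2_inner_eq complex_of_real_def)
  qed
  then show ?thesis by (simp add: is_spectral_measure_def moment_measure_def)
qed

lemma moment_spectral_measure:
  assumes "\<phi> \<in> l2 V m"
  shows "moment_measure op (to_ell2 \<phi>) (spectral_measure V m T \<phi>)"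
proof -
  obtain R where "0 < R" "\<forall>f. norm (op f) \<le> R * norm f" using op_bound by blast
  then obtain \<mu> where \<mu>: "moment_measure op (to_ell2 \<phi>) \<mu>"
    using op.exists_moment_measure by blast
  have "spectral_measure V m T \<phi> = \<mu>"
    unfolding spectral_measure_def is_spectral_measure_iff[OF assms]
    by (rule the_equality[where P = "moment_measure op (to_ell2 \<phi>)", OF \<mu>])
      (rule op.moment_measure_unique[OF _ \<mu>])
  then show ?thesis using \<mu> by simp
qed

lemma finite_borel_spectral_measure:
  "\<phi> \<in> l2 V m \<Longrightarrow> finite_borel_measure (spectral_measure V m T \<phi>)"
  using moment_spectral_measure
  by (auto simp: moment_measure_def finite_borel_measure_def finite_borel_measure_axioms_def)

text \<open>
The limit \<open>f(T)\<close> commutes with every bounded operator commuting with \<open>T\<close>. Applied to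
multiplication by scalars this gives complex linearity, and applied to the restriction to \<open>V\<close> it
shows that functions on \<open>V\<close> are preserved; the quadratic form is the defining one.
\<close>

lemma borel_calculus_limit:
  assumes lim: "spectral_limit op R p f"
  shows "borel_calculus V m T (\<lambda>t. complex_of_real (f t)) = (\<lambda>\<phi>\<in>l2 V m. of_ell2 (spectral_limit.E op p (to_ell2 \<phi>)))"
      (is "_ = ?A")
    and "\<phi> \<in> l2 V m \<Longrightarrow>
      l2_inner V m (borel_calculus V m T (\<lambda>t. complex_of_real (f t)) \<phi>) \<phi> =
      (\<integral>t. complex_of_real (f t) \<partial>(spectral_measure V m T \<phi>))"
proof -
  interpret S: spectral_limit op R p f by (rule lim)
  have E_scaleC: "S.E (scaleC_ell2 c f) = scaleC_ell2 c (S.E f)" for c f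
    by (rule S.E_commute[symmetric]) (simp_all add: bounded_linear_scaleC op_scaleC)
  have E_restrict: "restrict_ell2 V (S.E f) = S.E (restrict_ell2 V f)" for f
    by (rule S.E_commute) (simp_all add: bounded_linear_restrict restrict_op op_restrict)
  have to_A: "to_ell2 (?A \<phi>) = S.E (to_ell2 \<phi>)" if "\<phi> \<in> l2 V m" for \<phi>
    using that by (simp add: to_of_ell2 E_restrict restrict_to_ell2)
  obtain K where K: "\<And>g. norm (S.E g) \<le> norm g * K"
    using bounded_linear.bounded[OF S.bounded_linear_E] by blast
  have A_bounded: "bounded_operator V m ?A"
    unfolding bounded_operator_def
  proof (intro conjI ballI allI)
    show "?A \<in> l2 V m \<rightarrow>\<^sub>E l2 V m" by (simp add: of_ell2_in_l2)
    show "?A (\<lambda>x. \<phi> x + \<psi> x) = (\<lambda>x. ?A \<phi> x + ?A \<psi> x)" if "\<phi> \<in> l2 V m" "\<psi> \<in> l2 V m" for \<phi> \<psi>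
      using that by (simp add: l2_add to_ell2_add linear_add[OF bounded_linear.linear[OF S.bounded_linear_E]] of_ell2_add)
    show "?A (\<lambda>x. c * \<phi> x) = (\<lambda>x. c * ?A \<phi> x)" if "\<phi> \<in> l2 V m" for \<phi> c
      using that by (simp add: l2_scale to_ell2_scaleC E_scaleC of_ell2_scaleC)
    have "l2_norm V m (?A \<phi>) \<le> K * l2_norm V m \<phi>" if "\<phi> \<in> l2 V m" for \<phi>
      using K[of "to_ell2 \<phi>"] to_A[OF that] that by (simp add: l2_norm_eq of_ell2_in_l2 mult.commute)
    then show "\<exists>C. \<forall>\<phi>\<in>l2 V m. l2_norm V m (?A \<phi>) \<le> C * l2_norm V m \<phi>" by blast
  qed
  have A_form: "l2_inner V m (?A \<phi>) \<phi> = (\<integral>t. complex_of_real (f t) \<partial>(spectral_measure V m T \<phi>))"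
    if \<phi>: "\<phi> \<in> l2 V m" for \<phi>
  proof -
    have "S.E g \<bullet> scaleC_ell2 \<i> g = 0" for g
      by (rule selfadjoint_inner_imaginary[OF S.E_selfadjoint E_scaleC])
    moreover have "?A \<phi> \<in> l2 V m" using \<phi> by (simp add: of_ell2_in_l2)
    ultimately show ?thesis
      using S.inner_E[OF moment_spectral_measure[OF \<phi>]] to_A[OF \<phi>] \<phi>
      by (simp only: l2_inner_eq complex_of_real_def[symmetric] integral_complex_of_real)
  qed
  show eq: "borel_calculus V m T (\<lambda>t. complex_of_real (f t)) = ?A"
    unfolding borel_calculus_def
  proof (rule the_equality)
    show "bounded_operator V m ?A \<and> (\<forall>\<phi>\<in>l2 V m. l2_inner V m (?A \<phi>) \<phi> =
        (\<integral>t. complex_of_real (f t) \<partial>(spectral_measure V m T \<phi>)))"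
      using A_bounded A_form by blast
    fix B assume "bounded_operator V m B \<and> (\<forall>\<phi>\<in>l2 V m. l2_inner V m (B \<phi>) \<phi> =
        (\<integral>t. complex_of_real (f t) \<partial>(spectral_measure V m T \<phi>)))"
    then show "B = ?A" using A_bounded A_form by (intro bounded_operator_eqI) auto
  qed
  show "\<phi> \<in> l2 V m \<Longrightarrow>
      l2_inner V m (borel_calculus V m T (\<lambda>t. complex_of_real (f t)) \<phi>) \<phi> =
      (\<integral>t. complex_of_real (f t) \<partial>(spectral_measure V m T \<phi>))"
    unfolding eq by (rule A_form)
qed

text \<open>
The hypothesis on \<open>B\<close> holds for points and for left half-lines, the sets that occur below.
\<close>

lemma spectral_projection_limit:
  assumes "\<And>R. \<exists>p. poly_approx R p (indicator B)" "B \<in> sets borel"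
  obtains R p where "spectral_limit op R p (indicator B)"
    "spectral_projection V m T B = (\<lambda>\<phi>\<in>l2 V m. of_ell2 (spectral_limit.E op p (to_ell2 \<phi>)))"
    "\<And>\<phi>. \<phi> \<in> l2 V m \<Longrightarrow> l2_inner V m (spectral_projection V m T B \<phi>) \<phi> =
      complex_of_real (measure (spectral_measure V m T \<phi>) B)"
proof -
  obtain R where R: "0 < R" "\<And>f. norm (op f) \<le> R * norm f" using op_bound by blast
  obtain p where p: "poly_approx R p (indicator B)" using assms(1) by blast
  have lim: "spectral_limit op R p (indicator B)"
    by unfold_locales (use R p assms(2) in auto)
  have ind: "(indicator B :: real \<Rightarrow> complex) = (\<lambda>t. complex_of_real (indicator B t))"
    by (auto simp: indicator_def fun_eq_iff)
  show ?thesis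
  proof (rule that[OF lim])
    show "spectral_projection V m T B = (\<lambda>\<phi>\<in>l2 V m. of_ell2 (spectral_limit.E op p (to_ell2 \<phi>)))"
      unfolding spectral_projection_def ind by (rule borel_calculus_limit(1)[OF lim])
    show "l2_inner V m (spectral_projection V m T B \<phi>) \<phi> = complex_of_real (measure (spectral_measure V m T \<phi>) B)"
      if \<phi>: "\<phi> \<in> l2 V m" for \<phi>
    proof -
      interpret M: finite_borel_measure "spectral_measure V m T \<phi>"
        by (rule finite_borel_spectral_measure[OF \<phi>])
      show ?thesis
        unfolding spectral_projection_def ind borel_calculus_limit(2)[OF lim \<phi>] integral_complex_of_real
        by (simp add: M.borel_UNIV)
    qed
  qed
qed

lemma eigenfunction_to_ell2:
  "eigenfunction V m T l \<phi> \<Longrightarrow> \<phi> \<in> l2 V m \<and> op (to_ell2 \<phi>) = l *\<^sub>R to_ell2 \<phi> \<and> to_ell2 \<phi> \<noteq> 0"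
proof -
  assume *: "eigenfunction V m T l \<phi>"
  then have \<phi>: "\<phi> \<in> l2 V m" and T: "T \<phi> = (\<lambda>x. complex_of_real l * \<phi> x)" and n0: "\<phi> \<noteq> (\<lambda>x. 0)"
    by (auto simp: eigenfunction_def)
  have "op (to_ell2 \<phi>) = l *\<^sub>R to_ell2 \<phi>"
    by (rule ell2_eqI) (simp add: op_to_ell2 T \<phi> to_ell2_scaleC scaleR_conv_of_real)
  moreover have "to_ell2 \<phi> \<noteq> 0"
  proof
    assume "to_ell2 \<phi> = 0"
    then have "of_ell2 (to_ell2 \<phi>) = (\<lambda>x. 0)" by (simp add: of_ell2_def fun_eq_iff)
    then show False using n0 by (simp add: of_to_ell2 \<phi>)
  qed
  ultimately show ?thesis using \<phi> by blast
qed

lemma eigenfunction_of_ell2: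
  assumes "op f = l *\<^sub>R f" "of_ell2 f \<noteq> (\<lambda>x. 0)"
  shows "eigenfunction V m T l (of_ell2 f)"
proof -
  have "T (of_ell2 f) = of_ell2 (l *\<^sub>R f)" by (simp add: assms(1) of_ell2_op[symmetric])
  then have "T (of_ell2 f) = (\<lambda>x. complex_of_real l * of_ell2 f x)"
    by (auto simp: of_ell2_def fun_eq_iff scaleR_conv_of_real)
  then show ?thesis using assms by (simp add: eigenfunction_def of_ell2_in_l2)
qed

text \<open>
The projection fixes every eigenfunction, and its values are eigenfunctions or zero.
\<close>

lemma spectral_projection_eq_zero_iff:
  "spectral_projection V m T {l} = zero_operator V m \<longleftrightarrow> \<not> (\<exists>\<phi>. eigenfunction V m T l \<phi>)"
proof -
  obtain R p where lim: "spectral_limit op R p (indicator {l})"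
    and eq: "spectral_projection V m T {l} = (\<lambda>\<phi>\<in>l2 V m. of_ell2 (spectral_limit.E op p (to_ell2 \<phi>)))"
    by (rule spectral_projection_limit[OF poly_approx_singleton, of l]) auto
  interpret S: spectral_limit op R p "indicator {l}" by (rule lim)
  show ?thesis
  proof
    assume 0: "spectral_projection V m T {l} = zero_operator V m"
    show "\<not> (\<exists>\<phi>. eigenfunction V m T l \<phi>)"
    proof
      assume "\<exists>\<phi>. eigenfunction V m T l \<phi>"
      then obtain \<phi> where ef: "eigenfunction V m T l \<phi>" ..
      from eigenfunction_to_ell2[OF ef] have \<phi>: "\<phi> \<in> l2 V m" "S.E (to_ell2 \<phi>) = to_ell2 \<phi>"
        using S.E_eigenvector[of "to_ell2 \<phi>" l] by auto
      have "\<phi> = spectral_projection V m T {l} \<phi>" using \<phi> by (simp add: eq of_to_ell2)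
      then have "\<phi> = (\<lambda>x. 0)" using 0 \<phi> by (simp add: zero_operator_def)
      then show False using ef by (simp add: eigenfunction_def)
    qed
  next
    assume none: "\<not> (\<exists>\<phi>. eigenfunction V m T l \<phi>)"
    have "of_ell2 (S.E f) = (\<lambda>x. 0)" for f
      using eigenfunction_of_ell2[OF S.eigenvector_E, of l f] none by (auto simp: indicator_def)
    then show "spectral_projection V m T {l} = zero_operator V m"
      by (simp add: eq zero_operator_def)
  qed
qed

lemma indicator_in_l2: "x \<in> V \<Longrightarrow> indicator {x} \<in> l2 V m"
  and to_ell2_indicator: "x \<in> V \<Longrightarrow> to_ell2 (indicator {x}) = unit_ell2 (complex_of_real (sqrt (m x))) x"
proof -
  assume x: "x \<in> V"
  have "indicator {x} = of_ell2 (unit_ell2 (complex_of_real (sqrt (m x))) x)"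
    using x m_pos[OF x] by (auto simp: of_ell2_def fun_eq_iff indicator_def scaleR_conv_of_real)
  moreover have "restrict_ell2 V (unit_ell2 c x) = unit_ell2 c x" for c
    using x by (intro ell2_eqI) auto
  ultimately show "indicator {x} \<in> l2 V m"
    "to_ell2 (indicator {x}) = unit_ell2 (complex_of_real (sqrt (m x))) x"
    by (simp_all add: of_ell2_in_l2 to_of_ell2)
qed

text \<open>
With \<open>u\<close> the image of \<open>\<delta>\<^sub>x\<close> and \<open>E\<close> the projection onto the eigenspace, the atom has mass
\<open>\<langle>Eu, u\<rangle> = \<parallel>Eu\<parallel>\<^sup>2\<close>. If it vanishes then \<open>\<langle>\<phi>, u\<rangle> = \<langle>E\<phi>, u\<rangle> = \<langle>\<phi>, Eu\<rangle> = 0\<close> for every eigenfunction;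
otherwise \<open>Eu\<close> is an eigenfunction that does not vanish at \<open>x\<close>.
\<close>

lemma spectral_atom_iff:
  assumes x: "x \<in> V"
  shows "measure (spectral_measure V m T (indicator {x})) {l} = 0 \<longleftrightarrow>
    (\<forall>\<phi>. eigenfunction V m T l \<phi> \<longrightarrow> \<phi> x = 0)"
proof -
  obtain R p where lim: "spectral_limit op R p (indicator {l})"
    by (rule spectral_projection_limit[OF poly_approx_singleton, of l]) auto
  interpret S: spectral_limit op R p "indicator {l}" by (rule lim)
  let ?\<mu> = "spectral_measure V m T (indicator {x})"
  interpret M: finite_borel_measure ?\<mu>
    by (rule finite_borel_spectral_measure[OF indicator_in_l2[OF x]])
  define u where "u = unit_ell2 (complex_of_real (sqrt (m x))) x"
  have mm: "moment_measure op u ?\<mu>"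
    using moment_spectral_measure[OF indicator_in_l2[OF x]] by (simp add: u_def to_ell2_indicator x)
  have ip: "S.E u \<bullet> u = measure ?\<mu> {l}"
    using S.inner_E[OF mm] by (simp add: M.borel_UNIV)
  have "(indicator {l} t)\<^sup>2 = (indicator {l} t :: real)" for t by (simp add: indicator_def)
  then have sq: "(norm (S.E u))\<^sup>2 = measure ?\<mu> {l}"
    using S.norm_E[OF mm] by (simp add: M.borel_UNIV)
  show ?thesis
  proof
    assume "measure ?\<mu> {l} = 0"
    then have Eu: "S.E u = 0" using sq by simp
    show "\<forall>\<phi>. eigenfunction V m T l \<phi> \<longrightarrow> \<phi> x = 0"
    proof (intro allI impI)
      fix \<phi> assume ef: "eigenfunction V m T l \<phi>"
      from eigenfunction_to_ell2[OF ef] have \<phi>: "\<phi> \<in> l2 V m" "S.E (to_ell2 \<phi>) = to_ell2 \<phi>"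
        using S.E_eigenvector[of "to_ell2 \<phi>" l] by auto
      let ?c = "coord (to_ell2 \<phi>) x"
      have "unit_ell2 ?c x = scaleC_ell2 (?c / complex_of_real (sqrt (m x))) u"
        using m_pos[OF x] by (intro ell2_eqI) (simp add: u_def)
      moreover have "S.E (scaleC_ell2 c u) = scaleC_ell2 c (S.E u)" for c
        by (rule S.E_commute[symmetric]) (simp_all add: bounded_linear_scaleC op_scaleC)
      ultimately have "S.E (unit_ell2 ?c x) = scaleC_ell2 (?c / complex_of_real (sqrt (m x))) 0"
        using Eu by simp
      also have "\<dots> = 0" by (rule ell2_eqI) simp
      finally have "to_ell2 \<phi> \<bullet> unit_ell2 ?c x = 0"
        using S.E_selfadjoint[of "to_ell2 \<phi>" "unit_ell2 ?c x"] \<phi>(2) by simp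
      then have "?c = 0" by (simp add: inner_unit)
      then show "\<phi> x = 0" using x m_pos[OF x] by (simp add: coord_to_ell2 \<phi>)
    qed
  next
    assume all: "\<forall>\<phi>. eigenfunction V m T l \<phi> \<longrightarrow> \<phi> x = 0"
    have "op (S.E u) = l *\<^sub>R S.E u" by (rule S.eigenvector_E) (simp add: indicator_def)
    then have "of_ell2 (S.E u) x = 0"
      using eigenfunction_of_ell2 all by metis
    then have "coord (S.E u) x = 0" using x m_pos[OF x] by (simp add: of_ell2_def)
    then show "measure ?\<mu> {l} = 0" using ip by (simp add: u_def inner_unit)
  qed
qed

end

context l2_space
begin

lemma l2_inner_add:
  assumes "\<phi> \<in> l2 V m" "\<psi> \<in> l2 V m" "\<xi> \<in> l2 V m"
  shows "l2_inner V m (\<lambda>x. \<phi> x + \<psi> x) \<xi> = l2_inner V m \<phi> \<xi> + l2_inner V m \<psi> \<xi>"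
  using infsum_add[OF summable_l2_inner[OF assms(1,3)] summable_l2_inner[OF assms(2,3)]]
  by (simp add: l2_inner_def algebra_simps)

lemma l2_inner_scale: "l2_inner V m (\<lambda>x. c * \<phi> x) \<xi> = c * l2_inner V m \<phi> \<xi>"
  by (simp add: l2_inner_def infsum_cmult_right'[symmetric] mult.assoc)

lemma l2_inner_commute: "l2_inner V m \<psi> \<phi> = cnj (l2_inner V m \<phi> \<psi>)"
  unfolding l2_inner_def by (subst infsum_cnj[symmetric]) (simp add: mult_ac)

lemma cmod_l2_inner_le:
  assumes "\<phi> \<in> l2 V m" "\<psi> \<in> l2 V m"
  shows "cmod (l2_inner V m \<phi> \<psi>) \<le> l2_norm V m \<phi> * l2_norm V m \<psi>"
proof -
  \<comment> \<open>rotating \<open>\<phi>\<close> by the phase of \<open>z\<close> reduces to the real inner product\<close>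
  define z where "z = l2_inner V m \<phi> \<psi>"
  have "(cmod z)\<^sup>2 = Re (cnj z * z)" by (simp add: cmod_power2) (simp add: power2_eq_square)
  also have "\<dots> = Re (l2_inner V m (\<lambda>x. cnj z * \<phi> x) \<psi>)" by (simp only: l2_inner_scale z_def)
  also have "\<dots> = scaleC_ell2 (cnj z) (to_ell2 \<phi>) \<bullet> to_ell2 \<psi>"
    by (simp add: l2_inner_eq l2_scale assms to_ell2_scaleC)
  also have "\<dots> \<le> norm (scaleC_ell2 (cnj z) (to_ell2 \<phi>)) * norm (to_ell2 \<psi>)"
    by (rule norm_cauchy_schwarz)
  finally have "cmod z * cmod z \<le> cmod z * (norm (to_ell2 \<phi>) * norm (to_ell2 \<psi>))"
    by (simp add: norm_scaleC power2_eq_square mult.assoc)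
  then have "cmod z \<le> norm (to_ell2 \<phi>) * norm (to_ell2 \<psi>)"
    by (cases "z = 0") (simp_all add: mult_le_cancel_left_pos)
  then show ?thesis by (simp add: z_def l2_norm_eq assms)
qed

lemma l2_norm_power2: "\<phi> \<in> l2 V m \<Longrightarrow> (l2_norm V m \<phi>)\<^sup>2 = (\<Sum>\<^sub>\<infinity>x\<in>V. (cmod (\<phi> x))\<^sup>2 * m x)"
  unfolding l2_norm_def by (intro real_sqrt_pow2 infsum_nonneg) (simp add: m_pos less_imp_le)

lemma l2_norm_nonneg: "0 \<le> l2_norm V m \<phi>"
  unfolding l2_norm_def by (intro real_sqrt_ge_zero infsum_nonneg) (simp add: m_pos less_imp_le)

lemma l2_norm_add_le:
  assumes "\<phi> \<in> l2 V m" "\<psi> \<in> l2 V m"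
  shows "l2_norm V m (\<lambda>x. \<phi> x + \<psi> x) \<le> l2_norm V m \<phi> + l2_norm V m \<psi>"
  by (simp add: l2_norm_eq assms l2_add to_ell2_add norm_triangle_ineq)

lemma l2_dominated:
  assumes zero: "\<And>x. x \<notin> V \<Longrightarrow> g x = 0" and B: "B summable_on V"
    and le: "\<And>x. x \<in> V \<Longrightarrow> (cmod (g x))\<^sup>2 * m x \<le> B x"
  shows "g \<in> l2 V m" "(l2_norm V m g)\<^sup>2 \<le> (\<Sum>\<^sub>\<infinity>x\<in>V. B x)"
proof -
  have s: "(\<lambda>x. (cmod (g x))\<^sup>2 * m x) summable_on V"
    by (rule summable_on_le_nonneg[OF B]) (auto simp: le m_pos less_imp_le)
  then show g: "g \<in> l2 V m" by (simp add: l2_def zero)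
  show "(l2_norm V m g)\<^sup>2 \<le> (\<Sum>\<^sub>\<infinity>x\<in>V. B x)"
    unfolding l2_norm_power2[OF g] by (intro infsum_mono s B le)
qed

lemma l2_mult:
  assumes \<phi>: "\<phi> \<in> l2 V m" and d: "\<And>x. x \<in> V \<Longrightarrow> cmod (d x) \<le> K" and K: "0 \<le> K"
  shows "(\<lambda>x. d x * \<phi> x) \<in> l2 V m" "l2_norm V m (\<lambda>x. d x * \<phi> x) \<le> K * l2_norm V m \<phi>"
proof -
  have s: "(\<lambda>x. K\<^sup>2 * ((cmod (\<phi> x))\<^sup>2 * m x)) summable_on V"
    using \<phi> by (intro summable_on_cmult_right) (simp add: l2_def)
  have le: "(cmod (d x * \<phi> x))\<^sup>2 * m x \<le> K\<^sup>2 * ((cmod (\<phi> x))\<^sup>2 * m x)" if "x \<in> V" for x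
    using d[OF that] m_pos[OF that]
    by (simp add: norm_mult power_mult_distrib mult.assoc mult_right_mono power_mono)
  have 0: "d x * \<phi> x = 0" if "x \<notin> V" for x using \<phi> that by (simp add: l2_def)
  show "(\<lambda>x. d x * \<phi> x) \<in> l2 V m" by (rule l2_dominated(1)[OF 0 s le])
  have "(l2_norm V m (\<lambda>x. d x * \<phi> x))\<^sup>2 \<le> (K * l2_norm V m \<phi>)\<^sup>2"
    using l2_dominated(2)[OF 0 s le] by (simp add: infsum_cmult_right' power_mult_distrib l2_norm_power2 \<phi>)
  then show "l2_norm V m (\<lambda>x. d x * \<phi> x) \<le> K * l2_norm V m \<phi>"
    by (rule power2_le_imp_le) (simp add: K l2_norm_nonneg)
qed

end

text \<open>
The Cauchy-Schwarz inequality in \<open>l2 B w\<close> against the constant function one.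
\<close>

lemma infsum_Cauchy_Schwarz:
  fixes a :: "'a \<Rightarrow> complex" and w :: "'a \<Rightarrow> real"
  assumes w: "\<And>e. e \<in> B \<Longrightarrow> 0 < w e" "w summable_on B"
    and a: "(\<lambda>e. (cmod (a e))\<^sup>2 * w e) summable_on B"
  shows "(\<lambda>e. a e * complex_of_real (w e)) summable_on B"
    "(cmod (\<Sum>\<^sub>\<infinity>e\<in>B. a e * complex_of_real (w e)))\<^sup>2 \<le> (\<Sum>\<^sub>\<infinity>e\<in>B. w e) * (\<Sum>\<^sub>\<infinity>e\<in>B. (cmod (a e))\<^sup>2 * w e)"
proof -
  interpret l2_space B w by unfold_locales (rule w)
  define a' one where "a' e = (if e \<in> B then a e else 0)" and "one e = (if e \<in> B then 1 else 0 :: complex)" for e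
  have a': "a' \<in> l2 B w" using a by (simp add: l2_def a'_def cong: summable_on_cong)
  have one: "one \<in> l2 B w" using w(2) by (simp add: l2_def one_def cong: summable_on_cong)
  have eq: "a' e * cnj (one e) * complex_of_real (w e) = a e * complex_of_real (w e)" if "e \<in> B" for e
    using that by (simp add: a'_def one_def)
  show "(\<lambda>e. a e * complex_of_real (w e)) summable_on B"
    using summable_l2_inner[OF a' one] eq by (simp cong: summable_on_cong)
  have ip: "l2_inner B w a' one = (\<Sum>\<^sub>\<infinity>e\<in>B. a e * complex_of_real (w e))"
    unfolding l2_inner_def by (rule infsum_cong) (rule eq)
  have "(cmod (l2_inner B w a' one))\<^sup>2 \<le> (l2_norm B w a' * l2_norm B w one)\<^sup>2"
    by (intro power_mono cmod_l2_inner_le a' one) simp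
  also have "\<dots> = (\<Sum>\<^sub>\<infinity>e\<in>B. w e) * (\<Sum>\<^sub>\<infinity>e\<in>B. (cmod (a e))\<^sup>2 * w e)"
    unfolding power_mult_distrib l2_norm_power2[OF a'] l2_norm_power2[OF one]
    by (simp add: a'_def one_def mult.commute cong: infsum_cong)
  finally show "(cmod (\<Sum>\<^sub>\<infinity>e\<in>B. a e * complex_of_real (w e)))\<^sup>2 \<le> (\<Sum>\<^sub>\<infinity>e\<in>B. w e) * (\<Sum>\<^sub>\<infinity>e\<in>B. (cmod (a e))\<^sup>2 * w e)"
    by (simp only: ip)
qed

section \<open>Schroedinger operators are bounded and self-adjoint\<close>

text \<open>
The Sunada-Sy condition and the boundedness of the potential, with their constants fixed.
\<close>

locale schroedinger_graph = weighted_graph \<Gamma> arev mV mE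
  for \<Gamma> :: "('v, 'e) pre_digraph" and arev mV mE +
  fixes q :: "'v \<Rightarrow> real" and C Q :: real
  assumes C_nonneg: "0 \<le> C" and Q_nonneg: "0 \<le> Q"
    and summable_mE: "x \<in> verts \<Gamma> \<Longrightarrow> mE summable_on out_arcs \<Gamma> x"
    and degree_le: "x \<in> verts \<Gamma> \<Longrightarrow> (\<Sum>\<^sub>\<infinity>e\<in>out_arcs \<Gamma> x. mE e) \<le> C * mV x"
    and potential_le: "x \<in> verts \<Gamma> \<Longrightarrow> \<bar>q x\<bar> \<le> Q"
begin

sublocale l2_space "verts \<Gamma>" mV
  by unfold_locales (rule mV_pos)

abbreviation L2 :: "('v \<Rightarrow> complex) set" where "L2 \<equiv> l2 (verts \<Gamma>) mV"

lemma bij_betw_arcs: "bij_betw snd (Sigma (verts \<Gamma>) (out_arcs \<Gamma>)) (arcs \<Gamma>)"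
  by (rule bij_betwI[where g = "\<lambda>e. (tail \<Gamma> e, e)"]) (auto simp: out_arcs_def)

lemma infsum_arcs:
  fixes F :: "'e \<Rightarrow> 'b::banach"
  assumes "F summable_on arcs \<Gamma>"
  shows "(\<lambda>x. \<Sum>\<^sub>\<infinity>e\<in>out_arcs \<Gamma> x. F e) summable_on verts \<Gamma>"
    and "(\<Sum>\<^sub>\<infinity>x\<in>verts \<Gamma>. \<Sum>\<^sub>\<infinity>e\<in>out_arcs \<Gamma> x. F e) = (\<Sum>\<^sub>\<infinity>e\<in>arcs \<Gamma>. F e)"
proof -
  have s: "(\<lambda>(x, e). F e) summable_on Sigma (verts \<Gamma>) (out_arcs \<Gamma>)"
    using assms summable_on_reindex_bij_betw[OF bij_betw_arcs, of F] by (simp add: case_prod_unfold)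
  show "(\<lambda>x. \<Sum>\<^sub>\<infinity>e\<in>out_arcs \<Gamma> x. F e) summable_on verts \<Gamma>"
    by (rule summable_on_Sigma_banach[OF s])
  show "(\<Sum>\<^sub>\<infinity>x\<in>verts \<Gamma>. \<Sum>\<^sub>\<infinity>e\<in>out_arcs \<Gamma> x. F e) = (\<Sum>\<^sub>\<infinity>e\<in>arcs \<Gamma>. F e)"
    using infsum_Sigma'_banach[OF s] infsum_reindex_bij_betw[OF bij_betw_arcs, of F]
    by (simp add: case_prod_unfold)
qed

lemma bij_betw_arev: "bij_betw arev (arcs \<Gamma>) (arcs \<Gamma>)"
  by (rule bij_betwI[where g = arev]) auto

text \<open>
One half of the Schur test: grouping the edges by their origin, the Sunada-Sy condition bounds
the weighted sum of \<open>|\<phi>|\<^sup>2\<close> over the edges by \<open>C \<parallel>\<phi>\<parallel>\<^sup>2\<close>. Reversing the edges gives the other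
half, \<open>summable_head\<close>.
\<close>

lemma summable_tail:
  assumes "\<phi> \<in> L2"
  shows "(\<lambda>e. (cmod (\<phi> (tail \<Gamma> e)))\<^sup>2 * mE e) summable_on arcs \<Gamma>"
    and "(\<Sum>\<^sub>\<infinity>e\<in>arcs \<Gamma>. (cmod (\<phi> (tail \<Gamma> e)))\<^sup>2 * mE e) \<le> C * (l2_norm (verts \<Gamma>) mV \<phi>)\<^sup>2"
proof -
  have s: "(\<lambda>x. C * ((cmod (\<phi> x))\<^sup>2 * mV x)) summable_on verts \<Gamma>"
    using assms by (intro summable_on_cmult_right) (simp add: l2_def)
  let ?g = "\<lambda>x. (cmod (\<phi> x))\<^sup>2 * (\<Sum>\<^sub>\<infinity>e\<in>out_arcs \<Gamma> x. mE e)"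
  have le: "?g x \<le> C * ((cmod (\<phi> x))\<^sup>2 * mV x)" if "x \<in> verts \<Gamma>" for x
    using mult_left_mono[OF degree_le[OF that], of "(cmod (\<phi> x))\<^sup>2"] by (simp add: mult_ac)
  have pos: "0 \<le> (\<Sum>\<^sub>\<infinity>e\<in>out_arcs \<Gamma> x. mE e)" for x
    by (intro infsum_nonneg) (auto simp: out_arcs_def mE_pos less_imp_le)
  have g: "?g summable_on verts \<Gamma>"
    by (rule summable_on_le_nonneg[OF s]) (auto simp: le pos)
  have hs: "((\<lambda>e. (cmod (\<phi> (tail \<Gamma> e)))\<^sup>2 * mE e) has_sum ?g x) (out_arcs \<Gamma> x)" if "x \<in> verts \<Gamma>" for x
  proof -
    have "((\<lambda>e. (cmod (\<phi> x))\<^sup>2 * mE e) has_sum ?g x) (out_arcs \<Gamma> x)"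
      by (intro has_sum_cmult_right has_sum_infsum summable_mE that)
    then show ?thesis by (rule has_sum_cong[THEN iffD1, rotated]) (simp add: out_arcs_def)
  qed
  have "(\<lambda>p. (cmod (\<phi> (tail \<Gamma> (snd p))))\<^sup>2 * mE (snd p)) summable_on Sigma (verts \<Gamma>) (out_arcs \<Gamma>)"
    by (rule summable_on_SigmaI[OF _ g]) (use hs in \<open>auto simp: out_arcs_def mE_pos less_imp_le\<close>)
  then show sa: "(\<lambda>e. (cmod (\<phi> (tail \<Gamma> e)))\<^sup>2 * mE e) summable_on arcs \<Gamma>"
    using summable_on_reindex_bij_betw[OF bij_betw_arcs, of "\<lambda>e. (cmod (\<phi> (tail \<Gamma> e)))\<^sup>2 * mE e"] by simp
  have "(\<Sum>\<^sub>\<infinity>e\<in>arcs \<Gamma>. (cmod (\<phi> (tail \<Gamma> e)))\<^sup>2 * mE e) = (\<Sum>\<^sub>\<infinity>x\<in>verts \<Gamma>. ?g x)"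
    unfolding infsum_arcs(2)[OF sa, symmetric] by (intro infsum_cong infsumI hs)
  also have "\<dots> \<le> (\<Sum>\<^sub>\<infinity>x\<in>verts \<Gamma>. C * ((cmod (\<phi> x))\<^sup>2 * mV x))"
    by (intro infsum_mono g s le)
  finally show "(\<Sum>\<^sub>\<infinity>e\<in>arcs \<Gamma>. (cmod (\<phi> (tail \<Gamma> e)))\<^sup>2 * mE e) \<le> C * (l2_norm (verts \<Gamma>) mV \<phi>)\<^sup>2"
    by (simp add: infsum_cmult_right' l2_norm_power2 assms)
qed

lemma summable_head:
  assumes "\<phi> \<in> L2"
  shows "(\<lambda>e. (cmod (\<phi> (head \<Gamma> e)))\<^sup>2 * mE e) summable_on arcs \<Gamma>"
    and "(\<Sum>\<^sub>\<infinity>e\<in>arcs \<Gamma>. (cmod (\<phi> (head \<Gamma> e)))\<^sup>2 * mE e) \<le> C * (l2_norm (verts \<Gamma>) mV \<phi>)\<^sup>2"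
proof -
  let ?f = "\<lambda>e. (cmod (\<phi> (tail \<Gamma> e)))\<^sup>2 * mE e"
  have eq: "?f (arev e) = (cmod (\<phi> (head \<Gamma> e)))\<^sup>2 * mE e" if "e \<in> arcs \<Gamma>" for e
    using that by (simp add: mE_inv)
  show "(\<lambda>e. (cmod (\<phi> (head \<Gamma> e)))\<^sup>2 * mE e) summable_on arcs \<Gamma>"
    using summable_tail(1)[OF assms] summable_on_reindex_bij_betw[OF bij_betw_arev, of ?f]
    by (simp only: eq cong: summable_on_cong)
  show "(\<Sum>\<^sub>\<infinity>e\<in>arcs \<Gamma>. (cmod (\<phi> (head \<Gamma> e)))\<^sup>2 * mE e) \<le> C * (l2_norm (verts \<Gamma>) mV \<phi>)\<^sup>2"
    using summable_tail(2)[OF assms] infsum_reindex_bij_betw[OF bij_betw_arev, of ?f]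
    by (simp only: eq cong: infsum_cong)
qed

definition adjacency :: "('v \<Rightarrow> complex) \<Rightarrow> 'v \<Rightarrow> complex" where
  "adjacency \<phi> x = (if x \<in> verts \<Gamma> then
     complex_of_real (1 / mV x) * (\<Sum>\<^sub>\<infinity>e\<in>out_arcs \<Gamma> x. \<phi> (head \<Gamma> e) * complex_of_real (mE e)) else 0)"

lemma out_arcs_subset: "out_arcs \<Gamma> x \<subseteq> arcs \<Gamma>" by (auto simp: out_arcs_def)

lemma summable_head_out_arcs:
  assumes "\<phi> \<in> L2" "x \<in> verts \<Gamma>"
  shows "(\<lambda>e. \<phi> (head \<Gamma> e) * complex_of_real (mE e)) summable_on out_arcs \<Gamma> x"
    and "(cmod (\<Sum>\<^sub>\<infinity>e\<in>out_arcs \<Gamma> x. \<phi> (head \<Gamma> e) * complex_of_real (mE e)))\<^sup>2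
      \<le> (\<Sum>\<^sub>\<infinity>e\<in>out_arcs \<Gamma> x. mE e) * (\<Sum>\<^sub>\<infinity>e\<in>out_arcs \<Gamma> x. (cmod (\<phi> (head \<Gamma> e)))\<^sup>2 * mE e)"
proof -
  have "(\<lambda>e. (cmod (\<phi> (head \<Gamma> e)))\<^sup>2 * mE e) summable_on out_arcs \<Gamma> x"
    using summable_head(1)[OF assms(1)] out_arcs_subset by (rule summable_on_subset_banach)
  then show "(\<lambda>e. \<phi> (head \<Gamma> e) * complex_of_real (mE e)) summable_on out_arcs \<Gamma> x"
    "(cmod (\<Sum>\<^sub>\<infinity>e\<in>out_arcs \<Gamma> x. \<phi> (head \<Gamma> e) * complex_of_real (mE e)))\<^sup>2
      \<le> (\<Sum>\<^sub>\<infinity>e\<in>out_arcs \<Gamma> x. mE e) * (\<Sum>\<^sub>\<infinity>e\<in>out_arcs \<Gamma> x. (cmod (\<phi> (head \<Gamma> e)))\<^sup>2 * mE e)"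
    using infsum_Cauchy_Schwarz[of "out_arcs \<Gamma> x" mE "\<lambda>e. \<phi> (head \<Gamma> e)"] summable_mE[OF assms(2)] mE_pos out_arcs_subset
    by (auto simp: out_arcs_def)
qed

lemma adjacency_l2:
  assumes \<phi>: "\<phi> \<in> L2"
  shows "adjacency \<phi> \<in> L2" "l2_norm (verts \<Gamma>) mV (adjacency \<phi>) \<le> C * l2_norm (verts \<Gamma>) mV \<phi>"
proof -
  let ?s = "\<lambda>x. \<Sum>\<^sub>\<infinity>e\<in>out_arcs \<Gamma> x. (cmod (\<phi> (head \<Gamma> e)))\<^sup>2 * mE e"
  have s: "(\<lambda>x. C * ?s x) summable_on verts \<Gamma>"
    by (intro summable_on_cmult_right infsum_arcs summable_head \<phi>)
  have le: "(cmod (adjacency \<phi> x))\<^sup>2 * mV x \<le> C * ?s x" if x: "x \<in> verts \<Gamma>" for x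
  proof -
    have m: "0 < mV x" by (rule mV_pos[OF x])
    have "(cmod (\<Sum>\<^sub>\<infinity>e\<in>out_arcs \<Gamma> x. \<phi> (head \<Gamma> e) * complex_of_real (mE e)))\<^sup>2 \<le> (C * mV x) * ?s x"
      by (rule order_trans[OF summable_head_out_arcs(2)[OF \<phi> x]])
        (intro mult_right_mono degree_le x infsum_nonneg mult_nonneg_nonneg,
          auto simp: out_arcs_def mE_pos less_imp_le)
    from divide_right_mono[OF this, of "mV x"] show ?thesis
      using x m by (simp add: adjacency_def norm_mult norm_divide power_divide power2_eq_square field_simps)
  qed
  have 0: "adjacency \<phi> x = 0" if "x \<notin> verts \<Gamma>" for x using that by (simp add: adjacency_def)
  show "adjacency \<phi> \<in> L2" by (rule l2_dominated(1)[OF 0 s le])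
  have "(l2_norm (verts \<Gamma>) mV (adjacency \<phi>))\<^sup>2 \<le> C * (\<Sum>\<^sub>\<infinity>x\<in>verts \<Gamma>. ?s x)"
    using l2_dominated(2)[OF 0 s le] by (simp add: infsum_cmult_right')
  also have "\<dots> \<le> C * (C * (l2_norm (verts \<Gamma>) mV \<phi>)\<^sup>2)"
    using summable_head[OF \<phi>] by (intro mult_left_mono C_nonneg) (simp add: infsum_arcs)
  finally have "(l2_norm (verts \<Gamma>) mV (adjacency \<phi>))\<^sup>2 \<le> (C * l2_norm (verts \<Gamma>) mV \<phi>)\<^sup>2"
    by (simp add: power2_eq_square mult_ac)
  then show "l2_norm (verts \<Gamma>) mV (adjacency \<phi>) \<le> C * l2_norm (verts \<Gamma>) mV \<phi>"
    by (rule power2_le_imp_le) (simp add: C_nonneg l2_norm_nonneg)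
qed

lemma adjacency_add:
  assumes "\<phi> \<in> L2" "\<psi> \<in> L2"
  shows "adjacency (\<lambda>x. \<phi> x + \<psi> x) x = adjacency \<phi> x + adjacency \<psi> x"
proof (cases "x \<in> verts \<Gamma>")
  case True
  then show ?thesis
    using infsum_add[OF summable_head_out_arcs(1)[OF assms(1) True] summable_head_out_arcs(1)[OF assms(2) True]]
    by (simp add: adjacency_def algebra_simps)
qed (simp add: adjacency_def)

lemma adjacency_scale: "adjacency (\<lambda>x. c * \<phi> x) x = c * adjacency \<phi> x"
  by (simp add: adjacency_def infsum_cmult_right' mult.assoc)

lemma l2_inner_adjacency:
  assumes \<phi>: "\<phi> \<in> L2" and \<psi>: "\<psi> \<in> L2"
  shows "(\<lambda>e. \<phi> (head \<Gamma> e) * cnj (\<psi> (tail \<Gamma> e)) * complex_of_real (mE e)) summable_on arcs \<Gamma>"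
    and "l2_inner (verts \<Gamma>) mV (adjacency \<phi>) \<psi> =
      (\<Sum>\<^sub>\<infinity>e\<in>arcs \<Gamma>. \<phi> (head \<Gamma> e) * cnj (\<psi> (tail \<Gamma> e)) * complex_of_real (mE e))"
proof -
  interpret arcs: l2_space "arcs \<Gamma>" mE by unfold_locales (rule mE_pos)
  let ?h = "\<lambda>e. if e \<in> arcs \<Gamma> then \<phi> (head \<Gamma> e) else 0"
  let ?t = "\<lambda>e. if e \<in> arcs \<Gamma> then \<psi> (tail \<Gamma> e) else 0"
  let ?F = "\<lambda>e. \<phi> (head \<Gamma> e) * cnj (\<psi> (tail \<Gamma> e)) * complex_of_real (mE e)"
  have "?h \<in> l2 (arcs \<Gamma>) mE" "?t \<in> l2 (arcs \<Gamma>) mE"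
    using summable_head(1)[OF \<phi>] summable_tail(1)[OF \<psi>] by (simp_all add: l2_def cong: summable_on_cong)
  from arcs.summable_l2_inner[OF this] show s: "?F summable_on arcs \<Gamma>"
    by (simp cong: summable_on_cong)
  have "adjacency \<phi> x * cnj (\<psi> x) * complex_of_real (mV x) = (\<Sum>\<^sub>\<infinity>e\<in>out_arcs \<Gamma> x. ?F e)"
    if x: "x \<in> verts \<Gamma>" for x
  proof -
    have "adjacency \<phi> x * cnj (\<psi> x) * complex_of_real (mV x) =
        (\<Sum>\<^sub>\<infinity>e\<in>out_arcs \<Gamma> x. \<phi> (head \<Gamma> e) * complex_of_real (mE e)) * cnj (\<psi> x)"
      using x mV_pos[OF x] by (simp add: adjacency_def)
    also have "\<dots> = (\<Sum>\<^sub>\<infinity>e\<in>out_arcs \<Gamma> x. \<phi> (head \<Gamma> e) * complex_of_real (mE e) * cnj (\<psi> x))"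
      by (rule infsum_cmult_left'[symmetric])
    also have "\<dots> = (\<Sum>\<^sub>\<infinity>e\<in>out_arcs \<Gamma> x. ?F e)"
      by (intro infsum_cong) (simp add: out_arcs_def mult_ac)
    finally show ?thesis .
  qed
  then have "l2_inner (verts \<Gamma>) mV (adjacency \<phi>) \<psi> = (\<Sum>\<^sub>\<infinity>x\<in>verts \<Gamma>. \<Sum>\<^sub>\<infinity>e\<in>out_arcs \<Gamma> x. ?F e)"
    unfolding l2_inner_def by (intro infsum_cong)
  then show "l2_inner (verts \<Gamma>) mV (adjacency \<phi>) \<psi> = (\<Sum>\<^sub>\<infinity>e\<in>arcs \<Gamma>. ?F e)"
    by (simp add: infsum_arcs(2)[OF s])
qed

text \<open>
Both sides are sums over all edges, and the reversal of edges exchanges them.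
\<close>

lemma adjacency_symmetric:
  assumes \<phi>: "\<phi> \<in> L2" and \<psi>: "\<psi> \<in> L2"
  shows "l2_inner (verts \<Gamma>) mV (adjacency \<phi>) \<psi> = l2_inner (verts \<Gamma>) mV \<phi> (adjacency \<psi>)"
proof -
  let ?F = "\<lambda>e. \<phi> (head \<Gamma> e) * cnj (\<psi> (tail \<Gamma> e)) * complex_of_real (mE e)"
  have "l2_inner (verts \<Gamma>) mV \<phi> (adjacency \<psi>) =
      (\<Sum>\<^sub>\<infinity>e\<in>arcs \<Gamma>. cnj (\<psi> (head \<Gamma> e) * cnj (\<phi> (tail \<Gamma> e)) * complex_of_real (mE e)))"
    by (subst l2_inner_commute) (simp only: l2_inner_adjacency(2)[OF \<psi> \<phi>] infsum_cnj)
  also have "\<dots> = (\<Sum>\<^sub>\<infinity>e\<in>arcs \<Gamma>. ?F (arev e))"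
    by (intro infsum_cong) (simp add: mE_inv mult_ac)
  also have "\<dots> = (\<Sum>\<^sub>\<infinity>e\<in>arcs \<Gamma>. ?F e)"
    by (rule infsum_reindex_bij_betw[OF bij_betw_arev, of ?F])
  finally show ?thesis by (simp add: l2_inner_adjacency assms)
qed

definition diagonal :: "'v \<Rightarrow> complex" where
  "diagonal x = complex_of_real ((1 / mV x) * (\<Sum>\<^sub>\<infinity>e\<in>out_arcs \<Gamma> x. mE e) + q x)"

abbreviation H :: "('v \<Rightarrow> complex) \<Rightarrow> 'v \<Rightarrow> complex" where "H \<equiv> schroedinger \<Gamma> mV mE q"

lemma H_eq: "\<phi> \<in> L2 \<Longrightarrow> H \<phi> = (\<lambda>x. diagonal x * \<phi> x + (-1) * adjacency \<phi> x)"
  by (auto simp: schroedinger_def laplacian_def diagonal_def adjacency_def fun_eq_iff l2_def algebra_simps)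

lemma diagonal_bound: "x \<in> verts \<Gamma> \<Longrightarrow> cmod (diagonal x) \<le> C + Q"
proof -
  assume x: "x \<in> verts \<Gamma>"
  have m: "0 < mV x" by (rule mV_pos[OF x])
  have "0 \<le> (\<Sum>\<^sub>\<infinity>e\<in>out_arcs \<Gamma> x. mE e)"
    by (intro infsum_nonneg) (auto simp: out_arcs_def mE_pos less_imp_le)
  moreover have "(1 / mV x) * (\<Sum>\<^sub>\<infinity>e\<in>out_arcs \<Gamma> x. mE e) \<le> C"
    using degree_le[OF x] m by (simp add: divide_simps)
  ultimately have "\<bar>(1 / mV x) * (\<Sum>\<^sub>\<infinity>e\<in>out_arcs \<Gamma> x. mE e)\<bar> \<le> C" using m by simp
  then show ?thesis unfolding diagonal_def norm_of_real using potential_le[OF x] by linarith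
qed

lemma H_l2:
  assumes \<phi>: "\<phi> \<in> L2"
  shows "H \<phi> \<in> L2" "l2_norm (verts \<Gamma>) mV (H \<phi>) \<le> (C + Q + C) * l2_norm (verts \<Gamma>) mV \<phi>"
proof -
  have 1: "(\<lambda>x. diagonal x * \<phi> x) \<in> L2" "l2_norm (verts \<Gamma>) mV (\<lambda>x. diagonal x * \<phi> x) \<le> (C + Q) * l2_norm (verts \<Gamma>) mV \<phi>"
    using l2_mult[OF \<phi> diagonal_bound] C_nonneg Q_nonneg by auto
  have 2: "(\<lambda>x. (-1) * adjacency \<phi> x) \<in> L2" "l2_norm (verts \<Gamma>) mV (\<lambda>x. (-1) * adjacency \<phi> x) \<le> 1 * l2_norm (verts \<Gamma>) mV (adjacency \<phi>)"
    using l2_mult[OF adjacency_l2(1)[OF \<phi>], of "\<lambda>_. -1" 1] by auto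
  show "H \<phi> \<in> L2" unfolding H_eq[OF \<phi>] by (rule l2_add[OF 1(1) 2(1)])
  have "l2_norm (verts \<Gamma>) mV (H \<phi>) \<le> l2_norm (verts \<Gamma>) mV (\<lambda>x. diagonal x * \<phi> x) + l2_norm (verts \<Gamma>) mV (\<lambda>x. (-1) * adjacency \<phi> x)"
    unfolding H_eq[OF \<phi>] by (rule l2_norm_add_le[OF 1(1) 2(1)])
  then show "l2_norm (verts \<Gamma>) mV (H \<phi>) \<le> (C + Q + C) * l2_norm (verts \<Gamma>) mV \<phi>"
    using 1(2) 2(2) adjacency_l2(2)[OF \<phi>] by (simp add: distrib_right)
qed

lemma H_symmetric:
  assumes \<phi>: "\<phi> \<in> L2" and \<psi>: "\<psi> \<in> L2"
  shows "l2_inner (verts \<Gamma>) mV (H \<phi>) \<psi> = l2_inner (verts \<Gamma>) mV \<phi> (H \<psi>)"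
proof -
  have H: "l2_inner (verts \<Gamma>) mV (H \<phi>) \<psi> =
      l2_inner (verts \<Gamma>) mV (\<lambda>x. diagonal x * \<phi> x) \<psi> - l2_inner (verts \<Gamma>) mV (adjacency \<phi>) \<psi>"
    if "\<phi> \<in> L2" "\<psi> \<in> L2" for \<phi> \<psi>
  proof -
    have "(\<lambda>x. diagonal x * \<phi> x) \<in> L2" using l2_mult(1)[OF that(1) diagonal_bound] C_nonneg Q_nonneg by auto
    then show ?thesis
      unfolding H_eq[OF that(1)]
      by (subst l2_inner_add) (simp_all add: l2_scale adjacency_l2 that l2_inner_scale[of "-1", simplified]
          l2_scale[of _ "-1", simplified])
  qed
  have D: "l2_inner (verts \<Gamma>) mV (\<lambda>x. diagonal x * \<phi> x) \<psi> = cnj (l2_inner (verts \<Gamma>) mV (\<lambda>x. diagonal x * \<psi> x) \<phi>)"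
    unfolding l2_inner_def infsum_cnj[symmetric] by (intro infsum_cong) (simp add: diagonal_def mult_ac)
  have A: "l2_inner (verts \<Gamma>) mV (adjacency \<phi>) \<psi> = cnj (l2_inner (verts \<Gamma>) mV (adjacency \<psi>) \<phi>)"
    using adjacency_symmetric[OF \<phi> \<psi>] l2_inner_commute by metis
  show ?thesis
    by (subst (2) l2_inner_commute) (simp add: H assms A D)
qed

lemma bounded_operator_H: "bounded_operator (verts \<Gamma>) mV H"
  unfolding bounded_operator_def
proof (intro conjI ballI allI)
  show "H \<in> L2 \<rightarrow>\<^sub>E L2"
  proof
    show "H \<phi> = undefined" if "\<phi> \<notin> L2" for \<phi> using that by (simp add: schroedinger_def)
  qed (rule H_l2)
  show "H (\<lambda>x. \<phi> x + \<psi> x) = (\<lambda>x. H \<phi> x + H \<psi> x)" if "\<phi> \<in> L2" "\<psi> \<in> L2" for \<phi> \<psi>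
    using that by (simp add: H_eq l2_add adjacency_add algebra_simps)
  show "H (\<lambda>x. c * \<phi> x) = (\<lambda>x. c * H \<phi> x)" if "\<phi> \<in> L2" for \<phi> c
    using that by (simp add: H_eq l2_scale adjacency_scale algebra_simps)
  show "\<exists>C. \<forall>\<phi>\<in>L2. l2_norm (verts \<Gamma>) mV (H \<phi>) \<le> C * l2_norm (verts \<Gamma>) mV \<phi>"
    using H_l2(2) by blast
qed

sublocale selfadjoint_l2 "verts \<Gamma>" mV H
  by unfold_locales (rule bounded_operator_H, rule H_symmetric)

end

section \<open>A dimension estimate\<close>

text \<open>
The square of the distance of \<open>c\<close> from its orthogonal projection is nonnegative.
\<close>

lemma bessel:
  fixes c :: "'a::real_inner"
  assumes "finite I" and e: "\<And>i j. i \<in> I \<Longrightarrow> j \<in> I \<Longrightarrow> e i \<bullet> e j = (if i = j then 1 else 0)"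
  shows "(\<Sum>i\<in>I. (c \<bullet> e i)\<^sup>2) \<le> c \<bullet> c"
proof -
  define s where "s = (\<Sum>i\<in>I. (c \<bullet> e i) *\<^sub>R e i)"
  have "s \<bullet> s = (\<Sum>i\<in>I. \<Sum>j\<in>I. (c \<bullet> e i) * ((c \<bullet> e j) * (e j \<bullet> e i)))"
    by (simp add: s_def inner_sum_left inner_sum_right sum_distrib_left)
  also have "\<dots> = (\<Sum>i\<in>I. \<Sum>j\<in>I. if i = j then (c \<bullet> e i)\<^sup>2 else 0)"
    by (intro sum.cong refl) (simp add: e power2_eq_square)
  also have "\<dots> = (\<Sum>i\<in>I. (c \<bullet> e i)\<^sup>2)" using assms(1) by simp
  finally have ss: "s \<bullet> s = (\<Sum>i\<in>I. (c \<bullet> e i)\<^sup>2)" .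
  have cs: "c \<bullet> s = (\<Sum>i\<in>I. (c \<bullet> e i)\<^sup>2)"
    by (simp add: s_def inner_sum_right power2_eq_square)
  have "0 \<le> (c - s) \<bullet> (c - s)" by simp
  also have "\<dots> = c \<bullet> c - (\<Sum>i\<in>I. (c \<bullet> e i)\<^sup>2)"
    by (simp add: inner_diff_left inner_diff_right ss cs inner_commute[of s c])
  finally show ?thesis by simp
qed

text \<open>
A form of the inequality \<open>\<Sum>\<^sub>i \<langle>P e\<^sub>i, e\<^sub>i\<rangle> \<le> dim\<close> for the projection \<open>P\<close> onto a finite-dimensional
space, with \<open>\<langle>P e\<^sub>i, e\<^sub>i\<rangle> = \<parallel>P e\<^sub>i\<parallel>\<^sup>2\<close> replaced by the square of the lower bound \<open>|\<langle>w\<^sub>i, e\<^sub>i\<rangle>| / \<parallel>w\<^sub>i\<parallel>\<close> that any vector \<open>w\<^sub>i\<close> of the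
space provides. Expand \<open>w\<^sub>i\<close> in an orthogonal basis, use the Cauchy-Schwarz inequality, and sum
the coefficients of each basis vector by Bessel's inequality.
\<close>

lemma sum_inner_power2_le_dim:
  fixes w e :: "'i \<Rightarrow> 'a::real_inner"
  assumes B: "finite B" and I: "finite I"
    and e: "\<And>i j. i \<in> I \<Longrightarrow> j \<in> I \<Longrightarrow> e i \<bullet> e j = (if i = j then 1 else 0)"
    and w: "\<And>i. i \<in> I \<Longrightarrow> w i \<in> span B" "\<And>i. i \<in> I \<Longrightarrow> norm (w i) \<le> M"
  shows "(\<Sum>i\<in>I. (w i \<bullet> e i)\<^sup>2) \<le> M\<^sup>2 * real (card B)"
proof -
  obtain C0 where C0: "finite C0" "card C0 \<le> card B" "span C0 = span B" "pairwise orthogonal C0"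
    using basis_orthogonal[OF B] by blast
  \<comment> \<open>the zero vector is removed so that the squared norms can be divided by\<close>
  define C where "C = C0 - {0}"
  have C: "finite C" "span C = span B" "pairwise orthogonal C" "0 \<notin> C"
    using C0 by (auto simp: C_def pairwise_def)
  have card: "card C \<le> card B"
    using C0 card_mono[of C0 C] by (auto simp: C_def)
  have coeff_le: "(w i \<bullet> e i)\<^sup>2 \<le> M\<^sup>2 * (\<Sum>c\<in>C. (c \<bullet> e i)\<^sup>2 / (c \<bullet> c))" if i: "i \<in> I" for i
  proof -
    obtain a where a: "w i = (\<Sum>c\<in>C. a c *\<^sub>R c)"
      using w(1)[OF i] C span_finite[OF C(1)] by auto
    have "(norm (w i))\<^sup>2 = (\<Sum>c\<in>C. (norm (a c *\<^sub>R c))\<^sup>2)"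
      unfolding a using C(1,3)
      by (intro norm_sum_Pythagorean) (auto simp: pairwise_def orthogonal_def)
    then have nw: "(\<Sum>c\<in>C. (a c * norm c)\<^sup>2) \<le> M\<^sup>2"
      using power_mono[OF w(2)[OF i], of 2] by (simp add: power_mult_distrib)
    have "w i \<bullet> e i = (\<Sum>c\<in>C. (a c * norm c) * ((c \<bullet> e i) / norm c))"
      unfolding a inner_sum_left using C(4) by (intro sum.cong) auto
    then have "(w i \<bullet> e i)\<^sup>2 \<le> (\<Sum>c\<in>C. (a c * norm c)\<^sup>2) * (\<Sum>c\<in>C. ((c \<bullet> e i) / norm c)\<^sup>2)"
      by (simp only: Cauchy_Schwarz_ineq_sum)
    also have "\<dots> \<le> M\<^sup>2 * (\<Sum>c\<in>C. ((c \<bullet> e i) / norm c)\<^sup>2)"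
      by (intro mult_right_mono nw sum_nonneg) simp
    finally show ?thesis by (simp add: power_divide power2_norm_eq_inner)
  qed
  have "(\<Sum>i\<in>I. (w i \<bullet> e i)\<^sup>2) \<le> (\<Sum>i\<in>I. M\<^sup>2 * (\<Sum>c\<in>C. (c \<bullet> e i)\<^sup>2 / (c \<bullet> c)))"
    by (intro sum_mono coeff_le)
  also have "\<dots> = M\<^sup>2 * (\<Sum>c\<in>C. (\<Sum>i\<in>I. (c \<bullet> e i)\<^sup>2) / (c \<bullet> c))"
    by (simp add: sum_distrib_left[symmetric] sum_divide_distrib sum.swap[of _ C I])
  also have "\<dots> \<le> M\<^sup>2 * (\<Sum>c\<in>C. 1)"
  proof (intro mult_left_mono sum_mono)
    fix c assume "c \<in> C"
    then have "0 < c \<bullet> c" using C(4) by auto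
    then show "(\<Sum>i\<in>I. (c \<bullet> e i)\<^sup>2) / (c \<bullet> c) \<le> 1"
      using bessel[OF I e, of c] by simp
  qed simp
  also have "\<dots> \<le> M\<^sup>2 * real (card B)" using card by (simp add: mult_left_mono)
  finally show ?thesis .
qed

lemma finite_basis_of_injective:
  fixes W :: "'a::real_vector set" and L :: "'a \<Rightarrow> 'b::real_vector"
  assumes W: "subspace W" and L: "linear L" and inj: "\<And>w. w \<in> W \<Longrightarrow> L w = 0 \<Longrightarrow> w = 0"
    and U: "finite U" "\<And>w. L w \<in> span U"
  obtains B where "finite B" "card B \<le> card U" "W \<subseteq> span B"
proof -
  obtain B where B: "B \<subseteq> W" "independent B" "W \<subseteq> span B"
    using maximal_independent_subset[of W] by blast
  have span: "span B = W" using B W by (metis span_minimal subset_antisym)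
  have inj_on: "inj_on L W"
  proof (rule inj_onI)
    fix v w assume "v \<in> W" "w \<in> W" "L v = L w"
    then have "L (v - w) = 0" "v - w \<in> W"
      by (simp_all add: linear_diff[OF L] subspace_diff[OF W])
    then show "v = w" using inj by fastforce
  qed
  have "independent (L ` B)"
    using linear_independent_injective_image[OF L B(2)] inj_on span by simp
  then have "finite (L ` B) \<and> card (L ` B) \<le> card U"
    by (rule independent_span_bound[OF U(1)]) (use U(2) in auto)
  moreover have "inj_on L B" using inj_on B(1) by (rule inj_on_subset)
  ultimately show ?thesis
    using that[of B] B(3) finite_imageD card_image by metis
qed

section \<open>Isoperimetry of orbits in periodic graphs\<close>

text \<open>
Distances are infima of natural numbers, and a vertex of \<open>\<Omega>\<close> has positive distance from the
complement; so distance at most one means an edge leaving \<open>\<Omega>\<close>.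
\<close>

lemma boundary1_iff:
  fixes \<Gamma> :: "('v, 'e) pre_digraph"
  assumes "wf_digraph \<Gamma>" and \<Omega>: "\<Omega> \<subseteq> verts \<Gamma>"
  shows "x \<in> boundary1 \<Gamma> \<Omega> \<longleftrightarrow> x \<in> \<Omega> \<and> (\<exists>e\<in>out_arcs \<Gamma> x. head \<Gamma> e \<notin> \<Omega>)"
proof -
  interpret wf_digraph \<Gamma> by fact
  have "gdist_set \<Gamma> x (verts \<Gamma> - \<Omega>) \<le> 1 \<longleftrightarrow> (\<exists>e\<in>out_arcs \<Gamma> x. head \<Gamma> e \<notin> \<Omega>)" if x: "x \<in> \<Omega>"
  proof
    assume "\<exists>e\<in>out_arcs \<Gamma> x. head \<Gamma> e \<notin> \<Omega>"
    then obtain e where e: "e \<in> out_arcs \<Gamma> x" "head \<Gamma> e \<notin> \<Omega>" by blast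
    then have "awalk x [e] (head \<Gamma> e)" using x \<Omega> by (auto simp: awalk_def out_arcs_def)
    then have "gdist \<Gamma> x (head \<Gamma> e) \<le> enat (length [e])"
      unfolding gdist_def by (intro INF_lower) simp
    moreover have "head \<Gamma> e \<in> verts \<Gamma> - \<Omega>" using e by (auto simp: out_arcs_def)
    ultimately show "gdist_set \<Gamma> x (verts \<Gamma> - \<Omega>) \<le> 1"
      unfolding gdist_set_def by (intro INF_lower2) (simp_all add: one_enat_def)
  next
    assume le: "gdist_set \<Gamma> x (verts \<Gamma> - \<Omega>) \<le> 1"
    show "\<exists>e\<in>out_arcs \<Gamma> x. head \<Gamma> e \<notin> \<Omega>"
    proof (rule ccontr)
      assume none: "\<not> (\<exists>e\<in>out_arcs \<Gamma> x. head \<Gamma> e \<notin> \<Omega>)"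
      have "2 \<le> length p" if p: "awalk x p y" and y: "y \<in> verts \<Gamma> - \<Omega>" for p y
      proof (cases p)
        case Nil
        then show ?thesis using p x y by (auto simp: awalk_def)
      next
        case (Cons e p')
        then have e: "e \<in> out_arcs \<Gamma> x" using p by (auto simp: awalk_def out_arcs_def)
        then have "p' \<noteq> []" using none p y Cons by (auto simp: awalk_def)
        then show ?thesis using Cons by (cases p') auto
      qed
      then have "enat 2 \<le> gdist_set \<Gamma> x (verts \<Gamma> - \<Omega>)"
        unfolding gdist_set_def gdist_def by (intro INF_greatest) auto
      from order_trans[OF this le] show False by (simp add: one_enat_def)
    qed
  qed
  then show ?thesis by (auto simp: boundary1_def)
qed

text \<open>
A finite set \<open>D\<close> meeting every orbit stands for the finiteness of the number of orbits.
\<close>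

locale periodic_graph = schroedinger_graph \<Gamma> arev mV mE q C Q
  for \<Gamma> :: "('v, 'e) pre_digraph" and arev mV mE q C Q +
  fixes G :: "('g, 'r) monoid_scheme" and aV :: "'g \<Rightarrow> 'v \<Rightarrow> 'v" and aE :: "'g \<Rightarrow> 'e \<Rightarrow> 'e" and D :: "'v set"
  assumes connected: "strongly_connected \<Gamma>"
    and action: "graph_action G \<Gamma> arev aV aE"
    and mV_inv: "invariant_under G (verts \<Gamma>) aV mV"
    and mE_action_inv: "invariant_under G (arcs \<Gamma>) aE mE"
    and q_inv: "invariant_under G (verts \<Gamma>) aV q"
    and D: "finite D" "D \<subseteq> verts \<Gamma>" "\<And>x. x \<in> verts \<Gamma> \<Longrightarrow> \<exists>d\<in>D. \<exists>g\<in>carrier G. x = aV g d"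
begin

sublocale aV: group_action G "verts \<Gamma>" aV using action by (simp add: graph_action_def)
sublocale aE: group_action G "arcs \<Gamma>" aE using action by (simp add: graph_action_def)

lemma act_arcs:
  assumes "g \<in> carrier G" "e \<in> arcs \<Gamma>"
  shows "aE g e \<in> arcs \<Gamma>" "tail \<Gamma> (aE g e) = aV g (tail \<Gamma> e)" "head \<Gamma> (aE g e) = aV g (head \<Gamma> e)"
    "mE (aE g e) = mE e"
  using assms action mE_action_inv aE.element_image[OF assms]
  by (simp_all add: graph_action_def invariant_under_def)

lemma act_verts:
  assumes "g \<in> carrier G" "x \<in> verts \<Gamma>"
  shows "aV g x \<in> verts \<Gamma>" "mV (aV g x) = mV x" "q (aV g x) = q x"
  using assms mV_inv q_inv aV.element_image[OF assms] by (simp_all add: invariant_under_def)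

lemma act_inverse:
  assumes "g \<in> carrier G"
  obtains h where "h \<in> carrier G" "\<And>x. x \<in> verts \<Gamma> \<Longrightarrow> aV h (aV g x) = x" "\<And>x. x \<in> verts \<Gamma> \<Longrightarrow> aV g (aV h x) = x"
    "\<And>e. e \<in> arcs \<Gamma> \<Longrightarrow> aE h (aE g e) = e" "\<And>e. e \<in> arcs \<Gamma> \<Longrightarrow> aE g (aE h e) = e"
proof -
  interpret group G using aV.group_hom group_hom.axioms(1) by blast
  show ?thesis
  proof (rule that[of "inv\<^bsub>G\<^esub> g"])
    show "inv\<^bsub>G\<^esub> g \<in> carrier G" using assms by simp
    show "aV (inv\<^bsub>G\<^esub> g) (aV g x) = x" if "x \<in> verts \<Gamma>" for x
      by (rule aV.orbit_sym_aux[OF assms that refl])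
    show "aE (inv\<^bsub>G\<^esub> g) (aE g e) = e" if "e \<in> arcs \<Gamma>" for e
      by (rule aE.orbit_sym_aux[OF assms that refl])
    show "aV g (aV (inv\<^bsub>G\<^esub> g) x) = x" if "x \<in> verts \<Gamma>" for x
      using aV.orbit_sym_aux[of "inv\<^bsub>G\<^esub> g" x] assms that by simp
    show "aE g (aE (inv\<^bsub>G\<^esub> g) e) = e" if "e \<in> arcs \<Gamma>" for e
      using aE.orbit_sym_aux[of "inv\<^bsub>G\<^esub> g" e] assms that by simp
  qed
qed

lemma bij_aV: "g \<in> carrier G \<Longrightarrow> bij_betw (aV g) (verts \<Gamma>) (verts \<Gamma>)"
  using aV.bij_prop0 by (simp add: Bij_def)

lemma bij_out_arcs:
  assumes g: "g \<in> carrier G" and x: "x \<in> verts \<Gamma>"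
  shows "bij_betw (aE g) (out_arcs \<Gamma> x) (out_arcs \<Gamma> (aV g x))"
proof -
  obtain h where h: "h \<in> carrier G" "\<And>x. x \<in> verts \<Gamma> \<Longrightarrow> aV h (aV g x) = x"
    "\<And>e. e \<in> arcs \<Gamma> \<Longrightarrow> aE h (aE g e) = e" "\<And>e. e \<in> arcs \<Gamma> \<Longrightarrow> aE g (aE h e) = e"
    using act_inverse[OF g] by metis
  show ?thesis
    by (rule bij_betwI[where g = "aE h"]) (use g x h in \<open>auto simp: out_arcs_def act_arcs\<close>)
qed

definition nb :: "'v \<Rightarrow> 'v set" where "nb x = head \<Gamma> ` out_arcs \<Gamma> x"

lemma nb_subset: "nb x \<subseteq> verts \<Gamma>" by (auto simp: nb_def out_arcs_def)

lemma nb_sym: "y \<in> nb x \<Longrightarrow> x \<in> nb y"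
proof -
  assume "y \<in> nb x"
  then obtain e where e: "e \<in> arcs \<Gamma>" "tail \<Gamma> e = x" "head \<Gamma> e = y" by (auto simp: nb_def out_arcs_def)
  then show "x \<in> nb y" unfolding nb_def by (intro image_eqI[of _ _ "arev e"]) (auto simp: out_arcs_def)
qed

lemma nb_act: "g \<in> carrier G \<Longrightarrow> x \<in> verts \<Gamma> \<Longrightarrow> nb (aV g x) = aV g ` nb x"
proof -
  assume *: "g \<in> carrier G" "x \<in> verts \<Gamma>"
  have "nb (aV g x) = head \<Gamma> ` aE g ` out_arcs \<Gamma> x"
    using bij_out_arcs[OF *] by (simp add: nb_def bij_betw_def)
  also have "\<dots> = aV g ` nb x"
    unfolding nb_def image_image by (intro image_cong) (use * in \<open>auto simp: act_arcs out_arcs_def\<close>)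
  finally show ?thesis .
qed

lemma boundary_iff: "\<Omega> \<subseteq> verts \<Gamma> \<Longrightarrow> x \<in> boundary1 \<Gamma> \<Omega> \<longleftrightarrow> x \<in> \<Omega> \<and> \<not> nb x \<subseteq> \<Omega>"
  using boundary1_iff[OF wf_digraph_axioms] by (auto simp: nb_def)

definition loc_fin :: "'v set" where "loc_fin = {x \<in> verts \<Gamma>. finite (nb x)}"

lemma loc_fin_act: "g \<in> carrier G \<Longrightarrow> x \<in> verts \<Gamma> \<Longrightarrow> aV g x \<in> loc_fin \<longleftrightarrow> x \<in> loc_fin"
  using inj_on_subset[OF aV.inj_prop nb_subset]
  by (auto simp: loc_fin_def act_verts nb_act finite_image_iff)

text \<open>
Up to the action there are only finitely many pairs of a locally finite vertex and a neighbour,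
so the weight of a suitable edge joining such a pair is bounded below.
\<close>

lemma weight_lower_bound:
  "\<exists>c>0. \<forall>x\<in>loc_fin. \<forall>y\<in>nb x. \<exists>e\<in>out_arcs \<Gamma> x. head \<Gamma> e = y \<and> c \<le> mE e"
proof -
  have "\<forall>x y. \<exists>e. y \<in> nb x \<longrightarrow> e \<in> out_arcs \<Gamma> x \<and> head \<Gamma> e = y" by (auto simp: nb_def)
  then obtain e0 where e0: "\<And>x y. y \<in> nb x \<Longrightarrow> e0 x y \<in> out_arcs \<Gamma> x \<and> head \<Gamma> (e0 x y) = y"
    by metis
  \<comment> \<open>one edge for each pair of a locally finite vertex of \<open>D\<close> and a neighbour\<close>
  define E0 where "E0 = (\<lambda>(x, y). e0 x y) ` (SIGMA x:D \<inter> loc_fin. nb x)"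
  have fin: "finite E0"
    unfolding E0_def by (intro finite_imageI finite_SigmaI) (auto simp: loc_fin_def D(1))
  have arcs: "E0 \<subseteq> arcs \<Gamma>" using e0 by (auto simp: E0_def out_arcs_def)
  \<comment> \<open>the element one keeps the minimum positive when there are no such pairs\<close>
  define c where "c = Min (insert 1 (mE ` E0))"
  have c: "0 < c" "\<And>e. e \<in> E0 \<Longrightarrow> c \<le> mE e"
    using fin arcs mE_pos by (auto simp: c_def)
  have "\<exists>e\<in>out_arcs \<Gamma> x. head \<Gamma> e = y \<and> c \<le> mE e" if x: "x \<in> loc_fin" and y: "y \<in> nb x" for x y
  proof -
    obtain d g where d: "d \<in> D" "g \<in> carrier G" "x = aV g d"
      using D(3)[of x] x by (auto simp: loc_fin_def)
    have dV: "d \<in> verts \<Gamma>" using d D(2) by blast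
    obtain z where z: "z \<in> nb d" "y = aV g z" using y nb_act[OF d(2) dV] d(3) by auto
    have "d \<in> loc_fin" using x loc_fin_act[OF d(2) dV] d(3) by simp
    then have "e0 d z \<in> E0" unfolding E0_def using d(1) z(1) by (intro image_eqI[of _ _ "(d, z)"]) auto
    moreover have "e0 d z \<in> out_arcs \<Gamma> d" "head \<Gamma> (e0 d z) = z" using e0[OF z(1)] by auto
    ultimately show ?thesis
      using c(2) d z by (intro bexI[of _ "aE g (e0 d z)"]) (auto simp: act_arcs out_arcs_def)
  qed
  then show ?thesis using c(1) by blast
qed

text \<open>
By symmetry of the weights, the lower bound \<open>c\<close> applies to an edge from \<open>v\<close> to each of its locally
finite neighbours. The total weight at \<open>v\<close> is at most \<open>C * m\<close> by the Sunada-Sy condition, so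
there are at most \<open>C * m / c\<close> such neighbours, even when \<open>v\<close> has infinitely many neighbours.
\<close>

lemma few_loc_fin_neighbours:
  "\<exists>N. \<forall>v\<in>verts \<Gamma>. finite (nb v \<inter> loc_fin) \<and> card (nb v \<inter> loc_fin) \<le> N"
proof -
  obtain c where c: "0 < c" "\<And>x y. x \<in> loc_fin \<Longrightarrow> y \<in> nb x \<Longrightarrow> \<exists>e\<in>out_arcs \<Gamma> x. head \<Gamma> e = y \<and> c \<le> mE e"
    using weight_lower_bound by blast
  define m where "m = Max (mV ` D)"
  have mV_le: "mV x \<le> m" if x: "x \<in> verts \<Gamma>" for x
  proof -
    obtain d g where d: "d \<in> D" "g \<in> carrier G" "x = aV g d" using D(3)[OF x] by blast
    then have "mV x = mV d" using D(2) by (auto simp: act_verts)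
    then show ?thesis using d D(1) by (simp add: m_def)
  qed
  define N where "N = nat \<lfloor>C * m / c\<rfloor>"
  have "finite (nb v \<inter> loc_fin) \<and> card (nb v \<inter> loc_fin) \<le> N" if v: "v \<in> verts \<Gamma>" for v
  proof (rule finite_if_finite_subsets_card_bdd)
    fix Y assume Y: "Y \<subseteq> nb v \<inter> loc_fin" "finite Y"
    have "\<forall>y\<in>Y. \<exists>e. e \<in> out_arcs \<Gamma> v \<and> head \<Gamma> e = y \<and> c \<le> mE e"
    proof
      fix y assume "y \<in> Y"
      then obtain e where "e \<in> out_arcs \<Gamma> y" "head \<Gamma> e = v" "c \<le> mE e"
        using c(2)[of y v] Y nb_sym by blast
      then show "\<exists>e. e \<in> out_arcs \<Gamma> v \<and> head \<Gamma> e = y \<and> c \<le> mE e"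
        by (intro exI[of _ "arev e"]) (auto simp: out_arcs_def mE_inv)
    qed
    then obtain f where f: "\<And>y. y \<in> Y \<Longrightarrow> f y \<in> out_arcs \<Gamma> v \<and> head \<Gamma> (f y) = y \<and> c \<le> mE (f y)"
      by metis
    have inj: "inj_on f Y" by (metis f inj_onI)
    have "c * real (card Y) = (\<Sum>y\<in>Y. c)" by simp
    also have "\<dots> \<le> (\<Sum>y\<in>Y. mE (f y))" by (intro sum_mono) (simp add: f)
    also have "\<dots> = sum mE (f ` Y)" by (simp add: sum.reindex[OF inj])
    also have "\<dots> \<le> (\<Sum>\<^sub>\<infinity>e\<in>out_arcs \<Gamma> v. mE e)"
      by (rule finite_sum_le_infsum[OF summable_mE[OF v]])
        (use Y f in \<open>auto simp: out_arcs_def mE_pos less_imp_le\<close>)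
    also have "\<dots> \<le> C * m"
      using degree_le[OF v] mult_left_mono[OF mV_le[OF v] C_nonneg] by linarith
    finally have "real (card Y) \<le> C * m / c" using c(1) by (simp add: field_simps)
    then show "card Y \<le> N" unfolding N_def by linarith
  qed
  then show ?thesis by blast
qed

text \<open>
The vertices at distance at most \<open>k\<close> from \<open>S\<close>.
\<close>

primrec near :: "'v set \<Rightarrow> nat \<Rightarrow> 'v set" where
  "near S 0 = S"
| "near S (Suc k) = near S k \<union> {x \<in> verts \<Gamma>. nb x \<inter> near S k \<noteq> {}}"

lemma near_mono: "j \<le> k \<Longrightarrow> near S j \<subseteq> near S k"
  by (induction rule: dec_induct) auto

lemma near_act:
  assumes S: "S \<subseteq> verts \<Gamma>" "\<And>g x. g \<in> carrier G \<Longrightarrow> x \<in> S \<Longrightarrow> aV g x \<in> S" and g: "g \<in> carrier G"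
  shows "x \<in> near S k \<Longrightarrow> aV g x \<in> near S k"
proof (induction k arbitrary: x)
  case 0
  then show ?case using S(2) g by simp
next
  case (Suc k)
  show ?case
  proof (cases "x \<in> near S k")
    case False
    with Suc.prems obtain y where "x \<in> verts \<Gamma>" "y \<in> nb x" "y \<in> near S k" by auto
    then show ?thesis using Suc.IH[of y] g by (auto simp: nb_act act_verts)
  qed (use Suc.IH in simp)
qed

text \<open>
Every vertex is at finite distance from \<open>S\<close> by connectedness, and this distance is invariant, so
it takes only finitely many values.
\<close>

lemma near_exhausts:
  assumes S: "S \<subseteq> verts \<Gamma>" "S \<noteq> {}" "\<And>g x. g \<in> carrier G \<Longrightarrow> x \<in> S \<Longrightarrow> aV g x \<in> S"
  shows "\<exists>R. verts \<Gamma> \<subseteq> near S R"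
proof -
  obtain s where s: "s \<in> S" using S(2) by blast
  have "\<exists>k. x \<in> near S k" if "x \<in> verts \<Gamma>" for x
  proof -
    have "x \<rightarrow>\<^sup>*\<^bsub>\<Gamma>\<^esub> s" using connected that s S(1) by (auto simp: strongly_connected_def)
    then show ?thesis
    proof (induction rule: converse_reachable_induct)
      case base
      then show ?case using s by (intro exI[of _ 0]) simp
    next
      case (step x y)
      then obtain k where "y \<in> near S k" by blast
      moreover have "x \<in> verts \<Gamma>" "y \<in> nb x"
        using step.hyps(1) by (auto simp: nb_def arcs_ends_def arc_to_ends_def out_arcs_def)
      ultimately show ?case by (intro exI[of _ "Suc k"]) auto
    qed
  qed
  then obtain r where r: "\<And>x. x \<in> verts \<Gamma> \<Longrightarrow> x \<in> near S (r x)" by metis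
  define R where "R = Max (r ` D)"
  have "x \<in> near S R" if x: "x \<in> verts \<Gamma>" for x
  proof -
    obtain d g where d: "d \<in> D" "g \<in> carrier G" "x = aV g d" using D(3)[OF x] by blast
    have "d \<in> near S (r d)" using d D(2) r by blast
    moreover have "r d \<le> R" using d D(1) by (simp add: R_def)
    ultimately have "d \<in> near S R" using near_mono by blast
    then show ?thesis using near_act[OF S(1,3) d(2)] d(3) by simp
  qed
  then show ?thesis by blast
qed

text \<open>
Follow a shortest path of length at most \<open>R\<close> from a vertex of \<open>\<Omega>\<close> to \<open>S\<close>: it reaches a vertex of
\<open>\<Omega> \<inter> S\<close> or passes through the boundary of \<open>\<Omega>\<close> before leaving \<open>\<Omega>\<close>. Read backwards, the vertex is
obtained from \<open>\<Omega> \<inter> S\<close> or the boundary in at most \<open>R\<close> steps to vertices outside \<open>S\<close>, which are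
locally finite; each step multiplies the number of vertices by at most \<open>1 + N\<close>.
\<close>

lemma card_le_near_boundary:
  assumes S: "S \<subseteq> verts \<Gamma>" "S \<noteq> {}" "\<And>g x. g \<in> carrier G \<Longrightarrow> x \<in> S \<Longrightarrow> aV g x \<in> S"
    and lf: "verts \<Gamma> - S \<subseteq> loc_fin"
  shows "\<exists>K. \<forall>\<Omega>. \<Omega> \<subseteq> verts \<Gamma> \<and> finite \<Omega> \<longrightarrow> card \<Omega> \<le> K * (card (\<Omega> \<inter> S) + card (boundary1 \<Gamma> \<Omega>))"
proof -
  obtain N where N: "\<And>v. v \<in> verts \<Gamma> \<Longrightarrow> finite (nb v \<inter> loc_fin) \<and> card (nb v \<inter> loc_fin) \<le> N"
    using few_loc_fin_neighbours by blast
  obtain R where R: "verts \<Gamma> \<subseteq> near S R" using near_exhausts[OF S] by blast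
  have "card \<Omega> \<le> Suc N ^ R * (card (\<Omega> \<inter> S) + card (boundary1 \<Gamma> \<Omega>))"
    if \<Omega>: "\<Omega> \<subseteq> verts \<Gamma>" "finite \<Omega>" for \<Omega>
  proof -
    \<comment> \<open>\<open>Y k\<close> collects what \<open>k\<close> steps to locally finite neighbours reach from \<open>\<Omega> \<inter> S\<close> and the boundary\<close>
    define Y where "Y = rec_nat (\<Omega> \<inter> S \<union> boundary1 \<Gamma> \<Omega>) (\<lambda>_ Z. Z \<union> (\<Union>y\<in>Z. nb y \<inter> loc_fin))"
    have Y0: "Y 0 = \<Omega> \<inter> S \<union> boundary1 \<Gamma> \<Omega>" and
      YS: "Y (Suc k) = Y k \<union> (\<Union>y\<in>Y k. nb y \<inter> loc_fin)" for k
      by (simp_all add: Y_def)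
    have bd: "boundary1 \<Gamma> \<Omega> \<subseteq> \<Omega>" by (auto simp: boundary1_def)
    have Y: "Y k \<subseteq> verts \<Gamma> \<and> finite (Y k) \<and> card (Y k) \<le> Suc N ^ k * (card (\<Omega> \<inter> S) + card (boundary1 \<Gamma> \<Omega>))" for k
    proof (induction k)
      case 0
      then show ?case
        using \<Omega> bd by (auto simp: Y0 card_Un_le intro: finite_subset)
    next
      case (Suc k)
      then have fin: "finite (Y k)" and sub: "Y k \<subseteq> verts \<Gamma>" by auto
      have "card (\<Union>y\<in>Y k. nb y \<inter> loc_fin) \<le> (\<Sum>y\<in>Y k. card (nb y \<inter> loc_fin))"
        by (rule card_UN_le[OF fin])
      also have "\<dots> \<le> (\<Sum>y\<in>Y k. N)" using N sub by (intro sum_mono) blast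
      finally have "card (Y (Suc k)) \<le> card (Y k) + card (Y k) * N"
        unfolding YS using card_Un_le[of "Y k" "\<Union>y\<in>Y k. nb y \<inter> loc_fin"] by simp
      also have "\<dots> = Suc N * card (Y k)" by simp
      also have "\<dots> \<le> Suc N * (Suc N ^ k * (card (\<Omega> \<inter> S) + card (boundary1 \<Gamma> \<Omega>)))"
        using Suc by (intro mult_left_mono) auto
      finally have "card (Y (Suc k)) \<le> Suc N ^ Suc k * (card (\<Omega> \<inter> S) + card (boundary1 \<Gamma> \<Omega>))"
        by (simp add: algebra_simps)
      moreover have "finite (Y (Suc k))" unfolding YS using fin N sub by blast
      moreover have "Y (Suc k) \<subseteq> verts \<Gamma>" unfolding YS using sub nb_subset by blast
      ultimately show ?case by blast
    qed
    have "x \<in> \<Omega> \<Longrightarrow> x \<in> near S k \<Longrightarrow> x \<in> Y k" for x k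
    proof (induction k arbitrary: x)
      case 0
      then show ?case by (simp add: Y0)
    next
      case (Suc k)
      have Y0_sub: "Y 0 \<subseteq> Y j" for j by (induction j) (auto simp: YS)
      consider "x \<in> near S k" | "x \<in> S" | "x \<in> boundary1 \<Gamma> \<Omega>"
        | y where "x \<notin> S" "y \<in> nb x" "y \<in> near S k" "y \<in> \<Omega>"
        using Suc.prems boundary_iff[OF \<Omega>(1)] by auto
      then show ?case
      proof cases
        case 1
        then show ?thesis using Suc by (simp add: YS)
      next
        case 2
        then show ?thesis using Y0_sub[of "Suc k"] Suc.prems by (auto simp: Y0)
      next
        case 3
        then show ?thesis using Y0_sub[of "Suc k"] by (auto simp: Y0)
      next
        case 4
        then have "y \<in> Y k" using Suc.IH by blast
        moreover have "x \<in> nb y \<inter> loc_fin" using 4 nb_sym lf \<Omega>(1) Suc.prems by blast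
        ultimately show ?thesis by (auto simp: YS)
      qed
    qed
    then have "\<Omega> \<subseteq> Y R" using R \<Omega>(1) by blast
    then have "card \<Omega> \<le> card (Y R)" using Y by (intro card_mono) auto
    also have "\<dots> \<le> Suc N ^ R * (card (\<Omega> \<inter> S) + card (boundary1 \<Gamma> \<Omega>))" using Y by blast
    finally show ?thesis .
  qed
  then show ?thesis by blast
qed

text \<open>
The graph may have vertices with infinitely many neighbours. They are added to the orbit in the
preceding estimate, at the cost of one more boundary term: a finite set cannot contain all
neighbours of such a vertex, which therefore lies in the boundary of every finite set
containing it.
\<close>

lemma card_le_orbit_boundary:
  assumes x0: "x0 \<in> verts \<Gamma>"
  shows "\<exists>K. \<forall>\<Omega>. \<Omega> \<subseteq> verts \<Gamma> \<and> finite \<Omega> \<longrightarrow>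
    card \<Omega> \<le> K * (card (\<Omega> \<inter> orbit G aV x0) + 2 * card (boundary1 \<Gamma> \<Omega>))"
proof -
  let ?O = "orbit G aV x0"
  \<comment> \<open>outside \<open>S\<close> every vertex is locally finite\<close>
  define S where "S = ?O \<union> (verts \<Gamma> - loc_fin)"
  have O: "?O \<subseteq> verts \<Gamma>" "x0 \<in> ?O"
    using act_verts(1)[OF _ x0] aV.orbit_refl[OF x0] by (auto simp: orbit_def)
  have inv: "aV g x \<in> S" if g: "g \<in> carrier G" and x: "x \<in> S" for g x
  proof (cases "x \<in> ?O")
    case True
    then obtain h where h: "h \<in> carrier G" "x = aV h x0" by (auto simp: orbit_def)
    interpret group G using aV.group_hom group_hom.axioms(1) by blast
    have "aV g x = aV (g \<otimes>\<^bsub>G\<^esub> h) x0" using aV.composition_rule[OF x0 g h(1)] h by simp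
    then show ?thesis using g h by (auto simp: S_def orbit_def)
  next
    case False
    then show ?thesis using x g loc_fin_act act_verts by (auto simp: S_def)
  qed
  have S: "S \<subseteq> verts \<Gamma>" "S \<noteq> {}" "verts \<Gamma> - S \<subseteq> loc_fin"
    using O by (auto simp: S_def)
  obtain K where K: "\<And>\<Omega>. \<Omega> \<subseteq> verts \<Gamma> \<Longrightarrow> finite \<Omega> \<Longrightarrow> card \<Omega> \<le> K * (card (\<Omega> \<inter> S) + card (boundary1 \<Gamma> \<Omega>))"
    using card_le_near_boundary[OF S(1,2) inv S(3)] by blast
  have "card \<Omega> \<le> K * (card (\<Omega> \<inter> ?O) + 2 * card (boundary1 \<Gamma> \<Omega>))" if \<Omega>: "\<Omega> \<subseteq> verts \<Gamma>" "finite \<Omega>" for \<Omega>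
  proof -
    have "\<Omega> \<inter> S \<subseteq> (\<Omega> \<inter> ?O) \<union> boundary1 \<Gamma> \<Omega>"
    proof
      fix x assume x: "x \<in> \<Omega> \<inter> S"
      show "x \<in> (\<Omega> \<inter> ?O) \<union> boundary1 \<Gamma> \<Omega>"
      proof (cases "x \<in> ?O")
        case False
        then have "infinite (nb x)" using x \<Omega> by (auto simp: S_def loc_fin_def)
        then have "\<not> nb x \<subseteq> \<Omega>" using \<Omega>(2) finite_subset by blast
        then show ?thesis using x boundary_iff[OF \<Omega>(1)] by blast
      qed (use x in blast)
    qed
    moreover have "finite (boundary1 \<Gamma> \<Omega>)" using \<Omega>(2) by (rule finite_subset[rotated]) (auto simp: boundary1_def)
    ultimately have "card (\<Omega> \<inter> S) \<le> card (\<Omega> \<inter> ?O) + card (boundary1 \<Gamma> \<Omega>)"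
      using card_mono[of "(\<Omega> \<inter> ?O) \<union> boundary1 \<Gamma> \<Omega>" "\<Omega> \<inter> S"] card_Un_le[of "\<Omega> \<inter> ?O" "boundary1 \<Gamma> \<Omega>"] \<Omega>(2)
      by auto
    then have "K * (card (\<Omega> \<inter> S) + card (boundary1 \<Gamma> \<Omega>))
        \<le> K * (card (\<Omega> \<inter> ?O) + 2 * card (boundary1 \<Gamma> \<Omega>))"
      by (intro mult_le_mono2) simp
    then show ?thesis using K[OF \<Omega>] by linarith
  qed
  then show ?thesis by blast
qed

end

section \<open>Continuity of the integrated density of states\<close>

context selfadjoint_l2
begin

text \<open>
The integrated density of states is an average of distribution functions. Its jump is the average
of the masses of the atoms, which are nonnegative.
\<close>

lemma isCont_integrated_density_of_states_iff:
  assumes D: "finite D" "D \<noteq> {}" "D \<subseteq> V"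
  shows "isCont (integrated_density_of_states V m D T) l \<longleftrightarrow>
    (\<forall>x\<in>D. measure (spectral_measure V m T (indicator {x})) {l} = 0)"
proof -
  define \<mu> where "\<mu> x = spectral_measure V m T (indicator {x})" for x
  have \<mu>: "finite_borel_measure (\<mu> x)" if "x \<in> D" for x
    unfolding \<mu>_def using that D(3) by (intro finite_borel_spectral_measure indicator_in_l2) auto
  define F where "F t = (\<Sum>x\<in>D. cdf (\<mu> x) t)" for t
  have eq: "integrated_density_of_states V m D T = (\<lambda>t. complex_of_real (F t / real (card D)))"
  proof
    fix t
    have "l2_inner V m (spectral_projection V m T {..t} (indicator {x})) (indicator {x}) = complex_of_real (cdf (\<mu> x) t)"
      if "x \<in> D" for x
    proof (rule spectral_projection_limit[OF poly_approx_atMost, of t])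
      assume "\<And>\<phi>. \<phi> \<in> l2 V m \<Longrightarrow> l2_inner V m (spectral_projection V m T {..t} \<phi>) \<phi> =
          complex_of_real (measure (spectral_measure V m T \<phi>) {..t})"
      then show ?thesis unfolding \<mu>_def cdf_def using that D(3) indicator_in_l2 by blast
    qed simp
    then show "integrated_density_of_states V m D T t = complex_of_real (F t / real (card D))"
      by (simp add: integrated_density_of_states_def vn_trace_def F_def)
  qed
  have F_iff: "isCont F l \<longleftrightarrow> (\<forall>x\<in>D. measure (\<mu> x) {l} = 0)"
  proof
    assume "isCont F l"
    then have "(F \<longlongrightarrow> F l) (at_left l)"
      by (simp add: isCont_def filterlim_at_split)
    moreover have "(F \<longlongrightarrow> (\<Sum>x\<in>D. measure (\<mu> x) {..<l})) (at_left l)"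
      unfolding F_def by (intro tendsto_sum finite_borel_measure.cdf_at_left \<mu>)
    ultimately have "F l = (\<Sum>x\<in>D. measure (\<mu> x) {..<l})"
      by (intro tendsto_unique) auto
    moreover have "cdf (\<mu> x) l = measure (\<mu> x) {..<l} + measure (\<mu> x) {l}" if "x \<in> D" for x
    proof -
      interpret finite_borel_measure "\<mu> x" by (rule \<mu>[OF that])
      show ?thesis
        unfolding cdf_def ivl_disj_un(2)[symmetric] by (subst finite_measure_Union) auto
    qed
    ultimately have "(\<Sum>x\<in>D. measure (\<mu> x) {l}) = 0"
      by (simp add: F_def sum.distrib)
    then show "\<forall>x\<in>D. measure (\<mu> x) {l} = 0"
      using D(1) by (simp add: sum_nonneg_eq_0_iff)
  next
    assume "\<forall>x\<in>D. measure (\<mu> x) {l} = 0"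
    then have "isCont (cdf (\<mu> x)) l" if "x \<in> D" for x
      using finite_borel_measure.isCont_cdf[OF \<mu>[OF that]] that by blast
    then show "isCont F l"
      unfolding F_def by (auto simp: isCont_def intro!: tendsto_sum)
  qed
  have "isCont (integrated_density_of_states V m D T) l \<longleftrightarrow> isCont F l"
  proof
    assume *: "isCont (integrated_density_of_states V m D T) l"
    have "F = (\<lambda>t. real (card D) * Re (integrated_density_of_states V m D T t))"
      using D by (simp add: eq fun_eq_iff)
    then show "isCont F l" using * by (simp add: continuous_intros)
  next
    assume "isCont F l"
    then show "isCont (integrated_density_of_states V m D T) l"
      unfolding eq using D by (intro continuous_intros) auto
  qed
  then show ?thesis using F_iff by (simp add: \<mu>_def)
qed

end

section \<open>Eigenfunctions and uniqueness on finite sets\<close>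

context periodic_graph
begin

definition translate :: "'g \<Rightarrow> ('v \<Rightarrow> complex) \<Rightarrow> 'v \<Rightarrow> complex" where
  "translate g \<phi> x = (if x \<in> verts \<Gamma> then \<phi> (aV g x) else 0)"

lemma translate_l2:
  assumes g: "g \<in> carrier G" and \<phi>: "\<phi> \<in> L2"
  shows "translate g \<phi> \<in> L2" "l2_norm (verts \<Gamma>) mV (translate g \<phi>) = l2_norm (verts \<Gamma>) mV \<phi>"
proof -
  let ?F = "\<lambda>x. (cmod (\<phi> x))\<^sup>2 * mV x"
  have eq: "(cmod (translate g \<phi> x))\<^sup>2 * mV x = ?F (aV g x)" if "x \<in> verts \<Gamma>" for x
    using that g by (simp add: translate_def act_verts)
  show "translate g \<phi> \<in> L2"
  proof -
    have "(\<lambda>x. ?F (aV g x)) summable_on verts \<Gamma>"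
      using \<phi> unfolding summable_on_reindex_bij_betw[OF bij_aV[OF g], of ?F] by (simp add: l2_def)
    then have "(\<lambda>x. (cmod (translate g \<phi> x))\<^sup>2 * mV x) summable_on verts \<Gamma>"
      by (simp only: eq cong: summable_on_cong)
    then show ?thesis by (simp add: l2_def) (simp add: translate_def)
  qed
  show "l2_norm (verts \<Gamma>) mV (translate g \<phi>) = l2_norm (verts \<Gamma>) mV \<phi>"
    unfolding l2_norm_def using infsum_reindex_bij_betw[OF bij_aV[OF g], of ?F]
    by (simp only: eq cong: infsum_cong)
qed

lemma H_translate:
  assumes g: "g \<in> carrier G" and \<phi>: "\<phi> \<in> L2" and x: "x \<in> verts \<Gamma>"
  shows "H (translate g \<phi>) x = H \<phi> (aV g x)"
proof -
  have reindex: "(\<Sum>\<^sub>\<infinity>e\<in>out_arcs \<Gamma> (aV g x). F e) = (\<Sum>\<^sub>\<infinity>e\<in>out_arcs \<Gamma> x. F (aE g e))" for F :: "'e \<Rightarrow> 'b::banach"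
    by (rule infsum_reindex_bij_betw[OF bij_out_arcs[OF g x], symmetric])
  have "(\<Sum>\<^sub>\<infinity>e\<in>out_arcs \<Gamma> (aV g x). mE e) = (\<Sum>\<^sub>\<infinity>e\<in>out_arcs \<Gamma> x. mE e)"
    unfolding reindex by (intro infsum_cong) (auto simp: out_arcs_def act_arcs g)
  then have "diagonal (aV g x) = diagonal x" using g x by (simp add: diagonal_def act_verts)
  moreover have "(\<Sum>\<^sub>\<infinity>e\<in>out_arcs \<Gamma> (aV g x). \<phi> (head \<Gamma> e) * complex_of_real (mE e)) =
      (\<Sum>\<^sub>\<infinity>e\<in>out_arcs \<Gamma> x. translate g \<phi> (head \<Gamma> e) * complex_of_real (mE e))"
    unfolding reindex by (intro infsum_cong) (auto simp: out_arcs_def act_arcs g translate_def)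
  then have "adjacency \<phi> (aV g x) = adjacency (translate g \<phi>) x"
    using g x by (simp add: adjacency_def act_verts)
  ultimately show ?thesis
    using \<phi> translate_l2[OF g \<phi>] x by (simp add: H_eq translate_def)
qed

lemma eigen_translate:
  assumes g: "g \<in> carrier G" and \<phi>: "\<phi> \<in> L2" "H \<phi> = (\<lambda>x. complex_of_real l * \<phi> x)"
  shows "H (translate g \<phi>) = (\<lambda>x. complex_of_real l * translate g \<phi> x)"
proof
  fix x
  show "H (translate g \<phi>) x = complex_of_real l * translate g \<phi> x"
  proof (cases "x \<in> verts \<Gamma>")
    case True
    then show ?thesis using H_translate[OF g \<phi>(1)] \<phi>(2) by (simp add: translate_def)
  next
    case False
    then show ?thesis
      using H_l2(1)[OF translate_l2(1)[OF g \<phi>(1)]] by (simp add: l2_def translate_def)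
  qed
qed

text \<open>
Translates of eigenfunctions are eigenfunctions, so a point of the support can be moved into \<open>D\<close>.
\<close>

lemma eigenfunction_meets_domain:
  "(\<exists>\<phi>. eigenfunction (verts \<Gamma>) mV H l \<phi>) \<longleftrightarrow> (\<exists>d\<in>D. \<exists>\<phi>. eigenfunction (verts \<Gamma>) mV H l \<phi> \<and> \<phi> d \<noteq> 0)"
proof
  assume "\<exists>\<phi>. eigenfunction (verts \<Gamma>) mV H l \<phi>"
  then obtain \<phi> y where \<phi>: "\<phi> \<in> L2" "H \<phi> = (\<lambda>x. complex_of_real l * \<phi> x)" and y: "\<phi> y \<noteq> 0"
    by (auto simp: eigenfunction_def fun_eq_iff)
  have "y \<in> verts \<Gamma>" using y \<phi>(1) by (auto simp: l2_def)
  then obtain d g where d: "d \<in> D" "g \<in> carrier G" "y = aV g d" using D(3) by blast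
  then have "translate g \<phi> d \<noteq> 0" using y D(2) by (auto simp: translate_def)
  moreover from this have "eigenfunction (verts \<Gamma>) mV H l (translate g \<phi>)"
    using translate_l2(1)[OF d(2) \<phi>(1)] eigen_translate[OF d(2) \<phi>] by (auto simp: eigenfunction_def)
  ultimately show "\<exists>d\<in>D. \<exists>\<phi>. eigenfunction (verts \<Gamma>) mV H l \<phi> \<and> \<phi> d \<noteq> 0" using d(1) by blast
qed blast

text \<open>
Truncating a solution to \<open>\<Omega>\<close> affects the equation only at boundary vertices of \<open>\<Omega>\<close> and at their
neighbours outside \<open>\<Omega>\<close>. The first are covered by the assumption \<open>H \<psi> x = 0\<close>; at the second,
\<open>\<psi>\<close> vanishes together with its values at all neighbours.
\<close>

lemma cut_off_eigen:
  assumes \<Omega>: "\<Omega> \<subseteq> verts \<Gamma>" and \<phi>: "\<phi> \<in> L2" "H \<phi> = (\<lambda>x. complex_of_real l * \<phi> x)"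
    and \<psi>: "\<psi> \<in> L2" "\<And>x. \<psi> x = (if x \<in> \<Omega> then \<phi> x else 0)"
    and bd: "\<And>x. x \<in> boundary1 \<Gamma> \<Omega> \<Longrightarrow> \<psi> x = 0 \<and> H \<psi> x = 0"
  shows "H \<psi> = (\<lambda>x. complex_of_real l * \<psi> x)"
proof
  fix x
  consider "x \<notin> verts \<Gamma>" | "x \<in> boundary1 \<Gamma> \<Omega>" | "x \<in> \<Omega>" "nb x \<subseteq> \<Omega>" | "x \<in> verts \<Gamma>" "x \<notin> \<Omega>"
    using boundary_iff[OF \<Omega>] by blast
  then show "H \<psi> x = complex_of_real l * \<psi> x"
  proof cases
    case 1
    then show ?thesis using H_l2(1)[OF \<psi>(1)] \<psi>(1) by (simp add: l2_def)
  next
    case 2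
    then show ?thesis using bd by simp
  next
    case 3
    have "adjacency \<psi> x = adjacency \<phi> x"
    proof -
      have "\<psi> (head \<Gamma> e) = \<phi> (head \<Gamma> e)" if "e \<in> out_arcs \<Gamma> x" for e
      proof -
        have "head \<Gamma> e \<in> nb x" using that by (simp add: nb_def)
        then show ?thesis using 3 by (auto simp: \<psi>(2))
      qed
      then have "(\<Sum>\<^sub>\<infinity>e\<in>out_arcs \<Gamma> x. \<psi> (head \<Gamma> e) * complex_of_real (mE e)) =
          (\<Sum>\<^sub>\<infinity>e\<in>out_arcs \<Gamma> x. \<phi> (head \<Gamma> e) * complex_of_real (mE e))"
        by (intro infsum_cong) (simp only:)
      then show ?thesis by (simp add: adjacency_def)
    qed
    then have "H \<psi> x = H \<phi> x" using 3(1) by (simp add: H_eq \<psi> \<phi>(1))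
    then show ?thesis using 3(1) by (simp add: \<phi>(2) \<psi>(2))
  next
    case 4
    have "\<psi> (head \<Gamma> e) = 0" if e: "e \<in> out_arcs \<Gamma> x" for e
    proof (cases "head \<Gamma> e \<in> \<Omega>")
      case True
      have "x \<in> nb (head \<Gamma> e)" by (rule nb_sym) (use e in \<open>simp add: nb_def\<close>)
      then have "\<not> nb (head \<Gamma> e) \<subseteq> \<Omega>" using 4(2) by blast
      then have "head \<Gamma> e \<in> boundary1 \<Gamma> \<Omega>" using True boundary_iff[OF \<Omega>] by simp
      then show ?thesis using bd by simp
    qed (simp add: \<psi>(2))
    then have "(\<Sum>\<^sub>\<infinity>e\<in>out_arcs \<Gamma> x. \<psi> (head \<Gamma> e) * complex_of_real (mE e)) = 0"
      by (intro infsum_0) simp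
    then have "adjacency \<psi> x = 0" by (simp add: adjacency_def)
    then show ?thesis using 4 by (simp add: H_eq \<psi>(1)) (simp add: \<psi>(2))
  qed
qed

text \<open>
By uniqueness on \<open>\<Omega>\<close> and \<open>cut_off_eigen\<close>, the restriction \<open>w\<close> of an eigenfunction to \<open>\<Omega>\<close> is
determined by the values of \<open>w\<close> and \<open>H w\<close> on the boundary, that is by two complex or four real
numbers for each boundary vertex. Asking for the values of \<open>H w\<close> instead of values of \<open>w\<close> on a
thicker boundary keeps the count proportional to the number of boundary vertices, whatever their
degrees.
\<close>

lemma restricted_eigenspace_dim:
  assumes \<Omega>: "\<Omega> \<subseteq> verts \<Gamma>" "finite \<Omega>" and uniq: "uniqueness_on (verts \<Gamma>) mV H l \<Omega>"
  obtains B where "finite B" "card B \<le> 4 * card (boundary1 \<Gamma> \<Omega>)"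
    "\<And>\<phi>. \<phi> \<in> L2 \<Longrightarrow> H \<phi> = (\<lambda>x. complex_of_real l * \<phi> x) \<Longrightarrow> restrict_ell2 \<Omega> (to_ell2 \<phi>) \<in> span B"
proof -
  let ?bd = "boundary1 \<Gamma> \<Omega>"
  have bd: "finite ?bd" "?bd \<subseteq> \<Omega>" using \<Omega>(2) by (auto simp: boundary1_def)
  define K where "K = {f. restrict_ell2 (verts \<Gamma>) f = f \<and> op f = l *\<^sub>R f}"
  define W where "W = restrict_ell2 \<Omega> ` K"
  \<comment> \<open>the boundary data that determine \<open>w\<close>\<close>
  define L where "L w = (restrict_ell2 ?bd w, restrict_ell2 ?bd (op w))" for w
  define X where "X = unit_ell2 1 ` ?bd \<union> unit_ell2 \<i> ` ?bd"
  define U where "U = (\<lambda>u. (u, 0)) ` X \<union> (\<lambda>u. (0, u)) ` X"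
  have lin_r: "linear (restrict_ell2 A)" for A :: "'v set"
    using bounded_linear_restrict by (rule bounded_linear.linear)
  have "subspace K"
    unfolding K_def by (rule subspaceI)
      (auto simp: linear_0[OF lin_r] linear_add[OF lin_r] linear_scale[OF lin_r] op.zero op.add op.scale algebra_simps)
  then have W: "subspace W" unfolding W_def by (rule linear_subspace_image[OF lin_r])
  have L: "linear L"
    unfolding L_def by (rule linearI)
      (simp_all add: linear_add[OF lin_r] linear_scale[OF lin_r] op.add op.scale)
  have inj: "w = 0" if w: "w \<in> W" and Lw: "L w = 0" for w
  proof -
    obtain f where f: "w = restrict_ell2 \<Omega> f" "restrict_ell2 (verts \<Gamma>) f = f" "op f = l *\<^sub>R f"
      using w by (auto simp: W_def K_def)
    define \<phi> \<psi> where "\<phi> = of_ell2 f" and "\<psi> = of_ell2 w"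
    have \<phi>: "\<phi> \<in> L2" and \<psi>: "\<psi> \<in> L2" by (simp_all add: \<phi>_def \<psi>_def of_ell2_in_l2)
    have "H \<phi> = of_ell2 (l *\<^sub>R f)" by (simp only: \<phi>_def of_ell2_op[symmetric] f(3))
    then have H\<phi>: "H \<phi> = (\<lambda>x. complex_of_real l * \<phi> x)"
      by (auto simp: \<phi>_def of_ell2_def fun_eq_iff scaleR_conv_of_real)
    have \<psi>_eq: "\<psi> x = (if x \<in> \<Omega> then \<phi> x else 0)" for x
      using \<Omega>(1) by (simp add: \<psi>_def \<phi>_def f(1) of_ell2_def)
    have r0: "restrict_ell2 ?bd w = 0" "restrict_ell2 ?bd (op w) = 0" using Lw by (simp_all add: L_def zero_prod_def)
    have "\<psi> x = 0 \<and> H \<psi> x = 0" if x: "x \<in> ?bd" for x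
    proof -
      have "coord (restrict_ell2 ?bd w) x = 0" "coord (restrict_ell2 ?bd (op w)) x = 0"
        by (simp_all only: r0 coord_simps)
      then have "coord w x = 0" "coord (op w) x = 0" using x by simp_all
      then show ?thesis by (simp add: \<psi>_def of_ell2_op[symmetric] of_ell2_def)
    qed
    then have "H \<psi> = (\<lambda>x. complex_of_real l * \<psi> x)"
      by (rule cut_off_eigen[OF \<Omega>(1) \<phi> H\<phi> \<psi> \<psi>_eq])
    moreover have "\<forall>x\<in>verts \<Gamma> - \<Omega>. \<psi> x = 0" by (simp add: \<psi>_eq)
    ultimately have "\<forall>x\<in>verts \<Gamma>. \<psi> x = 0"
      using uniq \<psi> unfolding uniqueness_on_def by blast
    then have "\<psi> = (\<lambda>x. 0)" using \<psi> by (auto simp: l2_def)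
    then have "to_ell2 \<psi> = 0" using \<psi> by (intro ell2_eqI) (simp add: coord_to_ell2)
    moreover have "to_ell2 \<psi> = w"
      using \<Omega>(1) by (intro ell2_eqI) (auto simp: \<psi>_def to_of_ell2 f(1))
    ultimately show "w = 0" by simp
  qed
  have finX: "finite X" and cardX: "card X \<le> 2 * card ?bd"
    using bd(1) card_Un_le[of "unit_ell2 1 ` ?bd" "unit_ell2 \<i> ` ?bd"]
      card_image_le[OF bd(1), of "unit_ell2 1"] card_image_le[OF bd(1), of "unit_ell2 \<i>"]
    by (auto simp: X_def)
  have finU: "finite U" using finX by (simp add: U_def)
  have cardU: "card U \<le> 4 * card ?bd"
    unfolding U_def using cardX card_Un_le[of "(\<lambda>u. (u, 0 :: 'v ell2)) ` X" "(\<lambda>u. (0 :: 'v ell2, u)) ` X"]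
      card_image_le[OF finX, of "\<lambda>u. (u, 0 :: 'v ell2)"] card_image_le[OF finX, of "\<lambda>u. (0 :: 'v ell2, u)"]
    by linarith
  have spanU: "L w \<in> span U" for w
  proof -
    have 1: "restrict_ell2 ?bd f \<in> span X" for f
      unfolding X_def by (rule in_span_units[OF bd(1)]) simp
    have "(a, 0) \<in> span U" "(0, a) \<in> span U" if "a \<in> span X" for a
    proof -
      have "linear (\<lambda>u :: 'v ell2. (u, 0 :: 'v ell2))" "linear (\<lambda>u :: 'v ell2. (0 :: 'v ell2, u))"
        by (auto intro!: linearI)
      from this[THEN linear_span_image, of X] that
      have "(a, 0 :: 'v ell2) \<in> span ((\<lambda>u. (u, 0)) ` X)" "(0 :: 'v ell2, a) \<in> span ((\<lambda>u. (0, u)) ` X)"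
        by simp_all
      then show "(a, 0) \<in> span U" "(0, a) \<in> span U"
        using span_mono[of _ U] by (auto simp: U_def)
    qed
    then have "(restrict_ell2 ?bd w, 0) + (0, restrict_ell2 ?bd (op w)) \<in> span U"
      by (intro span_add) (use 1 in auto)
    then show ?thesis by (simp add: L_def)
  qed
  obtain B where B: "finite B" "card B \<le> card U" "W \<subseteq> span B"
    using finite_basis_of_injective[OF W L inj finU spanU] by blast
  have "restrict_ell2 \<Omega> (to_ell2 \<phi>) \<in> span B"
    if "\<phi> \<in> L2" "H \<phi> = (\<lambda>x. complex_of_real l * \<phi> x)" for \<phi>
  proof -
    have "op (to_ell2 \<phi>) = l *\<^sub>R to_ell2 \<phi>"
      by (rule ell2_eqI) (simp add: op_to_ell2 that to_ell2_scaleC scaleR_conv_of_real)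
    then have "to_ell2 \<phi> \<in> K" by (simp add: K_def restrict_to_ell2 that)
    then show ?thesis using B(3) by (auto simp: W_def)
  qed
  then show ?thesis using that[OF B(1) order_trans[OF B(2) cardU]] by blast
qed

text \<open>
Normalize \<open>\<phi>\<close> so that \<open>\<phi> x0 = 1\<close>. For each \<open>x\<close> in the orbit some translate of \<open>\<phi>\<close> takes the value
one at \<open>x\<close> and has the same norm \<open>M\<close>. The restrictions of these translates to \<open>\<Omega>\<close> lie in a space of
dimension at most four times the number of boundary vertices, and
\<open>sum_inner_power2_le_dim\<close> counts the points \<open>x\<close>.
\<close>

lemma card_orbit_le_boundary:
  assumes \<phi>: "\<phi> \<in> L2" "H \<phi> = (\<lambda>x. complex_of_real l * \<phi> x)" and x0: "x0 \<in> verts \<Gamma>" "\<phi> x0 \<noteq> 0"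
  shows "\<exists>M. \<forall>\<Omega>. \<Omega> \<subseteq> verts \<Gamma> \<and> finite \<Omega> \<and> uniqueness_on (verts \<Gamma>) mV H l \<Omega> \<longrightarrow>
    real (card (\<Omega> \<inter> orbit G aV x0)) \<le> M * real (card (boundary1 \<Gamma> \<Omega>))"
proof -
  define \<phi>1 where "\<phi>1 x = (1 / \<phi> x0) * \<phi> x" for x
  have \<phi>1: "\<phi>1 \<in> L2" unfolding \<phi>1_def by (rule l2_scale[OF \<phi>(1)])
  have H\<phi>1: "H \<phi>1 = (\<lambda>x. complex_of_real l * \<phi>1 x)"
  proof -
    have "H (\<lambda>x. (1 / \<phi> x0) * \<phi> x) = (\<lambda>x. (1 / \<phi> x0) * H \<phi> x)"
      using bounded_operator_H \<phi>(1) unfolding bounded_operator_def by blast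
    then show ?thesis by (simp add: \<phi>1_def[abs_def] \<phi>(2) mult_ac)
  qed
  have one: "\<phi>1 x0 = 1" using x0(2) by (simp add: \<phi>1_def)
  define M where "M = l2_norm (verts \<Gamma>) mV \<phi>1"
  have m: "0 < mV x0" by (rule mV_pos[OF x0(1)])
  have "\<exists>g. x \<in> orbit G aV x0 \<longrightarrow> g \<in> carrier G \<and> aV g x = x0" for x
  proof (cases "x \<in> orbit G aV x0")
    case True
    then obtain h where h: "h \<in> carrier G" "x = aV h x0" by (auto simp: orbit_def)
    then show ?thesis using act_inverse[OF h(1)] x0(1) by metis
  qed blast
  \<comment> \<open>\<open>\<gamma> x\<close> moves \<open>x\<close> back to \<open>x0\<close>\<close>
  then obtain \<gamma> where \<gamma>: "\<And>x. x \<in> orbit G aV x0 \<Longrightarrow> \<gamma> x \<in> carrier G \<and> aV (\<gamma> x) x = x0" by metis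
  have "real (card (\<Omega> \<inter> orbit G aV x0)) \<le> (M\<^sup>2 * 4 / mV x0) * real (card (boundary1 \<Gamma> \<Omega>))"
    if \<Omega>: "\<Omega> \<subseteq> verts \<Gamma>" "finite \<Omega>" and uniq: "uniqueness_on (verts \<Gamma>) mV H l \<Omega>" for \<Omega>
  proof -
    obtain B where B: "finite B" "card B \<le> 4 * card (boundary1 \<Gamma> \<Omega>)"
      "\<And>\<phi>. \<phi> \<in> L2 \<Longrightarrow> H \<phi> = (\<lambda>x. complex_of_real l * \<phi> x) \<Longrightarrow> restrict_ell2 \<Omega> (to_ell2 \<phi>) \<in> span B"
      using restricted_eigenspace_dim[OF \<Omega> uniq] by blast
    let ?I = "\<Omega> \<inter> orbit G aV x0"
    define w where "w x = restrict_ell2 \<Omega> (to_ell2 (translate (\<gamma> x) \<phi>1))" for x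
    have tr: "translate (\<gamma> x) \<phi>1 \<in> L2" "l2_norm (verts \<Gamma>) mV (translate (\<gamma> x) \<phi>1) = M"
      "H (translate (\<gamma> x) \<phi>1) = (\<lambda>y. complex_of_real l * translate (\<gamma> x) \<phi>1 y)"
      "translate (\<gamma> x) \<phi>1 x = 1" if "x \<in> ?I" for x
      using translate_l2[OF _ \<phi>1, of "\<gamma> x"] eigen_translate[OF _ \<phi>1 H\<phi>1, of "\<gamma> x"] \<gamma>[of x] that \<Omega>(1) one
      by (auto simp: M_def translate_def)
    have mx: "mV x = mV x0" if "x \<in> ?I" for x
      using \<gamma>[of x] that \<Omega>(1) act_verts(2)[of "\<gamma> x" x] by auto
    have "(\<Sum>x\<in>?I. (w x \<bullet> unit_ell2 1 x)\<^sup>2) \<le> M\<^sup>2 * real (card B)"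
    proof (rule sum_inner_power2_le_dim[OF B(1)])
      show "finite ?I" using \<Omega>(2) by blast
      show "unit_ell2 1 x \<bullet> unit_ell2 1 y = (if x = y then 1 else 0)" for x y :: 'v
        by (simp add: inner_unit)
      show "w x \<in> span B" if "x \<in> ?I" for x
        unfolding w_def by (rule B(3)) (use tr that in auto)
      show "norm (w x) \<le> M" if "x \<in> ?I" for x
        using norm_restrict_le[of \<Omega> "to_ell2 (translate (\<gamma> x) \<phi>1)"] tr[OF that] by (simp add: w_def l2_norm_eq)
    qed
    moreover have "(w x \<bullet> unit_ell2 1 x)\<^sup>2 = mV x0" if "x \<in> ?I" for x
    proof -
      have "coord (w x) x = complex_of_real (sqrt (mV x0))"
        using that \<Omega>(1) tr[OF that] mx[OF that] by (auto simp: w_def coord_to_ell2 scaleR_conv_of_real)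
      then show ?thesis using m by (simp add: inner_unit)
    qed
    moreover have "M\<^sup>2 * real (card B) \<le> M\<^sup>2 * (4 * real (card (boundary1 \<Gamma> \<Omega>)))"
      using B(2) by (intro mult_left_mono) auto
    ultimately have "real (card ?I) * mV x0 \<le> M\<^sup>2 * (4 * real (card (boundary1 \<Gamma> \<Omega>)))" by simp
    then show ?thesis using m by (simp add: field_simps)
  qed
  then show ?thesis by blast
qed

text \<open>
If an eigenfunction existed, the two preceding estimates would bound the size of \<open>\<Omega> n\<close> by a
constant multiple of the size of its boundary, uniformly in \<open>n\<close>.
\<close>

theorem no_eigenfunction_if_folner_uniqueness:
  assumes \<Omega>: "folner_sequence \<Gamma> \<Omega>" and uniq: "\<And>n. uniqueness_on (verts \<Gamma>) mV H l (\<Omega> n)"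
  shows "\<not> (\<exists>\<phi>. eigenfunction (verts \<Gamma>) mV H l \<phi>)"
proof
  assume "\<exists>\<phi>. eigenfunction (verts \<Gamma>) mV H l \<phi>"
  then obtain \<phi> x0 where \<phi>: "\<phi> \<in> L2" "H \<phi> = (\<lambda>x. complex_of_real l * \<phi> x)" and x0: "\<phi> x0 \<noteq> 0"
    by (auto simp: eigenfunction_def fun_eq_iff)
  have x0V: "x0 \<in> verts \<Gamma>" using x0 \<phi>(1) by (auto simp: l2_def)
  have \<Omega>n: "\<Omega> n \<subseteq> verts \<Gamma>" "finite (\<Omega> n)" "\<Omega> n \<noteq> {}" for n
    using \<Omega> by (auto simp: folner_sequence_def)
  obtain M where M: "\<And>A. A \<subseteq> verts \<Gamma> \<Longrightarrow> finite A \<Longrightarrow> uniqueness_on (verts \<Gamma>) mV H l A \<Longrightarrow>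
      real (card (A \<inter> orbit G aV x0)) \<le> M * real (card (boundary1 \<Gamma> A))"
    using card_orbit_le_boundary[OF \<phi> x0V x0] by blast
  obtain K where K: "\<And>A. A \<subseteq> verts \<Gamma> \<Longrightarrow> finite A \<Longrightarrow>
      card A \<le> K * (card (A \<inter> orbit G aV x0) + 2 * card (boundary1 \<Gamma> A))"
    using card_le_orbit_boundary[OF x0V] by blast
  define r where "r n = real (card (boundary1 \<Gamma> (\<Omega> n))) / real (card (\<Omega> n))" for n
  have "1 \<le> real K * (M + 2) * r n" for n
  proof -
    have pos: "0 < real (card (\<Omega> n))" using \<Omega>n[of n] by (simp add: card_gt_0_iff)
    have "real (card (\<Omega> n)) \<le> real K * (real (card (\<Omega> n \<inter> orbit G aV x0)) + 2 * real (card (boundary1 \<Gamma> (\<Omega> n))))"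
      using of_nat_mono[OF K[OF \<Omega>n(1,2), of n], where 'a = real] by simp
    also have "\<dots> \<le> real K * (M * real (card (boundary1 \<Gamma> (\<Omega> n))) + 2 * real (card (boundary1 \<Gamma> (\<Omega> n))))"
      using M[OF \<Omega>n(1,2) uniq, of n] by (intro mult_left_mono) auto
    finally show ?thesis using pos by (simp add: r_def field_simps)
  qed
  moreover have "(\<lambda>n. real K * (M + 2) * r n) \<longlonglongrightarrow> real K * (M + 2) * 0"
    using \<Omega> unfolding folner_sequence_def r_def by (intro tendsto_intros) auto
  ultimately have "1 \<le> real K * (M + 2) * 0"
    by (intro LIMSEQ_le_const[of "\<lambda>n. real K * (M + 2) * r n"]) auto
  then show False by simp
qed

end

text \<open>
Distinct points of a fundamental domain have distinct orbits.
\<close>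

lemma fundamental_domain_transversal:
  assumes act: "group_action G V a" and orb: "finite (orbits G V a)" and D: "fundamental_domain G V a D"
  shows "finite D" "D \<subseteq> V" "\<And>x. x \<in> V \<Longrightarrow> \<exists>d\<in>D. \<exists>g\<in>carrier G. x = a g d"
proof -
  interpret group_action G V a by fact
  show sub: "D \<subseteq> V" using D by (simp add: fundamental_domain_def)
  show "\<exists>d\<in>D. \<exists>g\<in>carrier G. x = a g d" if "x \<in> V" for x
    using D that by (force simp: fundamental_domain_def orbit_def)
  have "inj_on (orbit G a) D"
  proof (rule inj_onI)
    fix x y assume xy: "x \<in> D" "y \<in> D" "orbit G a x = orbit G a y"
    have "x \<in> orbit G a x \<inter> orbit G a y" using orbit_refl xy sub by blast
    then show "x = y" using D xy(1,2) by (auto simp: fundamental_domain_def disjoint_family_on_def)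
  qed
  moreover have "orbit G a ` D \<subseteq> orbits G V a" using sub by (auto simp: orbits_def)
  ultimately show "finite D" using orb by (meson finite_imageD finite_subset)
qed

section \<open>The equivalence\<close>

theorem theorem6p6:
  fixes \<Gamma> :: "('v, 'e) pre_digraph" and arev :: "'e \<Rightarrow> 'e"
    and mV :: "'v \<Rightarrow> real" and mE :: "'e \<Rightarrow> real" and q :: "'v \<Rightarrow> real"
    and G :: "('g, 'r) monoid_scheme"
    and aV :: "'g \<Rightarrow> 'v \<Rightarrow> 'v" and aE :: "'g \<Rightarrow> 'e \<Rightarrow> 'e"
    and D V :: "'v set" and H :: "('v \<Rightarrow> complex) \<Rightarrow> ('v \<Rightarrow> complex)" and l0 :: real
  assumes "weighted_graph \<Gamma> arev mV mE"
    and "strongly_connected \<Gamma>"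
    and "sunada_sy \<Gamma> mV mE"
    and "\<exists>\<Omega>. folner_sequence \<Gamma> \<Omega>"
    and "graph_action G \<Gamma> arev aV aE"
    and "invariant_under G (verts \<Gamma>) aV mV"
    and "invariant_under G (arcs \<Gamma>) aE mE"
    and "bounded (q ` verts \<Gamma>)"
    and "invariant_under G (verts \<Gamma>) aV q"
    and "finite (orbits G (verts \<Gamma>) aV)"
    and "fundamental_domain G (verts \<Gamma>) aV D"
    and V_def: "V = verts \<Gamma>"
    and H_def: "H = schroedinger \<Gamma> mV mE q"
  shows
    "((\<forall>\<Omega>. \<Omega> \<subseteq> V \<and> finite \<Omega> \<longrightarrow> uniqueness_on V mV H l0 \<Omega>)
        \<longleftrightarrow> (\<exists>\<Omega>. folner_sequence \<Gamma> \<Omega> \<and> (\<forall>n. uniqueness_on V mV H l0 (\<Omega> n)))) \<and>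
     ((\<exists>\<Omega>. folner_sequence \<Gamma> \<Omega> \<and> (\<forall>n. uniqueness_on V mV H l0 (\<Omega> n)))
        \<longleftrightarrow> spectral_projection V mV H {l0} = zero_operator V mV) \<and>
     (spectral_projection V mV H {l0} = zero_operator V mV
        \<longleftrightarrow> \<not> (\<exists>\<phi>. eigenfunction V mV H l0 \<phi>)) \<and>
     (\<not> (\<exists>\<phi>. eigenfunction V mV H l0 \<phi>)
        \<longleftrightarrow> \<not> (\<exists>\<phi>. eigenfunction V mV H l0 \<phi> \<and> finite {x \<in> V. \<phi> x \<noteq> 0})) \<and>
     (\<not> (\<exists>\<phi>. eigenfunction V mV H l0 \<phi> \<and> finite {x \<in> V. \<phi> x \<noteq> 0})
        \<longleftrightarrow> isCont (integrated_density_of_states V mV D H) l0)"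
proof -
  interpret weighted_graph \<Gamma> arev mV mE by fact
  obtain C where C: "\<And>x. x \<in> verts \<Gamma> \<Longrightarrow> mE summable_on out_arcs \<Gamma> x \<and>
      (1 / mV x) * (\<Sum>\<^sub>\<infinity>e\<in>out_arcs \<Gamma> x. mE e) \<le> C"
    using \<open>sunada_sy \<Gamma> mV mE\<close> by (auto simp: sunada_sy_def)
  obtain Q where Q: "\<And>x. x \<in> verts \<Gamma> \<Longrightarrow> \<bar>q x\<bar> \<le> Q"
    using \<open>bounded (q ` verts \<Gamma>)\<close> by (auto simp: bounded_iff)
  have "group_action G (verts \<Gamma>) aV"
    using \<open>graph_action G \<Gamma> arev aV aE\<close> by (simp add: graph_action_def)
  note D = fundamental_domain_transversal[OF this assms(10,11)]
  interpret periodic_graph \<Gamma> arev mV mE q "max C 0" "max Q 0" G aV aE D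
  proof unfold_locales
    fix x assume x: "x \<in> verts \<Gamma>"
    show "mE summable_on out_arcs \<Gamma> x" using C[OF x] by blast
    have "(\<Sum>\<^sub>\<infinity>e\<in>out_arcs \<Gamma> x. mE e) \<le> C * mV x" using C[OF x] mV_pos[OF x] by (simp add: field_simps)
    also have "\<dots> \<le> max C 0 * mV x" using mV_pos[OF x] by (intro mult_right_mono) auto
    finally show "(\<Sum>\<^sub>\<infinity>e\<in>out_arcs \<Gamma> x. mE e) \<le> max C 0 * mV x" .
    show "\<bar>q x\<bar> \<le> max Q 0" using Q[OF x] by simp
    show "\<exists>d\<in>D. \<exists>g\<in>carrier G. x = aV g d" by (rule D(3)[OF x])
  qed (use assms D(1,2) in auto)
  have "verts \<Gamma> \<noteq> {}" using \<open>strongly_connected \<Gamma>\<close> by (simp add: strongly_connected_def)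
  then have "D \<noteq> {}" using D(3) by blast
  let ?c1 = "\<forall>\<Omega>. \<Omega> \<subseteq> V \<and> finite \<Omega> \<longrightarrow> uniqueness_on V mV H l0 \<Omega>"
  let ?c2 = "\<exists>\<Omega>. folner_sequence \<Gamma> \<Omega> \<and> (\<forall>n. uniqueness_on V mV H l0 (\<Omega> n))"
  let ?c3 = "spectral_projection V mV H {l0} = zero_operator V mV"
  let ?c4 = "\<not> (\<exists>\<phi>. eigenfunction V mV H l0 \<phi>)"
  let ?c5 = "\<not> (\<exists>\<phi>. eigenfunction V mV H l0 \<phi> \<and> finite {x \<in> V. \<phi> x \<noteq> 0})"
  let ?c6 = "isCont (integrated_density_of_states V mV D H) l0"
  have "?c1 \<Longrightarrow> ?c2"
    using \<open>\<exists>\<Omega>. folner_sequence \<Gamma> \<Omega>\<close> by (auto simp: folner_sequence_def V_def)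
  moreover have "?c2 \<Longrightarrow> ?c4"
    using no_eigenfunction_if_folner_uniqueness unfolding V_def H_def by blast
  moreover have "?c3 \<longleftrightarrow> ?c4"
    unfolding V_def H_def by (rule spectral_projection_eq_zero_iff)
  moreover have "?c4 \<Longrightarrow> ?c5" by blast
  moreover have "?c5 \<Longrightarrow> ?c1"
  proof (intro allI impI)
    fix \<Omega> assume 5: ?c5 and \<Omega>: "\<Omega> \<subseteq> V \<and> finite \<Omega>"
    show "uniqueness_on V mV H l0 \<Omega>"
      unfolding uniqueness_on_def
    proof (intro ballI impI, rule ccontr)
      fix \<phi> x assume \<phi>: "\<phi> \<in> l2 V mV" "H \<phi> = (\<lambda>x. complex_of_real l0 * \<phi> x) \<and> (\<forall>x\<in>V - \<Omega>. \<phi> x = 0)"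
        and x: "x \<in> V" "\<phi> x \<noteq> 0"
      have "{x \<in> V. \<phi> x \<noteq> 0} \<subseteq> \<Omega>" using \<phi>(2) by blast
      then have "finite {x \<in> V. \<phi> x \<noteq> 0}" using \<Omega> finite_subset by blast
      moreover have "eigenfunction V mV H l0 \<phi>" using \<phi> x by (auto simp: eigenfunction_def)
      ultimately show False using 5 by blast
    qed
  qed
  moreover have "?c6 \<longleftrightarrow> ?c4"
  proof -
    have "?c6 \<longleftrightarrow> (\<forall>d\<in>D. \<forall>\<phi>. eigenfunction (verts \<Gamma>) mV (schroedinger \<Gamma> mV mE q) l0 \<phi> \<longrightarrow> \<phi> d = 0)"
      unfolding V_def H_def isCont_integrated_density_of_states_iff[OF D(1) \<open>D \<noteq> {}\<close> D(2)]
      using spectral_atom_iff D(2) by blast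
    then show ?thesis using eigenfunction_meets_domain unfolding V_def H_def by blast
  qed
  ultimately show ?thesis by argo
qed

end
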